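(* Let $(A,S)$ be a relative pair and let $e\in S$ be an idempotent such that $S$ is diagonal with respect to $e$. Suppose that $(A,S)$ admits an $LU$-decomposition (with respect to $e$) with subrings $L$ and $U$. Then $AeA$ is an $(A,S)$-stratifying ideal, i.e. $\mathrm{Tor}^{(A,S)}_k(A/AeA,\,A/AeA)=0$ for all $k\ge 1$.
   Context: Relative pair: $(A,S)$ where $A$ is a ring with identity $1$ and $S$ is a subring of $A$ containing $1$. For an idempotent $e\in S$ put $\bar e=1-e$. A subring $B$ of $A$ containing $S$ is called upper triangular if $\bar e B e=0$, lower triangular if $eB\bar e=0$, and diagonal if $\bar e B e=eB\bar e=0$. Twisted product: if $A_1,A_2$ are subrings of $A$ containing $S$, then $(A,S)$ is a twisted product of $A_1$ and $A_2$ (in this order) if the map $\alpha\colon A_1\otimes_S A_2\to A$, $a_1\otimes a_2\mapsto a_1a_2$, is an isomorphism of abelian groups. $LU$-decomposition: for a relative pair $(A,S)$ with $S$ diagonal with respect to the idempotent $e\in S$, an $LU$-decomposition consists of subrings $L$ and $U$ of $A$ containing $S$ such that (1) $(A,S)$ is a twisted product of $L$ and $U$; (2) $L$ is lower triangular; (3) $U$ is upper triangular. Relative Tor: let $\beta(A,S,A)$ be the complex of $A$-$A$-bimodules with $\beta_k=A^{\otimes_S(k+1)}\otimes_S A$ for $k\ge 0$ and differential $d_k\colon\beta_k\to\beta_{k-1}$ ($k\ge1$), $d_k(a_0\otimes\cdots\otimes a_{k+1})=\sum_{j=0}^{k}(-1)^j a_0\otimes\cdots\otimes a_ja_{j+1}\otimes\cdots\otimes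 a_{k+1}$. For a right $A$-module $N$ and a left $A$-module $M$, $\mathrm{Tor}^{(A,S)}_k(N,M)=H_k(N\otimes_A\beta(A,S,A)\otimes_A M)$. $(A,S)$-stratifying: for an idempotent $e\in S$, the ideal $AeA$ is $(A,S)$-stratifying if $\mathrm{Tor}^{(A,S)}_k(A/AeA,A/AeA)=0$ for all $k\ge 1$. *)

theory Defs
  imports "HOL-Algebra.Free_Abelian_Groups" "HOL-Algebra.Subrings" "HOL-Algebra.QuotRing"
begin

text \<open>
  Rings are the (possibly zero, not necessarily commutative) unital rings of HOL-Algebra;
  \<open>subring\<close> of HOL-Algebra requires the subring to contain the identity of the big ring.
  Right and left modules are given by an abelian group (a monoid record, written multiplicatively
  by HOL-Algebra, with \<open>add_monoid\<close> turning the additive group of a ring into one) together with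
  an action function of type \<open>'m \<Rightarrow> 'r \<Rightarrow> 'm\<close>, respectively \<open>'r \<Rightarrow> 'n \<Rightarrow> 'n\<close>.
\<close>

section \<open>Abelian groups given by generators and relations\<close>

definition rel_subgroup :: "'a set \<Rightarrow> ('a \<Rightarrow>\<^sub>0 int) set \<Rightarrow> ('a \<Rightarrow>\<^sub>0 int) set"
  where "rel_subgroup B R = generate (free_Abelian_group B) R"

definition presented_group :: "'a set \<Rightarrow> ('a \<Rightarrow>\<^sub>0 int) set \<Rightarrow> ('a \<Rightarrow>\<^sub>0 int) set monoid"
  where "presented_group B R = free_Abelian_group B Mod rel_subgroup B R"

definition gen_class :: "'a set \<Rightarrow> ('a \<Rightarrow>\<^sub>0 int) set \<Rightarrow> 'a \<Rightarrow> ('a \<Rightarrow>\<^sub>0 int) set"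
  where "gen_class B R x = rel_subgroup B R #>\<^bsub>free_Abelian_group B\<^esub> frag_of x"

text \<open>
  The map into \<open>presented_group Y T\<close> induced by the map \<open>f\<close> that sends each generator to a formal
  linear combination of elements of \<open>Y\<close>.  If the linear extension of \<open>f\<close> sends relations to
  relations, the value at a coset \<open>C\<close> is the coset of the image of any representative of \<open>C\<close>.
\<close>

definition induced_map ::
    "'b set \<Rightarrow> ('b \<Rightarrow>\<^sub>0 int) set \<Rightarrow> ('a \<Rightarrow> ('b \<Rightarrow>\<^sub>0 int)) \<Rightarrow> ('a \<Rightarrow>\<^sub>0 int) set \<Rightarrow> ('b \<Rightarrow>\<^sub>0 int) set"
  where "induced_map Y T f C = rel_subgroup Y T <#>\<^bsub>free_Abelian_group Y\<^esub> (frag_extend f ` C)"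


section \<open>The tensor product of a right and a left module\<close>

definition tensor_rels ::
    "'r set \<Rightarrow> ('m, 'x) monoid_scheme \<Rightarrow> ('m \<Rightarrow> 'r \<Rightarrow> 'm) \<Rightarrow> ('n, 'y) monoid_scheme \<Rightarrow> ('r \<Rightarrow> 'n \<Rightarrow> 'n)
      \<Rightarrow> (('m \<times> 'n) \<Rightarrow>\<^sub>0 int) set"
  where "tensor_rels R M ract N lact =
      {frag_of (x \<otimes>\<^bsub>M\<^esub> x', y) - frag_of (x, y) - frag_of (x', y) | x x' y.
          x \<in> carrier M \<and> x' \<in> carrier M \<and> y \<in> carrier N}
    \<union> {frag_of (x, y \<otimes>\<^bsub>N\<^esub> y') - frag_of (x, y) - frag_of (x, y') | x y y'.
          x \<in> carrier M \<and> y \<in> carrier N \<and> y' \<in> carrier N}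
    \<union> {frag_of (ract x r, y) - frag_of (x, lact r y) | x r y.
          x \<in> carrier M \<and> r \<in> R \<and> y \<in> carrier N}"

definition tensor ::
    "'r set \<Rightarrow> ('m, 'x) monoid_scheme \<Rightarrow> ('m \<Rightarrow> 'r \<Rightarrow> 'm) \<Rightarrow> ('n, 'y) monoid_scheme \<Rightarrow> ('r \<Rightarrow> 'n \<Rightarrow> 'n)
      \<Rightarrow> (('m \<times> 'n) \<Rightarrow>\<^sub>0 int) set monoid"
  where "tensor R M ract N lact =
    presented_group (carrier M \<times> carrier N) (tensor_rels R M ract N lact)"

definition pure_tensor ::
    "'r set \<Rightarrow> ('m, 'x) monoid_scheme \<Rightarrow> ('m \<Rightarrow> 'r \<Rightarrow> 'm) \<Rightarrow> ('n, 'y) monoid_scheme \<Rightarrow> ('r \<Rightarrow> 'n \<Rightarrow> 'n)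
      \<Rightarrow> 'm \<Rightarrow> 'n \<Rightarrow> (('m \<times> 'n) \<Rightarrow>\<^sub>0 int) set"
  where "pure_tensor R M ract N lact x y =
    gen_class (carrier M \<times> carrier N) (tensor_rels R M ract N lact) (x, y)"

text \<open>The map \<open>f \<otimes> g\<close> into the tensor product of \<open>M\<close> and \<open>N\<close>; only the target module
  structures enter the definition.\<close>

definition tensor_map ::
    "'r set \<Rightarrow> ('m, 'x) monoid_scheme \<Rightarrow> ('m \<Rightarrow> 'r \<Rightarrow> 'm) \<Rightarrow> ('n, 'y) monoid_scheme \<Rightarrow> ('r \<Rightarrow> 'n \<Rightarrow> 'n)
      \<Rightarrow> ('a \<Rightarrow> 'm) \<Rightarrow> ('b \<Rightarrow> 'n) \<Rightarrow> (('a \<times> 'b) \<Rightarrow>\<^sub>0 int) set \<Rightarrow> (('m \<times> 'n) \<Rightarrow>\<^sub>0 int) set"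
  where "tensor_map R M ract N lact f g =
    induced_map (carrier M \<times> carrier N) (tensor_rels R M ract N lact)
      (\<lambda>(x, y). frag_of (f x, g y))"


section \<open>Relative pairs, triangular subrings, LU-decompositions\<close>

locale relative_pair = ring A + subring S A for A (structure) and S

definition upper_triangular :: "('a, 'm) ring_scheme \<Rightarrow> 'a \<Rightarrow> 'a set \<Rightarrow> bool"
  where "upper_triangular A e B \<longleftrightarrow>
    (\<forall>b\<in>B. (\<one>\<^bsub>A\<^esub> \<ominus>\<^bsub>A\<^esub> e) \<otimes>\<^bsub>A\<^esub> b \<otimes>\<^bsub>A\<^esub> e = \<zero>\<^bsub>A\<^esub>)"

definition lower_triangular :: "('a, 'm) ring_scheme \<Rightarrow> 'a \<Rightarrow> 'a set \<Rightarrow> bool"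
  where "lower_triangular A e B \<longleftrightarrow>
    (\<forall>b\<in>B. e \<otimes>\<^bsub>A\<^esub> b \<otimes>\<^bsub>A\<^esub> (\<one>\<^bsub>A\<^esub> \<ominus>\<^bsub>A\<^esub> e) = \<zero>\<^bsub>A\<^esub>)"

definition diagonal :: "('a, 'm) ring_scheme \<Rightarrow> 'a \<Rightarrow> 'a set \<Rightarrow> bool"
  where "diagonal A e B \<longleftrightarrow> upper_triangular A e B \<and> lower_triangular A e B"

text \<open>The isomorphism below is unique, since the pure tensors generate the tensor product.\<close>

definition twisted_product :: "('a, 'm) ring_scheme \<Rightarrow> 'a set \<Rightarrow> 'a set \<Rightarrow> 'a set \<Rightarrow> bool"
  where "twisted_product A S A1 A2 \<longleftrightarrow>
    (let M1 = add_monoid A\<lparr>carrier := A1\<rparr>; M2 = add_monoid A\<lparr>carrier := A2\<rparr> in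
      \<exists>\<alpha> \<in> iso (tensor S M1 (mult A) M2 (mult A)) (add_monoid A).
        \<forall>a1\<in>A1. \<forall>a2\<in>A2. \<alpha> (pure_tensor S M1 (mult A) M2 (mult A) a1 a2) = a1 \<otimes>\<^bsub>A\<^esub> a2)"

definition LU_decomposition ::
    "('a, 'm) ring_scheme \<Rightarrow> 'a set \<Rightarrow> 'a \<Rightarrow> 'a set \<Rightarrow> 'a set \<Rightarrow> bool"
  where "LU_decomposition A S e L U \<longleftrightarrow>
    subring L A \<and> S \<subseteq> L \<and> subring U A \<and> S \<subseteq> U \<and>
    twisted_product A S L U \<and> lower_triangular A e L \<and> upper_triangular A e U"


section \<open>The relative bar complex\<close>

text \<open>
  The tensor power \<open>A \<otimes>\<^sub>S \<dots> \<otimes>\<^sub>S A\<close> with \<open>n\<close> factors is presented directly, without bracketing, by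
  generators \<open>[a\<^sub>0, \<dots>, a\<^sub>n\<^sub>-\<^sub>1]\<close> subject to additivity in every entry and to \<open>S\<close>-balancedness between
  every two neighbouring entries.  (Iterating the binary construction would change the type in
  each step.)  The bar complex in degree \<open>k\<close> is the tensor power with \<open>k + 2\<close> factors.
\<close>

definition tpower_gens :: "('a, 'm) ring_scheme \<Rightarrow> nat \<Rightarrow> 'a list set"
  where "tpower_gens A n = {as. length as = n \<and> set as \<subseteq> carrier A}"

definition tpower_rels :: "('a, 'm) ring_scheme \<Rightarrow> 'a set \<Rightarrow> nat \<Rightarrow> ('a list \<Rightarrow>\<^sub>0 int) set"
  where "tpower_rels A S n =
      {frag_of (as @ [x \<oplus>\<^bsub>A\<^esub> y] @ bs) - frag_of (as @ [x] @ bs) - frag_of (as @ [y] @ bs) | as x y bs.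
          length as + 1 + length bs = n \<and> set as \<union> {x, y} \<union> set bs \<subseteq> carrier A}
    \<union> {frag_of (as @ [x \<otimes>\<^bsub>A\<^esub> s, y] @ bs) - frag_of (as @ [x, s \<otimes>\<^bsub>A\<^esub> y] @ bs) | as x s y bs.
          length as + 2 + length bs = n \<and> s \<in> S \<and> set as \<union> {x, y} \<union> set bs \<subseteq> carrier A}"

definition bar :: "('a, 'm) ring_scheme \<Rightarrow> 'a set \<Rightarrow> nat \<Rightarrow> ('a list \<Rightarrow>\<^sub>0 int) set monoid"
  where "bar A S k = presented_group (tpower_gens A (k + 2)) (tpower_rels A S (k + 2))"

definition bar_lact ::
    "('a, 'm) ring_scheme \<Rightarrow> 'a set \<Rightarrow> nat \<Rightarrow> 'a \<Rightarrow> ('a list \<Rightarrow>\<^sub>0 int) set \<Rightarrow> ('a list \<Rightarrow>\<^sub>0 int) set"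
  where "bar_lact A S k a =
    induced_map (tpower_gens A (k + 2)) (tpower_rels A S (k + 2))
      (\<lambda>as. frag_of ((a \<otimes>\<^bsub>A\<^esub> hd as) # tl as))"

definition bar_ract ::
    "('a, 'm) ring_scheme \<Rightarrow> 'a set \<Rightarrow> nat \<Rightarrow> ('a list \<Rightarrow>\<^sub>0 int) set \<Rightarrow> 'a \<Rightarrow> ('a list \<Rightarrow>\<^sub>0 int) set"
  where "bar_ract A S k b a =
    induced_map (tpower_gens A (k + 2)) (tpower_rels A S (k + 2))
      (\<lambda>as. frag_of (butlast as @ [last as \<otimes>\<^bsub>A\<^esub> a])) b"

definition face :: "('a, 'm) ring_scheme \<Rightarrow> nat \<Rightarrow> 'a list \<Rightarrow> 'a list"
  where "face A j as = take j as @ [as ! j \<otimes>\<^bsub>A\<^esub> as ! Suc j] @ drop (j + 2) as"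

text \<open>The differential from degree \<open>k\<close> to degree \<open>k - 1\<close>; it is only used for \<open>k \<ge> 1\<close>.\<close>

definition bar_diff ::
    "('a, 'm) ring_scheme \<Rightarrow> 'a set \<Rightarrow> nat \<Rightarrow> ('a list \<Rightarrow>\<^sub>0 int) set \<Rightarrow> ('a list \<Rightarrow>\<^sub>0 int) set"
  where "bar_diff A S k =
    induced_map (tpower_gens A (k + 1)) (tpower_rels A S (k + 1))
      (\<lambda>as. \<Sum>j\<le>k. frag_cmul ((-1) ^ j) (frag_of (face A j as)))"


section \<open>Relative Tor\<close>

text \<open>Here \<open>C k\<close> is the group in degree \<open>k\<close> and \<open>d k\<close> maps degree \<open>k\<close> to degree \<open>k - 1\<close>
  (the differential out of degree 0 being zero).\<close>

definition chain_homology :: "(nat \<Rightarrow> 'c monoid) \<Rightarrow> (nat \<Rightarrow> 'c \<Rightarrow> 'c) \<Rightarrow> nat \<Rightarrow> 'c set monoid"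
  where "chain_homology C d k =
    (C k)\<lparr>carrier := (if k = 0 then carrier (C 0) else kernel (C k) (C (k - 1)) (d k))\<rparr>
      Mod (d (Suc k) ` carrier (C (Suc k)))"

type_synonym ('n, 'a) tensor_bar = "(('n \<times> ('a list \<Rightarrow>\<^sub>0 int) set) \<Rightarrow>\<^sub>0 int) set"

text \<open>The right module \<open>N \<otimes>\<^sub>A \<beta>\<^sub>k\<close> with its action, and the map \<open>1 \<otimes> d\<^sub>k\<close>.\<close>

definition N_bar ::
    "('a, 'm) ring_scheme \<Rightarrow> 'a set \<Rightarrow> ('n, 'x) monoid_scheme \<Rightarrow> ('n \<Rightarrow> 'a \<Rightarrow> 'n) \<Rightarrow> nat
      \<Rightarrow> ('n, 'a) tensor_bar monoid"
  where "N_bar A S N rN k = tensor (carrier A) N rN (bar A S k) (bar_lact A S k)"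

definition N_bar_ract ::
    "('a, 'm) ring_scheme \<Rightarrow> 'a set \<Rightarrow> ('n, 'x) monoid_scheme \<Rightarrow> ('n \<Rightarrow> 'a \<Rightarrow> 'n) \<Rightarrow> nat
      \<Rightarrow> ('n, 'a) tensor_bar \<Rightarrow> 'a \<Rightarrow> ('n, 'a) tensor_bar"
  where "N_bar_ract A S N rN k t a =
    tensor_map (carrier A) N rN (bar A S k) (bar_lact A S k) id (\<lambda>b. bar_ract A S k b a) t"

definition N_bar_diff ::
    "('a, 'm) ring_scheme \<Rightarrow> 'a set \<Rightarrow> ('n, 'x) monoid_scheme \<Rightarrow> ('n \<Rightarrow> 'a \<Rightarrow> 'n) \<Rightarrow> nat
      \<Rightarrow> ('n, 'a) tensor_bar \<Rightarrow> ('n, 'a) tensor_bar"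
  where "N_bar_diff A S N rN k =
    tensor_map (carrier A) N rN (bar A S (k - 1)) (bar_lact A S (k - 1)) id (bar_diff A S k)"

definition rel_Tor_complex ::
    "('a, 'm) ring_scheme \<Rightarrow> 'a set \<Rightarrow> ('n, 'x) monoid_scheme \<Rightarrow> ('n \<Rightarrow> 'a \<Rightarrow> 'n)
      \<Rightarrow> ('l, 'y) monoid_scheme \<Rightarrow> ('a \<Rightarrow> 'l \<Rightarrow> 'l) \<Rightarrow> nat
      \<Rightarrow> ((('n, 'a) tensor_bar \<times> 'l) \<Rightarrow>\<^sub>0 int) set monoid"
  where "rel_Tor_complex A S N rN M lM k =
    tensor (carrier A) (N_bar A S N rN k) (N_bar_ract A S N rN k) M lM"

definition rel_Tor_diff ::
    "('a, 'm) ring_scheme \<Rightarrow> 'a set \<Rightarrow> ('n, 'x) monoid_scheme \<Rightarrow> ('n \<Rightarrow> 'a \<Rightarrow> 'n)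
      \<Rightarrow> ('l, 'y) monoid_scheme \<Rightarrow> ('a \<Rightarrow> 'l \<Rightarrow> 'l) \<Rightarrow> nat
      \<Rightarrow> ((('n, 'a) tensor_bar \<times> 'l) \<Rightarrow>\<^sub>0 int) set \<Rightarrow> ((('n, 'a) tensor_bar \<times> 'l) \<Rightarrow>\<^sub>0 int) set"
  where "rel_Tor_diff A S N rN M lM k =
    tensor_map (carrier A) (N_bar A S N rN (k - 1)) (N_bar_ract A S N rN (k - 1)) M lM
      (N_bar_diff A S N rN k) id"

definition rel_Tor ::
    "('a, 'm) ring_scheme \<Rightarrow> 'a set \<Rightarrow> ('n, 'x) monoid_scheme \<Rightarrow> ('n \<Rightarrow> 'a \<Rightarrow> 'n)
      \<Rightarrow> ('l, 'y) monoid_scheme \<Rightarrow> ('a \<Rightarrow> 'l \<Rightarrow> 'l) \<Rightarrow> nat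
      \<Rightarrow> ((('n, 'a) tensor_bar \<times> 'l) \<Rightarrow>\<^sub>0 int) set set monoid"
  where "rel_Tor A S N rN M lM k =
    chain_homology (rel_Tor_complex A S N rN M lM) (rel_Tor_diff A S N rN M lM) k"


section \<open>Stratifying ideals\<close>

text \<open>The ideal \<open>AeA\<close>: the additive span of all products \<open>a e b\<close>.\<close>

definition AeA :: "('a, 'm) ring_scheme \<Rightarrow> 'a \<Rightarrow> 'a set"
  where "AeA A e = generate (add_monoid A)
    {a \<otimes>\<^bsub>A\<^esub> e \<otimes>\<^bsub>A\<^esub> b | a b. a \<in> carrier A \<and> b \<in> carrier A}"

text \<open>\<open>A/I\<close> as a right and as a left \<open>A\<close>-module, through the projection onto the quotient ring.\<close>

definition quot_ract :: "('a, 'm) ring_scheme \<Rightarrow> 'a set \<Rightarrow> 'a set \<Rightarrow> 'a \<Rightarrow> 'a set"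
  where "quot_ract A I x a = x \<otimes>\<^bsub>A Quot I\<^esub> (I +>\<^bsub>A\<^esub> a)"

definition quot_lact :: "('a, 'm) ring_scheme \<Rightarrow> 'a set \<Rightarrow> 'a \<Rightarrow> 'a set \<Rightarrow> 'a set"
  where "quot_lact A I a x = (I +>\<^bsub>A\<^esub> a) \<otimes>\<^bsub>A Quot I\<^esub> x"

definition rel_stratifying :: "('a, 'm) ring_scheme \<Rightarrow> 'a set \<Rightarrow> 'a set \<Rightarrow> bool"
  where "rel_stratifying A S I \<longleftrightarrow>
    (\<forall>k\<ge>1. trivial_group
      (rel_Tor A S (add_monoid (A Quot I)) (quot_ract A I) (add_monoid (A Quot I)) (quot_lact A I) k))"

end

theory Submission
  imports Defs
begin

text \<open>
  Put \<open>I = AeA\<close>.  Since \<open>L\<close> is lower and \<open>U\<close> is upper triangular, \<open>u e = e u e\<close> and \<open>e l = e l e\<close>,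
  and these identities collapse \<open>A e A = L U e L U\<close> to the span of the products \<open>(l e) (e u)\<close>.
  Hence, with \<open>L' = L/Le\<close> and \<open>U' = U/eU\<close>, the right module \<open>A/I\<close> is induced from the right
  \<open>L\<close>-module \<open>L'\<close>, while as a left \<open>L\<close>-module \<open>A/I = L \<otimes>\<^sub>S U'\<close> is relatively projective.  Since
  \<open>A = L \<otimes>\<^sub>S U\<close> is relatively projective over \<open>L\<close> too, relative Tor over \<open>A\<close> of \<open>A/I\<close> with itself
  is relative Tor over \<open>L\<close> of \<open>L'\<close> with \<open>L \<otimes>\<^sub>S U'\<close>, which vanishes in positive degrees.

  Unwinding this change of rings gives an explicit contracting homotopy \<open>h\<close>, and the proof uses only
  that homotopy.  On \<open>A \<otimes>\<^sub>S \<dots> \<otimes>\<^sub>S A\<close> it is determined by \<open>h (l u) = l \<otimes> u\<close> and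
  \<open>h (l u \<otimes> a \<otimes> x) = l \<otimes> u \<otimes> a \<otimes> x - l \<otimes> h (u a \<otimes> x)\<close>, and it satisfies
  \<open>h d + d h = 1\<close> for the bar differential \<open>d\<close>.  Because \<open>I\<close> is spanned by the products
  \<open>(l e) (e u)\<close>, \<open>h\<close> preserves the span of the tensors whose first or last entry lies in \<open>I\<close>.
  It therefore descends to the quotient by that span, which is the complex computing the
  relative Tor of \<open>A/I\<close> with itself.

  Everything is carried out for functions rather than for tensors.  A homomorphism out of
  \<open>A \<otimes>\<^sub>S \<dots> \<otimes>\<^sub>S A\<close> is a function on lists that is additive in each entry and \<open>S\<close>-balanced
  (\<open>tensorial\<close>), so \<open>d\<close> and \<open>h\<close> become the operators \<open>codiff\<close> and \<open>htpy\<close> on such functions, and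
  well-definedness of \<open>h\<close> becomes the statement that \<open>htpy\<close> preserves \<open>tensorial\<close>.  The values are
  taken in a free abelian group modulo a subgroup \<open>K\<close>, so that all identities are identities in a
  type of class \<open>ab_group_add\<close> and only membership in \<open>K\<close> has to be tracked.

  The result on functions is \<open>cocycle_is_coboundary\<close>.  To get back to the complex, let \<open>C\<close> denote
  the complex for \<open>A/I\<close> and let \<open>\<zeta>\<close> map a bar chain \<open>x\<close> to \<open>1 \<otimes> x \<otimes> 1\<close>; this is a surjective chain
  map.  The tautological function that sends a list to its own class modulo the boundaries of \<open>C\<close> is
  a cocycle, hence the coboundary of a function that induces a homomorphism on \<open>C\<close> one degree lower.
  So the projection of \<open>C\<close> onto its quotient by the boundaries factors through the differential,
  and every cycle is a boundary (\<open>Tor_vanishes\<close>).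
\<close>

section \<open>Subgroups of free abelian groups\<close>

text \<open>
  A congruence in a free abelian group, given by the subgroup \<open>R\<close> of the elements that count as zero.
  Equations in the quotient are stated as memberships \<open>x - y \<in> R\<close>, which combine by
  \<open>algebra_simps\<close>; reasoning with cosets would need closedness side conditions at every step.
\<close>

locale frag_subgroup =
  fixes R :: "('b \<Rightarrow>\<^sub>0 int) set"
  assumes zero_mem [simp]: "0 \<in> R"
    and diff_mem: "x \<in> R \<Longrightarrow> y \<in> R \<Longrightarrow> x - y \<in> R"
begin

lemma uminus_mem: "x \<in> R \<Longrightarrow> - x \<in> R"
  using diff_mem[of 0 x] by simp

lemma add_mem: "x \<in> R \<Longrightarrow> y \<in> R \<Longrightarrow> x + y \<in> R"
  using diff_mem[of x "- y"] uminus_mem[of y] by simp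

lemma frag_extend_mem:
  assumes "Poly_Mapping.keys z \<subseteq> X" "\<And>x. x \<in> X \<Longrightarrow> q x \<in> R"
  shows "frag_extend q z \<in> R"
  using assms(1) by (induction z rule: frag_induction) (auto simp: frag_extend_diff assms(2) diff_mem)

end

lemma frag_extend_plus: "frag_extend (\<lambda>x. q x + q' x) z = frag_extend q z + frag_extend q' z"
  by (induction z rule: frag_induction[OF subset_refl]) (auto simp: frag_extend_diff)

lemma frag_extend_minus_fun: "frag_extend (\<lambda>x. q x - q' x) z = frag_extend q z - frag_extend q' z"
  by (induction z rule: frag_induction[OF subset_refl]) (auto simp: frag_extend_diff)

lemma frag_extend_frag_extend:
  "frag_extend f (frag_extend g z) = frag_extend (\<lambda>x. frag_extend f (g x)) z"
  by (induction z rule: frag_induction[OF subset_refl]) (auto simp: frag_extend_diff)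

lemma keys_diff_subset:
  "Poly_Mapping.keys a \<subseteq> X \<Longrightarrow> Poly_Mapping.keys b \<subseteq> X \<Longrightarrow> Poly_Mapping.keys (a - b) \<subseteq> X"
  using keys_diff[of a b] by blast

lemma keys_frag_extend_subset:
  assumes "Poly_Mapping.keys z \<subseteq> X" "\<And>x. x \<in> X \<Longrightarrow> Poly_Mapping.keys (q x) \<subseteq> Y"
  shows "Poly_Mapping.keys (frag_extend q z) \<subseteq> Y"
  using assms keys_frag_extend[of q z] by blast

section \<open>Groups given by generators and relations\<close>

text \<open>
  This extends \<open>gen_class\<close> from generators to formal linear combinations of generators.
\<close>

definition rel_class :: "'a set \<Rightarrow> ('a \<Rightarrow>\<^sub>0 int) set \<Rightarrow> ('a \<Rightarrow>\<^sub>0 int) \<Rightarrow> ('a \<Rightarrow>\<^sub>0 int) set"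
  where "rel_class B R z = rel_subgroup B R #>\<^bsub>free_Abelian_group B\<^esub> z"

lemma gen_class_eq_rel_class: "gen_class B R x = rel_class B R (frag_of x)"
  by (simp add: gen_class_def rel_class_def)

locale presentation =
  fixes B :: "'a set" and R :: "('a \<Rightarrow>\<^sub>0 int) set"
  assumes rels_closed: "R \<subseteq> carrier (free_Abelian_group B)"
begin

lemma subgroup_rel: "subgroup (rel_subgroup B R) (free_Abelian_group B)"
  unfolding rel_subgroup_def by (rule group.generate_is_subgroup[OF group_free_Abelian_group rels_closed])

lemma normal_rel: "rel_subgroup B R \<lhd> free_Abelian_group B"
  using comm_group.subgroup_imp_normal[OF abelian_free_Abelian_group subgroup_rel] .

lemma rel_subgroup_keys: "z \<in> rel_subgroup B R \<Longrightarrow> Poly_Mapping.keys z \<subseteq> B"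
  using subsetD[OF subgroup.subset[OF subgroup_rel]] by simp

sublocale rel: frag_subgroup "rel_subgroup B R"
proof
  show "0 \<in> rel_subgroup B R"
    using subgroup.one_closed[OF subgroup_rel] by simp
next
  fix x y assume xy: "x \<in> rel_subgroup B R" "y \<in> rel_subgroup B R"
  have "- y \<in> rel_subgroup B R"
    using subgroup.m_inv_closed[OF subgroup_rel xy(2)] rel_subgroup_keys[OF xy(2)] by simp
  from subgroup.m_closed[OF subgroup_rel xy(1) this] show "x - y \<in> rel_subgroup B R" by simp
qed

lemma rels_mem: "r \<in> R \<Longrightarrow> r \<in> rel_subgroup B R"
  unfolding rel_subgroup_def by (rule generate.incl)

text \<open>
  Closure under subtraction is the only closure step, as it also covers the inverses and the products
  in \<open>generate\<close>.
\<close>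

lemma rel_subgroup_induct [consumes 1, case_names zero rel diff]:
  assumes "z \<in> rel_subgroup B R" "P 0" "\<And>r. r \<in> R \<Longrightarrow> P r"
    "\<And>x y. x \<in> rel_subgroup B R \<Longrightarrow> y \<in> rel_subgroup B R \<Longrightarrow> P x \<Longrightarrow> P y \<Longrightarrow> P (x - y)"
  shows "P z"
proof -
  have "x \<in> rel_subgroup B R \<and> P x" if "x \<in> generate (free_Abelian_group B) R" for x
    using that
  proof (induction x rule: generate.induct)
    case one
    then show ?case using assms by simp
  next
    case (incl h)
    then show ?case using assms rels_mem by simp
  next
    case (inv h)
    then have "inv\<^bsub>free_Abelian_group B\<^esub> h = 0 - h"
      using rels_closed by auto
    moreover have "h \<in> rel_subgroup B R" by (rule rels_mem[OF inv])
    then have "P (0 - h)" "0 - h \<in> rel_subgroup B R"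
      using assms(3)[OF inv] by (auto intro!: assms(2,4) rel.diff_mem simp del: diff_0)
    ultimately show ?case by simp
  next
    case (eng h1 h2)
    have "P (0 - h2)" "0 - h2 \<in> rel_subgroup B R"
      by (auto intro!: assms(2,4) rel.diff_mem simp: eng simp del: diff_0)
    then have "P (h1 - (0 - h2))" "h1 - (0 - h2) \<in> rel_subgroup B R"
      by (auto intro!: assms(4) rel.diff_mem simp: eng simp del: diff_0 diff_minus_eq_add)
    then show ?case by simp
  qed
  with assms(1) show ?thesis by (auto simp: rel_subgroup_def)
qed

lemma frag_extend_rel_subgroup:
  assumes "frag_subgroup K" "\<And>r. r \<in> R \<Longrightarrow> frag_extend f r \<in> K" "z \<in> rel_subgroup B R"
  shows "frag_extend f z \<in> K"
proof -
  interpret K: frag_subgroup K by fact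
  show ?thesis using assms(3)
    by (induction z rule: rel_subgroup_induct) (auto simp: assms(2) frag_extend_diff K.diff_mem)
qed

lemma comm_group_presented: "comm_group (presented_group B R)"
  unfolding presented_group_def
  by (rule comm_group.abelian_FactGroup[OF abelian_free_Abelian_group subgroup_rel])

lemma group_presented: "group (presented_group B R)"
  by (rule comm_group.axioms(2)[OF comm_group_presented])

lemma rel_class_closed: "Poly_Mapping.keys z \<subseteq> B \<Longrightarrow> rel_class B R z \<in> carrier (presented_group B R)"
  by (auto simp: presented_group_def carrier_FactGroup rel_class_def)

lemma rel_class_cases:
  assumes "c \<in> carrier (presented_group B R)"
  obtains z where "Poly_Mapping.keys z \<subseteq> B" "c = rel_class B R z"
  using assms by (auto simp: presented_group_def carrier_FactGroup rel_class_def)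

lemma rel_class_hom: "rel_class B R \<in> hom (free_Abelian_group B) (presented_group B R)"
  unfolding presented_group_def rel_class_def[abs_def] by (rule normal.r_coset_hom_Mod[OF normal_rel])

lemma rel_class_add:
  "Poly_Mapping.keys x \<subseteq> B \<Longrightarrow> Poly_Mapping.keys y \<subseteq> B \<Longrightarrow>
    rel_class B R (x + y) = rel_class B R x \<otimes>\<^bsub>presented_group B R\<^esub> rel_class B R y"
  using hom_mult[OF rel_class_hom, of x y] by simp

lemma rel_class_0: "rel_class B R 0 = \<one>\<^bsub>presented_group B R\<^esub>"
  using hom_one[OF rel_class_hom group_free_Abelian_group group_presented] by simp

lemma rel_class_minus:
  "Poly_Mapping.keys x \<subseteq> B \<Longrightarrow> rel_class B R (- x) = inv\<^bsub>presented_group B R\<^esub> rel_class B R x"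
  using group_hom.hom_inv[of "free_Abelian_group B" "presented_group B R" "rel_class B R" x]
  by (simp add: group_hom_def group_hom_axioms_def rel_class_hom group_presented)

lemma rel_class_diff:
  "Poly_Mapping.keys x \<subseteq> B \<Longrightarrow> Poly_Mapping.keys y \<subseteq> B \<Longrightarrow>
    rel_class B R (x - y) = rel_class B R x \<otimes>\<^bsub>presented_group B R\<^esub> inv\<^bsub>presented_group B R\<^esub> rel_class B R y"
  using rel_class_add[of x "- y"] rel_class_minus[of y] by simp

lemma rel_class_eq_one_iff:
  assumes "Poly_Mapping.keys x \<subseteq> B"
  shows "rel_class B R x = \<one>\<^bsub>presented_group B R\<^esub> \<longleftrightarrow> x \<in> rel_subgroup B R"
proof -
  have "rel_class B R x = rel_subgroup B R \<longleftrightarrow> x \<in> rel_subgroup B R"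
    unfolding rel_class_def
    using group.coset_join1[OF group_free_Abelian_group _ _ subgroup_rel, of x]
      group.coset_join2[OF group_free_Abelian_group _ subgroup_rel, of x] assms
      subgroup.subset[OF subgroup_rel]
    by auto
  then show ?thesis by (simp add: presented_group_def)
qed

lemma rel_class_eq_iff:
  assumes "Poly_Mapping.keys x \<subseteq> B" "Poly_Mapping.keys y \<subseteq> B"
  shows "rel_class B R x = rel_class B R y \<longleftrightarrow> x - y \<in> rel_subgroup B R"
proof -
  interpret comm_group "presented_group B R" by (rule comm_group_presented)
  have k: "Poly_Mapping.keys (x - y) \<subseteq> B"
    using assms keys_diff[of x y] by blast
  show ?thesis
    using rel_class_eq_one_iff[OF k] rel_class_diff[OF assms] rel_class_closed[OF assms(1)]
      rel_class_closed[OF assms(2)]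
    by (simp add: inv_solve_right')
qed

lemma presented_group_induct [consumes 1, case_names one gen mult_inv]:
  assumes "c \<in> carrier (presented_group B R)"
    and "P \<one>\<^bsub>presented_group B R\<^esub>"
    and "\<And>x. x \<in> B \<Longrightarrow> P (gen_class B R x)"
    and "\<And>x y. x \<in> carrier (presented_group B R) \<Longrightarrow> y \<in> carrier (presented_group B R)
      \<Longrightarrow> P x \<Longrightarrow> P y \<Longrightarrow> P (x \<otimes>\<^bsub>presented_group B R\<^esub> inv\<^bsub>presented_group B R\<^esub> y)"
  shows "P c"
proof -
  obtain z where z: "Poly_Mapping.keys z \<subseteq> B" "c = rel_class B R z"
    using rel_class_cases[OF assms(1)] .
  from z(1) have "P (rel_class B R z)"
    by (rule free_Abelian_group_induct[where P = "\<lambda>z. P (rel_class B R z)"])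
      (auto simp: rel_class_0 assms rel_class_diff rel_class_closed gen_class_eq_rel_class[symmetric])
  with z show ?thesis by simp
qed

text \<open>
  A homomorphism that kills the defining relations kills the subgroup they generate, so it is constant
  on its cosets.
\<close>

lemma presented_group_universal:
  assumes "group G" "F \<in> hom (free_Abelian_group B) G" "\<And>r. r \<in> R \<Longrightarrow> F r = \<one>\<^bsub>G\<^esub>"
  obtains h where "h \<in> hom (presented_group B R) G"
    "\<And>z. Poly_Mapping.keys z \<subseteq> B \<Longrightarrow> h (rel_class B R z) = F z"
proof -
  interpret F: group_hom "free_Abelian_group B" G F
    using assms by (simp add: group_hom_def group_hom_axioms_def)
  have diff: "F (x - y) = F x \<otimes>\<^bsub>G\<^esub> inv\<^bsub>G\<^esub> F y" if "Poly_Mapping.keys x \<subseteq> B" "Poly_Mapping.keys y \<subseteq> B" for x y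
    using F.hom_mult[of x "- y"] F.hom_inv[of y] that by simp
  have rel1: "F z = \<one>\<^bsub>G\<^esub>" if "z \<in> rel_subgroup B R" for z
    using that by (induction z rule: rel_subgroup_induct) 
      (use F.hom_one in \<open>auto simp: assms(3) diff rel_subgroup_keys\<close>)
  have eq0: "F x = F y" if "Poly_Mapping.keys x \<subseteq> B" "Poly_Mapping.keys y \<subseteq> B" "rel_class B R x = rel_class B R y" for x y
  proof -
    have "F x \<otimes>\<^bsub>G\<^esub> inv\<^bsub>G\<^esub> F y = \<one>\<^bsub>G\<^esub>"
      using rel1 diff that rel_class_eq_iff by metis
    moreover have "F x \<in> carrier G" "F y \<in> carrier G" using F.hom_closed that by auto
    ultimately show ?thesis
      by (simp add: F.H.inv_solve_right')
  qed
  have eq: "F x = F y" if "x \<in> carrier (free_Abelian_group B)" "y \<in> carrier (free_Abelian_group B)"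
    "rel_subgroup B R #>\<^bsub>free_Abelian_group B\<^esub> x = rel_subgroup B R #>\<^bsub>free_Abelian_group B\<^esub> y" for x y
    by (rule eq0) (use that in \<open>simp_all add: rel_class_def\<close>)
  show thesis
  proof (rule FactGroup_universal[OF assms(2) normal_rel eq])
    fix g
    assume g: "g \<in> hom (free_Abelian_group B Mod rel_subgroup B R) G"
      "\<And>x. x \<in> carrier (free_Abelian_group B)
        \<Longrightarrow> g (rel_subgroup B R #>\<^bsub>free_Abelian_group B\<^esub> x) = F x"
    show thesis
      by (rule that[of g]) (use g in \<open>simp_all add: presented_group_def rel_class_def\<close>)
  qed
qed

end

lemma (in comm_group) frag_eval:
  fixes f :: "'c \<Rightarrow> 'a"
  assumes "\<And>x. x \<in> X \<Longrightarrow> f x \<in> carrier G"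
  obtains F where "F \<in> hom (free_Abelian_group X) G" "\<And>x. x \<in> X \<Longrightarrow> F (frag_of x) = f x"
  using free_Abelian_group_universal[of f X] assms by blast

text \<open>
  The representatives of a class differ by relations of the source.  Their images differ by relations
  of the target, and the product with the target's relation subgroup in \<open>induced_map\<close> absorbs these.
\<close>

lemma induced_map_rel_class:
  assumes "presentation X T" "presentation Y T'"
    and gens: "\<And>x. x \<in> X \<Longrightarrow> Poly_Mapping.keys (f x) \<subseteq> Y"
    and rels: "\<And>r. r \<in> T \<Longrightarrow> frag_extend f r \<in> rel_subgroup Y T'"
    and z: "Poly_Mapping.keys z \<subseteq> X"
  shows "induced_map Y T' f (rel_class X T z) = rel_class Y T' (frag_extend f z)"
proof -
  interpret X: presentation X T by fact
  interpret Y: presentation Y T' by fact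
  have ext: "frag_extend f r \<in> rel_subgroup Y T'" if "r \<in> rel_subgroup X T" for r
    using X.frag_extend_rel_subgroup[OF Y.rel.frag_subgroup_axioms rels that] by blast
  have "rel_class X T z = (\<lambda>r. r + z) ` rel_subgroup X T"
    by (auto simp: rel_class_def r_coset_def)
  then have C: "frag_extend f ` rel_class X T z = (\<lambda>r. frag_extend f r + frag_extend f z) ` rel_subgroup X T"
    by (simp add: image_image frag_extend_add)
  have D: "rel_class Y T' (frag_extend f z) = {r + frag_extend f z | r. r \<in> rel_subgroup Y T'}"
    by (auto simp: rel_class_def r_coset_def)
  have "induced_map Y T' f (rel_class X T z)
      = {r + (frag_extend f r' + frag_extend f z) | r r'. r \<in> rel_subgroup Y T' \<and> r' \<in> rel_subgroup X T}"
    unfolding induced_map_def C by (auto simp: set_mult_def)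
  also have "\<dots> = {r + frag_extend f z | r. r \<in> rel_subgroup Y T'}"
  proof (intro equalityI subsetI)
    fix x assume "x \<in> {r + (frag_extend f r' + frag_extend f z) | r r'. r \<in> rel_subgroup Y T' \<and> r' \<in> rel_subgroup X T}"
    then obtain r r' where "x = (r + frag_extend f r') + frag_extend f z" "r \<in> rel_subgroup Y T'" "r' \<in> rel_subgroup X T"
      by (auto simp: add.assoc)
    then show "x \<in> {r + frag_extend f z | r. r \<in> rel_subgroup Y T'}"
      using Y.rel.add_mem ext by blast
  next
    fix x assume "x \<in> {r + frag_extend f z | r. r \<in> rel_subgroup Y T'}"
    then obtain r where "x = r + frag_extend f z" "r \<in> rel_subgroup Y T'" by blast
    then show "x \<in> {r + (frag_extend f r' + frag_extend f z) | r r'. r \<in> rel_subgroup Y T' \<and> r' \<in> rel_subgroup X T}"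
      using X.rel.zero_mem by (force intro: exI[of _ 0])
  qed
  finally show ?thesis unfolding D .
qed

lemma induced_map_hom:
  assumes "presentation X T" "presentation Y T'"
    and gens: "\<And>x. x \<in> X \<Longrightarrow> Poly_Mapping.keys (f x) \<subseteq> Y"
    and rels: "\<And>r. r \<in> T \<Longrightarrow> frag_extend f r \<in> rel_subgroup Y T'"
  shows "induced_map Y T' f \<in> hom (presented_group X T) (presented_group Y T')"
proof (rule homI)
  interpret X: presentation X T by fact
  interpret Y: presentation Y T' by fact
  have ind: "induced_map Y T' f (rel_class X T z) = rel_class Y T' (frag_extend f z)"
    if "Poly_Mapping.keys z \<subseteq> X" for z
    by (rule induced_map_rel_class[OF assms(1,2) gens rels that])
  have k: "Poly_Mapping.keys z \<subseteq> X \<Longrightarrow> Poly_Mapping.keys (frag_extend f z) \<subseteq> Y" for z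
    by (rule keys_frag_extend_subset[OF _ gens])
  show "induced_map Y T' f x \<in> carrier (presented_group Y T')" if "x \<in> carrier (presented_group X T)" for x
    using X.rel_class_cases[OF that] ind Y.rel_class_closed k by metis
  fix x y assume "x \<in> carrier (presented_group X T)" "y \<in> carrier (presented_group X T)"
  then obtain z w where z: "Poly_Mapping.keys z \<subseteq> X" "x = rel_class X T z"
    and w: "Poly_Mapping.keys w \<subseteq> X" "y = rel_class X T w"
    using X.rel_class_cases by metis
  have "Poly_Mapping.keys (z + w) \<subseteq> X" using z(1) w(1) keys_add[of z w] by blast
  then show "induced_map Y T' f (x \<otimes>\<^bsub>presented_group X T\<^esub> y)
    = induced_map Y T' f x \<otimes>\<^bsub>presented_group Y T'\<^esub> induced_map Y T' f y"
    unfolding z(2) w(2) X.rel_class_add[OF z(1) w(1), symmetric] ind[OF z(1)] ind[OF w(1)]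
    using ind[of "z + w"] Y.rel_class_add[OF k[OF z(1)] k[OF w(1)]] by (simp add: frag_extend_add)
qed

section \<open>Tensor products\<close>

locale tensor_data = M: comm_group M + N: comm_group N
  for R :: "'r set" and M :: "('m, 'x) monoid_scheme" and ract :: "'m \<Rightarrow> 'r \<Rightarrow> 'm"
    and N :: "('n, 'y) monoid_scheme" and lact :: "'r \<Rightarrow> 'n \<Rightarrow> 'n" +
  assumes ract_closed: "\<And>x r. x \<in> carrier M \<Longrightarrow> r \<in> R \<Longrightarrow> ract x r \<in> carrier M"
    and lact_closed: "\<And>r y. r \<in> R \<Longrightarrow> y \<in> carrier N \<Longrightarrow> lact r y \<in> carrier N"
begin

abbreviation "T \<equiv> tensor R M ract N lact"
abbreviation "pure \<equiv> pure_tensor R M ract N lact"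

lemma tensor_relE:
  assumes "r \<in> tensor_rels R M ract N lact"
  obtains
    (add_left) x x' y where "r = frag_of (x \<otimes>\<^bsub>M\<^esub> x', y) - frag_of (x, y) - frag_of (x', y)"
      "x \<in> carrier M" "x' \<in> carrier M" "y \<in> carrier N"
  | (add_right) x y y' where "r = frag_of (x, y \<otimes>\<^bsub>N\<^esub> y') - frag_of (x, y) - frag_of (x, y')"
      "x \<in> carrier M" "y \<in> carrier N" "y' \<in> carrier N"
  | (balanced) x s y where "r = frag_of (ract x s, y) - frag_of (x, lact s y)"
      "x \<in> carrier M" "s \<in> R" "y \<in> carrier N"
  using assms unfolding tensor_rels_def by blast

sublocale presentation "carrier M \<times> carrier N" "tensor_rels R M ract N lact"
proof
  show "tensor_rels R M ract N lact \<subseteq> carrier (free_Abelian_group (carrier M \<times> carrier N))"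
  proof
    fix r assume "r \<in> tensor_rels R M ract N lact"
    then show "r \<in> carrier (free_Abelian_group (carrier M \<times> carrier N))"
      by (cases rule: tensor_relE)
        (simp_all add: keys_diff_subset ract_closed lact_closed)
  qed
qed

lemma tensor_presented: "T = presented_group (carrier M \<times> carrier N) (tensor_rels R M ract N lact)"
  by (simp add: tensor_def)

lemma pure_eq: "pure x y = rel_class (carrier M \<times> carrier N) (tensor_rels R M ract N lact) (frag_of (x, y))"
  by (simp add: pure_tensor_def gen_class_eq_rel_class)

sublocale T: comm_group T
  unfolding tensor_presented by (rule comm_group_presented)

lemma pure_closed: "x \<in> carrier M \<Longrightarrow> y \<in> carrier N \<Longrightarrow> pure x y \<in> carrier T"
  unfolding pure_eq tensor_presented by (rule rel_class_closed) simp

lemma pure_add_left: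
  assumes "x \<in> carrier M" "x' \<in> carrier M" "y \<in> carrier N"
  shows "pure (x \<otimes>\<^bsub>M\<^esub> x') y = pure x y \<otimes>\<^bsub>T\<^esub> pure x' y"
proof -
  have "frag_of (x \<otimes>\<^bsub>M\<^esub> x', y) - frag_of (x, y) - frag_of (x', y) \<in> tensor_rels R M ract N lact"
    using assms unfolding tensor_rels_def by blast
  then have "frag_of (x \<otimes>\<^bsub>M\<^esub> x', y) - (frag_of (x, y) + frag_of (x', y)) \<in> rel_subgroup (carrier M \<times> carrier N) (tensor_rels R M ract N lact)"
    using rels_mem by (simp add: algebra_simps)
  then show ?thesis unfolding pure_eq tensor_presented
    using assms rel_class_add[of "frag_of (x, y)" "frag_of (x', y)"] keys_add[of "frag_of (x, y)" "frag_of (x', y)"]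
    by (subst rel_class_add[symmetric], simp, simp, subst rel_class_eq_iff) auto
qed

lemma pure_add_right:
  assumes "x \<in> carrier M" "y \<in> carrier N" "y' \<in> carrier N"
  shows "pure x (y \<otimes>\<^bsub>N\<^esub> y') = pure x y \<otimes>\<^bsub>T\<^esub> pure x y'"
proof -
  have "frag_of (x, y \<otimes>\<^bsub>N\<^esub> y') - frag_of (x, y) - frag_of (x, y') \<in> tensor_rels R M ract N lact"
    using assms unfolding tensor_rels_def by blast
  then have "frag_of (x, y \<otimes>\<^bsub>N\<^esub> y') - (frag_of (x, y) + frag_of (x, y')) \<in> rel_subgroup (carrier M \<times> carrier N) (tensor_rels R M ract N lact)"
    using rels_mem by (simp add: algebra_simps)
  then show ?thesis unfolding pure_eq tensor_presented
    using assms keys_add[of "frag_of (x, y)" "frag_of (x, y')"]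
    by (subst rel_class_add[symmetric], simp, simp, subst rel_class_eq_iff) auto
qed

lemma pure_balanced:
  assumes "x \<in> carrier M" "r \<in> R" "y \<in> carrier N"
  shows "pure (ract x r) y = pure x (lact r y)"
proof -
  have "frag_of (ract x r, y) - frag_of (x, lact r y) \<in> tensor_rels R M ract N lact"
    using assms unfolding tensor_rels_def by blast
  then show ?thesis unfolding pure_eq
    using assms by (simp add: rel_class_eq_iff rels_mem ract_closed lact_closed)
qed

lemma pure_hom_left: "y \<in> carrier N \<Longrightarrow> (\<lambda>x. pure x y) \<in> hom M T"
  by (rule homI) (auto simp: pure_closed pure_add_left)

lemma pure_hom_right: "x \<in> carrier M \<Longrightarrow> (\<lambda>y. pure x y) \<in> hom N T"
  by (rule homI) (auto simp: pure_closed pure_add_right)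

lemma tensor_induct [consumes 1, case_names one pure mult_inv]:
  assumes "t \<in> carrier T" "P \<one>\<^bsub>T\<^esub>" "\<And>x y. x \<in> carrier M \<Longrightarrow> y \<in> carrier N \<Longrightarrow> P (pure x y)"
    "\<And>s t. s \<in> carrier T \<Longrightarrow> t \<in> carrier T \<Longrightarrow> P s \<Longrightarrow> P t \<Longrightarrow> P (s \<otimes>\<^bsub>T\<^esub> inv\<^bsub>T\<^esub> t)"
  shows "P t"
  using assms(1) unfolding tensor_presented
  by (rule presented_group_induct) (use assms in \<open>auto simp: tensor_presented pure_tensor_def\<close>)

text \<open>
  The three hypotheses on \<open>b\<close> say that its linear extension kills the three kinds of tensor relations.
\<close>

lemma tensor_universal:
  assumes "comm_group G"
    and closed: "\<And>x y. x \<in> carrier M \<Longrightarrow> y \<in> carrier N \<Longrightarrow> b x y \<in> carrier G"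
    and left: "\<And>x x' y. x \<in> carrier M \<Longrightarrow> x' \<in> carrier M \<Longrightarrow> y \<in> carrier N \<Longrightarrow>
      b (x \<otimes>\<^bsub>M\<^esub> x') y = b x y \<otimes>\<^bsub>G\<^esub> b x' y"
    and right: "\<And>x y y'. x \<in> carrier M \<Longrightarrow> y \<in> carrier N \<Longrightarrow> y' \<in> carrier N \<Longrightarrow>
      b x (y \<otimes>\<^bsub>N\<^esub> y') = b x y \<otimes>\<^bsub>G\<^esub> b x y'"
    and bal: "\<And>x r y. x \<in> carrier M \<Longrightarrow> r \<in> R \<Longrightarrow> y \<in> carrier N \<Longrightarrow> b (ract x r) y = b x (lact r y)"
  obtains h where "h \<in> hom T G" "\<And>x y. x \<in> carrier M \<Longrightarrow> y \<in> carrier N \<Longrightarrow> h (pure x y) = b x y"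
proof -
  interpret G: comm_group G by fact
  obtain F where F: "F \<in> hom (free_Abelian_group (carrier M \<times> carrier N)) G"
    and Fb: "\<And>z. z \<in> carrier M \<times> carrier N \<Longrightarrow> F (frag_of z) = (case z of (x, y) \<Rightarrow> b x y)"
    by (rule G.frag_eval[of "carrier M \<times> carrier N" "\<lambda>(x, y). b x y"]) (use closed in auto)
  interpret F: group_hom "free_Abelian_group (carrier M \<times> carrier N)" G F
    using F by (simp add: group_hom_def group_hom_axioms_def G.is_group)
  have diff: "F (x - y) = F x \<otimes>\<^bsub>G\<^esub> inv\<^bsub>G\<^esub> F y"
    if "Poly_Mapping.keys x \<subseteq> carrier M \<times> carrier N" "Poly_Mapping.keys y \<subseteq> carrier M \<times> carrier N" for x y
    using F.hom_mult[of x "- y"] F.hom_inv[of y] that by simp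
  \<comment> \<open>An additivity relation \<open>(a + c) - a - c\<close> in multiplicative notation.\<close>
  have canc: "a \<otimes>\<^bsub>G\<^esub> c \<otimes>\<^bsub>G\<^esub> inv\<^bsub>G\<^esub> a \<otimes>\<^bsub>G\<^esub> inv\<^bsub>G\<^esub> c = \<one>\<^bsub>G\<^esub>" if "a \<in> carrier G" "c \<in> carrier G" for a c
    using that G.r_inv[of "a \<otimes>\<^bsub>G\<^esub> c"] by (simp add: G.inv_mult G.m_assoc del: G.r_inv)
  have "F r = \<one>\<^bsub>G\<^esub>" if "r \<in> tensor_rels R M ract N lact" for r
    using that
    by (cases rule: tensor_relE)
      (simp_all add: diff keys_diff_subset ract_closed lact_closed Fb left right bal closed canc)
  then obtain h where "h \<in> hom (presented_group (carrier M \<times> carrier N) (tensor_rels R M ract N lact)) G"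
    "\<And>z. Poly_Mapping.keys z \<subseteq> carrier M \<times> carrier N \<Longrightarrow> h (rel_class (carrier M \<times> carrier N) (tensor_rels R M ract N lact) z) = F z"
    using presented_group_universal[OF G.is_group F] by metis
  then show thesis
    by (intro that[of h]) (simp_all add: tensor_presented pure_eq Fb)
qed

end

text \<open>
  Additivity of \<open>f\<close> and \<open>g\<close> takes care of the additivity relations; the relations that move a scalar
  across the tensor sign are preserved because \<open>f\<close> and \<open>g\<close> are both \<open>R\<close>-linear.
\<close>

lemma
  assumes "tensor_data R M ract N lact" "tensor_data R M' ract' N' lact'"
    and f: "f \<in> hom M M'" "\<And>x r. x \<in> carrier M \<Longrightarrow> r \<in> R \<Longrightarrow> f (ract x r) = ract' (f x) r"
    and g: "g \<in> hom N N'" "\<And>r y. r \<in> R \<Longrightarrow> y \<in> carrier N \<Longrightarrow> g (lact r y) = lact' r (g y)"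
  shows tensor_map_hom: "tensor_map R M' ract' N' lact' f g
      \<in> hom (tensor R M ract N lact) (tensor R M' ract' N' lact')"
    and tensor_map_pure: "\<And>x y. x \<in> carrier M \<Longrightarrow> y \<in> carrier N \<Longrightarrow>
      tensor_map R M' ract' N' lact' f g (pure_tensor R M ract N lact x y)
        = pure_tensor R M' ract' N' lact' (f x) (g y)"
proof -
  interpret T: tensor_data R M ract N lact by fact
  interpret T': tensor_data R M' ract' N' lact' by fact
  have fc: "x \<in> carrier M \<Longrightarrow> f x \<in> carrier M'" for x using f(1) by (rule hom_in_carrier)
  have gc: "y \<in> carrier N \<Longrightarrow> g y \<in> carrier N'" for y using g(1) by (rule hom_in_carrier)
  let ?q = "\<lambda>(x, y). frag_of (f x, g y)"
  have gens: "Poly_Mapping.keys (?q z) \<subseteq> carrier M' \<times> carrier N'" if "z \<in> carrier M \<times> carrier N" for z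
    using that fc gc by auto
  have "frag_extend ?q r \<in> tensor_rels R M' ract' N' lact'" if "r \<in> tensor_rels R M ract N lact" for r
    using that
  proof (cases rule: T.tensor_relE)
    case (add_left x x' y)
    then have "frag_extend ?q r = frag_of (f x \<otimes>\<^bsub>M'\<^esub> f x', g y) - frag_of (f x, g y) - frag_of (f x', g y)"
      using hom_mult[OF f(1)] by (simp add: frag_extend_diff)
    with add_left fc gc show ?thesis unfolding tensor_rels_def by blast
  next
    case (add_right x y y')
    then have "frag_extend ?q r = frag_of (f x, g y \<otimes>\<^bsub>N'\<^esub> g y') - frag_of (f x, g y) - frag_of (f x, g y')"
      using hom_mult[OF g(1)] by (simp add: frag_extend_diff)
    with add_right fc gc show ?thesis unfolding tensor_rels_def by blast
  next
    case (balanced x s y)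
    then have "frag_extend ?q r = frag_of (ract' (f x) s, g y) - frag_of (f x, lact' s (g y))"
      by (simp add: frag_extend_diff f g)
    with balanced fc gc show ?thesis unfolding tensor_rels_def by blast
  qed
  then have rels: "frag_extend ?q r \<in> rel_subgroup (carrier M' \<times> carrier N') (tensor_rels R M' ract' N' lact')"
    if "r \<in> tensor_rels R M ract N lact" for r
    using that T'.rels_mem by blast
  show "tensor_map R M' ract' N' lact' f g \<in> hom (tensor R M ract N lact) (tensor R M' ract' N' lact')"
    unfolding tensor_map_def tensor_def
    by (rule induced_map_hom[OF T.presentation_axioms T'.presentation_axioms gens rels])
  show "tensor_map R M' ract' N' lact' f g (pure_tensor R M ract N lact x y)
        = pure_tensor R M' ract' N' lact' (f x) (g y)" if "x \<in> carrier M" "y \<in> carrier N" for x y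
    unfolding tensor_map_def T.pure_eq T'.pure_eq using that
    by (subst induced_map_rel_class[OF T.presentation_axioms T'.presentation_axioms gens rels]) simp_all
qed

section \<open>Lists as tensors\<close>

fun lmul :: "('a, 'm) ring_scheme \<Rightarrow> 'a \<Rightarrow> 'a list \<Rightarrow> 'a list" where
  "lmul A a [] = []"
| "lmul A a (x # xs) = (a \<otimes>\<^bsub>A\<^esub> x) # xs"

fun rmul :: "('a, 'm) ring_scheme \<Rightarrow> 'a list \<Rightarrow> 'a \<Rightarrow> 'a list" where
  "rmul A [] a = []"
| "rmul A [x] a = [x \<otimes>\<^bsub>A\<^esub> a]"
| "rmul A (x # y # xs) a = x # rmul A (y # xs) a"

text \<open>
  This is composition with the bar differential, \<open>f \<mapsto> f \<circ> d\<close>, written as a recursion: the face \<open>0\<close>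
  multiplies the first two entries, and all other faces keep the first entry and are the faces of the
  remaining list with opposite sign.  The recursion is what makes inductive proofs possible;
  \<open>sum_faces_eq_codiff\<close> below relates it to the alternating sum.
\<close>

fun codiff :: "('a, 'm) ring_scheme \<Rightarrow> ('a list \<Rightarrow> 'b \<Rightarrow>\<^sub>0 int) \<Rightarrow> 'a list \<Rightarrow> 'b \<Rightarrow>\<^sub>0 int" where
  "codiff A f [] = 0"
| "codiff A f (x # xs) = (if xs = [] then 0 else f (lmul A x xs) - codiff A (\<lambda>ys. f (x # ys)) xs)"

lemma length_lmul [simp]: "length (lmul A a xs) = length xs"
  by (cases xs) auto

lemma lmul_eq_Nil_iff [simp]: "lmul A a xs = [] \<longleftrightarrow> xs = []"
  by (cases xs) auto

lemma length_rmul [simp]: "length (rmul A xs a) = length xs"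
  by (induction A xs a rule: rmul.induct) auto

lemma rmul_eq_Nil_iff [simp]: "rmul A xs a = [] \<longleftrightarrow> xs = []"
  by (metis length_0_conv length_rmul)

lemma Cons_in_tpower_gens [simp]:
  "x # xs \<in> tpower_gens A n \<longleftrightarrow> x \<in> carrier A \<and> (\<exists>m. n = Suc m \<and> xs \<in> tpower_gens A m)"
  by (auto simp: tpower_gens_def)

lemma Nil_in_tpower_gens [simp]: "[] \<in> tpower_gens A n \<longleftrightarrow> n = 0"
  by (auto simp: tpower_gens_def)

lemma tpower_gens_0: "xs \<in> tpower_gens A 0 \<longleftrightarrow> xs = []"
  by (cases xs) auto

lemma tpower_gens_SucE:
  assumes "xs \<in> tpower_gens A (Suc n)"
  obtains x ys where "xs = x # ys" "x \<in> carrier A" "ys \<in> tpower_gens A n"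
  using assms by (cases xs) auto

lemma codiff_diff_fun: "codiff A (\<lambda>xs. f xs - g xs) xs = codiff A f xs - codiff A g xs"
  by (induction xs arbitrary: f g) simp_all

lemma frag_extend_codiff: "frag_extend g (codiff A f xs) = codiff A (\<lambda>ys. frag_extend g (f ys)) xs"
  by (induction xs arbitrary: f) (simp_all add: frag_extend_diff)

context ring
begin

lemma lmul_in_gens: "a \<in> carrier R \<Longrightarrow> xs \<in> tpower_gens R n \<Longrightarrow> lmul R a xs \<in> tpower_gens R n"
  by (cases xs) auto

lemma rmul_in_gens: "a \<in> carrier R \<Longrightarrow> xs \<in> tpower_gens R n \<Longrightarrow> rmul R xs a \<in> tpower_gens R n"
proof (induction xs arbitrary: n)
  case (Cons x xs)
  then show ?case by (cases xs) auto
qed simp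

lemma lmul_lmul: "a \<in> carrier R \<Longrightarrow> b \<in> carrier R \<Longrightarrow> xs \<in> tpower_gens R n \<Longrightarrow>
    lmul R a (lmul R b xs) = lmul R (a \<otimes> b) xs"
  by (cases xs) (auto simp: m_assoc)

lemma rmul_rmul: "a \<in> carrier R \<Longrightarrow> b \<in> carrier R \<Longrightarrow> xs \<in> tpower_gens R n \<Longrightarrow>
    rmul R (rmul R xs a) b = rmul R xs (a \<otimes> b)"
proof (induction xs arbitrary: n)
  case (Cons x xs)
  then show ?case by (cases xs; cases "tl xs") (auto simp: m_assoc)
qed simp

lemma lmul_rmul: "a \<in> carrier R \<Longrightarrow> b \<in> carrier R \<Longrightarrow> xs \<in> tpower_gens R n \<Longrightarrow>
    lmul R a (rmul R xs b) = rmul R (lmul R a xs) b"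
  by (cases xs; cases "tl xs") (auto simp: m_assoc)

lemma codiff_cong:
  assumes "\<And>ys. ys \<in> tpower_gens R n \<Longrightarrow> f ys = g ys" "xs \<in> tpower_gens R (Suc n)"
  shows "codiff R f xs = codiff R g xs"
  using assms
proof (induction n arbitrary: f g xs)
  case 0
  then show ?case by (auto simp: tpower_gens_0 elim!: tpower_gens_SucE)
next
  case (Suc n)
  obtain x ys where xs: "xs = x # ys" "x \<in> carrier R" "ys \<in> tpower_gens R (Suc n)"
    using Suc.prems(2) by (rule tpower_gens_SucE)
  have "codiff R (\<lambda>ys. f (x # ys)) ys = codiff R (\<lambda>ys. g (x # ys)) ys"
    by (rule Suc.IH) (use Suc.prems(1) xs in auto)
  with xs Suc.prems(1) lmul_in_gens[OF xs(2,3)] show ?case by simp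
qed

lemma codiff_lmul:
  assumes "a \<in> carrier R" "xs \<in> tpower_gens R n"
  shows "codiff R (\<lambda>ys. f (lmul R a ys)) xs = codiff R f (lmul R a xs)"
proof (cases xs)
  case (Cons x ys)
  with assms show ?thesis by (cases n) (auto simp: lmul_lmul)
qed simp

lemma codiff_rmul:
  assumes "a \<in> carrier R" "xs \<in> tpower_gens R n" "n \<ge> 2"
  shows "codiff R (\<lambda>ys. f (rmul R ys a)) xs = codiff R f (rmul R xs a)"
  using assms(2,3)
proof (induction xs arbitrary: n f)
  case (Cons x xs)
  then obtain m where m: "n = Suc m" "x \<in> carrier R" "xs \<in> tpower_gens R m" "m \<ge> 1" by auto
  then obtain y ys where xs: "xs = y # ys" by (cases xs) auto
  show ?case
  proof (cases ys)
    case Nil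
    with m xs assms(1) show ?thesis by (auto simp: m_assoc)
  next
    case (Cons z zs)
    have "codiff R (\<lambda>ys. f (rmul R (x # ys) a)) xs = codiff R (\<lambda>ys. f (x # rmul R ys a)) xs"
      by (rule codiff_cong[of "m - 1"]) (use m xs Cons in \<open>auto elim!: tpower_gens_SucE\<close>)
    also have "\<dots> = codiff R (\<lambda>ys. f (x # ys)) (rmul R xs a)"
      using m xs Cons by (intro Cons.IH[of m]) auto
    finally show ?thesis using m xs Cons assms(1) by (simp add: lmul_rmul)
  qed
qed simp

text \<open>
  Unfolding one step, \<open>d\<close> applied to the part that multiplies the first two entries cancels against the
  part of \<open>d\<close> that keeps the first entry, by associativity (\<open>codiff_lmul\<close>); the rest is the
  statement for the function with its first argument fixed.
\<close>

lemma codiff_codiff: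
  assumes "xs \<in> tpower_gens R n"
  shows "codiff R (codiff R f) xs = 0"
  using assms
proof (induction xs arbitrary: n f)
  case (Cons x xs)
  then obtain m where m: "n = Suc m" "x \<in> carrier R" "xs \<in> tpower_gens R m" by auto
  show ?case
  proof (cases xs)
    case Nil
    then show ?thesis by simp
  next
    case (Cons y ys)
    have "codiff R (\<lambda>ys. codiff R f (x # ys)) xs
        = codiff R (\<lambda>ys. f (lmul R x ys) - codiff R (\<lambda>ys. f (x # ys)) ys) xs" if "ys \<noteq> []"
      by (rule codiff_cong[of "m - 1"]) (use m Cons that in \<open>auto simp: tpower_gens_def\<close>)
    also have "\<dots> = codiff R f (lmul R x xs)" if "ys \<noteq> []"
      using m Cons.IH[OF m(3)] codiff_lmul[OF m(2,3)] by (simp add: codiff_diff_fun)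
    finally show ?thesis using Cons m by (cases "ys = []") auto
  qed
qed simp

end

section \<open>Tensorial functions on lists\<close>

locale tensorial_functions = relative_pair A S + frag_subgroup K
  for A (structure) and S and K :: "('b \<Rightarrow>\<^sub>0 int) set"
begin

text \<open>
  Equivalently, \<open>f\<close> induces a homomorphism from the \<open>n\<close>-fold tensor power of \<open>A\<close> over \<open>S\<close> into the
  free abelian group modulo \<open>K\<close>.
\<close>

definition tensorial :: "nat \<Rightarrow> ('a list \<Rightarrow> 'b \<Rightarrow>\<^sub>0 int) \<Rightarrow> bool" where
  "tensorial n f \<longleftrightarrow> (\<forall>r\<in>tpower_rels A S n. frag_extend f r \<in> K)"

lemma tensorial_iff:
  "tensorial n f \<longleftrightarrow>
    (\<forall>as x y bs. length as + 1 + length bs = n \<and> set as \<union> {x, y} \<union> set bs \<subseteq> carrier A \<longrightarrow>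
      f (as @ [x \<oplus> y] @ bs) - f (as @ [x] @ bs) - f (as @ [y] @ bs) \<in> K) \<and>
    (\<forall>as x s y bs. length as + 2 + length bs = n \<and> s \<in> S \<and> set as \<union> {x, y} \<union> set bs \<subseteq> carrier A \<longrightarrow>
      f (as @ [x \<otimes> s, y] @ bs) - f (as @ [x, s \<otimes> y] @ bs) \<in> K)" (is "_ \<longleftrightarrow> ?rhs")
proof
  assume L: "tensorial n f"
  show ?rhs
  proof (intro conjI allI impI, goal_cases)
    case (1 as x y bs)
    then have "frag_of (as @ [x \<oplus> y] @ bs) - frag_of (as @ [x] @ bs) - frag_of (as @ [y] @ bs) \<in> tpower_rels A S n"
      unfolding tpower_rels_def by blast
    with L have "frag_extend f (frag_of (as @ [x \<oplus> y] @ bs) - frag_of (as @ [x] @ bs) - frag_of (as @ [y] @ bs)) \<in> K"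
      unfolding tensorial_def by blast
    then show ?case by (simp add: frag_extend_diff)
  next
    case (2 as x s y bs)
    then have "frag_of (as @ [x \<otimes> s, y] @ bs) - frag_of (as @ [x, s \<otimes> y] @ bs) \<in> tpower_rels A S n"
      unfolding tpower_rels_def by blast
    with L have "frag_extend f (frag_of (as @ [x \<otimes> s, y] @ bs) - frag_of (as @ [x, s \<otimes> y] @ bs)) \<in> K"
      unfolding tensorial_def by blast
    then show ?case by (simp add: frag_extend_diff)
  qed
next
  assume R: ?rhs
  show "tensorial n f"
    unfolding tensorial_def
  proof
    fix r assume "r \<in> tpower_rels A S n"
    then show "frag_extend f r \<in> K"
      unfolding tpower_rels_def
    proof (elim UnE CollectE exE conjE, goal_cases)
      case (1 as x y bs)
      then show ?case using conjunct1[OF R, rule_format, of as bs x y] by (simp add: frag_extend_diff)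
    next
      case (2 as x s y bs)
      then show ?case using conjunct2[OF R, rule_format, of as bs s x y] by (simp add: frag_extend_diff)
    qed
  qed
qed

lemma tensorial_0 [simp]: "tensorial 0 f"
  by (simp add: tensorial_iff)

lemma tensorialD:
  assumes "tensorial n f" "set as \<union> {x, y} \<union> set bs \<subseteq> carrier A"
  shows "length as + 1 + length bs = n \<Longrightarrow>
      f (as @ [x \<oplus> y] @ bs) - f (as @ [x] @ bs) - f (as @ [y] @ bs) \<in> K"
    and "length as + 2 + length bs = n \<Longrightarrow> s \<in> S \<Longrightarrow>
      f (as @ [x \<otimes> s, y] @ bs) - f (as @ [x, s \<otimes> y] @ bs) \<in> K"
  using assms unfolding tensorial_iff by blast+

lemma tensorial_cons:
  assumes "tensorial (Suc n) f" "x \<in> carrier A"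
  shows "tensorial n (\<lambda>xs. f (x # xs))"
  unfolding tensorial_iff
proof (intro conjI allI impI, goal_cases)
  case (1 as y z bs)
  with assms(2) tensorialD(1)[OF assms(1), of "x # as" y z bs] show ?case by simp
next
  case (2 as y s z bs)
  with assms(2) tensorialD(2)[OF assms(1), of "x # as" y z bs s] show ?case by simp
qed

lemma tensorial_add:
  assumes "tensorial (Suc n) f" "x \<in> carrier A" "y \<in> carrier A" "xs \<in> tpower_gens A n"
  shows "f ((x \<oplus> y) # xs) - f (x # xs) - f (y # xs) \<in> K"
  using assms(2-) tensorialD(1)[OF assms(1), of "[]" x y xs] by (simp add: tpower_gens_def)

lemma tensorial_balanced:
  assumes "tensorial (Suc n) f" "x \<in> carrier A" "s \<in> S" "xs \<in> tpower_gens A n" "xs \<noteq> []"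
  shows "f ((x \<otimes> s) # xs) - f (x # lmul A s xs) \<in> K"
proof (cases xs)
  case (Cons y ys)
  with assms(2-) tensorialD(2)[OF assms(1), of "[]" x y ys s] show ?thesis
    by (auto simp: tpower_gens_def)
qed (use assms in simp)

text \<open>
  Fixing the first entry reduces the length by one, so only the relations that involve the first entry
  need to be checked.  This and its converses (\<open>tensorial_cons\<close>, \<open>tensorial_add\<close>,
  \<open>tensorial_balanced\<close>) match the recursions of \<open>codiff\<close> and of the homotopy.
\<close>

lemma tensorial_SucI:
  assumes "\<And>x. x \<in> carrier A \<Longrightarrow> tensorial n (\<lambda>xs. f (x # xs))"
    and "\<And>x y xs. x \<in> carrier A \<Longrightarrow> y \<in> carrier A \<Longrightarrow> xs \<in> tpower_gens A n \<Longrightarrow>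
      f ((x \<oplus> y) # xs) - f (x # xs) - f (y # xs) \<in> K"
    and "\<And>x s y xs. x \<in> carrier A \<Longrightarrow> s \<in> S \<Longrightarrow> y \<in> carrier A \<Longrightarrow> y # xs \<in> tpower_gens A n \<Longrightarrow>
      f ((x \<otimes> s) # y # xs) - f (x # (s \<otimes> y) # xs) \<in> K"
  shows "tensorial (Suc n) f"
  unfolding tensorial_iff
proof (intro conjI allI impI, goal_cases)
  case (1 as x y bs)
  show ?case
  proof (cases as)
    case Nil
    with 1 assms(2)[of x y bs] show ?thesis by (simp add: tpower_gens_def)
  next
    case (Cons a as')
    with 1 tensorialD(1)[OF assms(1)[of a], of as' x y bs] show ?thesis by simp
  qed
next
  case (2 as x s y bs)
  show ?case
  proof (cases as)
    case Nil
    with 2 assms(3)[of x s y bs] show ?thesis by (auto simp add: tpower_gens_def)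
  next
    case (Cons a as')
    with 2 tensorialD(2)[OF assms(1)[of a], of as' x y bs s] show ?thesis by simp
  qed
qed

lemma tensorial_cong:
  assumes "\<And>xs. xs \<in> tpower_gens A n \<Longrightarrow> f xs = g xs" "tensorial n f"
  shows "tensorial n g"
  using assms
proof (induction n arbitrary: f g)
  case (Suc n)
  show ?case
  proof (rule tensorial_SucI, goal_cases)
    case (1 x)
    show ?case
      by (rule Suc.IH[of "\<lambda>xs. f (x # xs)"])
        (use Suc.prems(1) 1 in simp, rule tensorial_cons[OF Suc.prems(2) 1])
  next
    case (2 x y xs)
    with tensorial_add[OF Suc.prems(2) 2] Suc.prems(1) show ?case by simp
  next
    case (3 x s y xs)
    have "s \<in> carrier A" using 3 subset by blast
    with 3 tensorial_balanced[OF Suc.prems(2), of x s "y # xs"] Suc.prems(1) show ?case by auto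
  qed
qed simp

lemma tensorial_diff_fun:
  assumes "tensorial n f" "tensorial n g"
  shows "tensorial n (\<lambda>xs. f xs - g xs)"
  using assms diff_mem by (auto simp: tensorial_def frag_extend_minus_fun)

lemma tensorial_frag_extend:
  assumes "Poly_Mapping.keys z \<subseteq> X" "\<And>i. i \<in> X \<Longrightarrow> tensorial n (f i)"
  shows "tensorial n (\<lambda>xs. frag_extend (\<lambda>i. f i xs) z)"
  using assms(1)
proof (induction z rule: frag_induction)
  case (diff a b)
  from tensorial_diff_fun[OF this] show ?case by (simp add: frag_extend_diff)
next
  case zero
  show ?case by (auto simp: tensorial_def frag_extend_eq_0)
qed (simp add: assms(2))

lemma tensorial_lmul:
  assumes "a \<in> carrier A" "tensorial n f"
  shows "tensorial n (\<lambda>xs. f (lmul A a xs))"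
proof (cases n)
  case (Suc m)
  show ?thesis
    unfolding Suc
  proof (rule tensorial_SucI, goal_cases)
    case (1 x)
    then show ?case using tensorial_cons[OF assms(2)[unfolded Suc]] assms(1) by simp
  next
    case (2 x y xs)
    then show ?case
      using tensorial_add[OF assms(2)[unfolded Suc], of "a \<otimes> x" "a \<otimes> y" xs] assms(1)
      by (simp add: r_distr)
  next
    case (3 x s y xs)
    have "s \<in> carrier A" using 3 subset by blast
    with 3 show ?case
      using tensorial_balanced[OF assms(2)[unfolded Suc], of "a \<otimes> x" s "y # xs"] assms(1)
      by (auto simp: m_assoc)
  qed
qed simp

lemma tensorial_rmul:
  assumes "a \<in> carrier A" "tensorial n f"
  shows "tensorial n (\<lambda>xs. f (rmul A xs a))"
  using assms(2)
proof (induction n arbitrary: f)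
  case (Suc n)
  show ?case
  proof (rule tensorial_SucI, goal_cases)
    case (1 x)
    show ?case
    proof (cases n)
      case (Suc k)
      show ?thesis
        by (rule tensorial_cong[OF _ Suc.IH[OF tensorial_cons[OF Suc.prems 1]]])
          (use Suc in \<open>auto elim!: tpower_gens_SucE\<close>)
    qed simp
  next
    case (2 x y xs)
    show ?case
    proof (cases xs)
      case Nil
      with 2 tensorial_add[OF Suc.prems, of "x \<otimes> a" "y \<otimes> a" "[]"] assms(1)
      show ?thesis by (auto simp: l_distr)
    next
      case (Cons b bs)
      with 2 tensorial_add[OF Suc.prems, of x y "rmul A xs a"] assms(1)
      show ?thesis using rmul_in_gens[OF assms(1) 2(3)] by simp
    qed
  next
    case (3 x s y xs)
    have s: "s \<in> carrier A" using 3 subset by blast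
    have "rmul A ((s \<otimes> y) # xs) a = lmul A s (rmul A (y # xs) a)"
      using lmul_rmul[OF s assms(1) 3(4)] by simp
    with 3 tensorial_balanced[OF Suc.prems, of x s "rmul A (y # xs) a"] show ?case
      using rmul_in_gens[OF assms(1) 3(4)] by simp
  qed
qed simp

text \<open>
  Lists of length one have no faces, so the value of \<open>f\<close> at the empty list never enters.  The
  restriction to nonempty lists matters where the hypothesis comes from balancedness, which says
  nothing about \<open>[]\<close>.
\<close>

lemma codiff_mem:
  assumes "\<And>ys. ys \<in> tpower_gens A n \<Longrightarrow> ys \<noteq> [] \<Longrightarrow> f ys \<in> K" "xs \<in> tpower_gens A (Suc n)"
  shows "codiff A f xs \<in> K"
  using assms
proof (induction n arbitrary: f xs)
  case 0
  then show ?case by (auto simp: tpower_gens_0 elim!: tpower_gens_SucE)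
next
  case (Suc n)
  obtain x ys where xs: "xs = x # ys" "x \<in> carrier A" "ys \<in> tpower_gens A (Suc n)"
    using Suc.prems(2) by (rule tpower_gens_SucE)
  have "codiff A (\<lambda>ys. f (x # ys)) ys \<in> K"
    by (rule Suc.IH) (use Suc.prems(1) xs in auto)
  moreover have "f (lmul A x ys) \<in> K"
    using Suc.prems(1)[of "lmul A x ys"] lmul_in_gens[OF xs(2,3)] xs by (cases ys) auto
  ultimately show ?case using xs by (simp add: diff_mem)
qed

text \<open>
  This says that the bar differential is well defined on tensor powers.
\<close>

lemma tensorial_codiff: "tensorial n f \<Longrightarrow> tensorial (Suc n) (codiff A f)"
proof (induction n arbitrary: f)
  case 0
  show ?case by (rule tensorial_SucI) (auto simp: tpower_gens_0)
next
  case (Suc n)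
  show ?case
  proof (rule tensorial_SucI, goal_cases)
    case (1 x)
    have "tensorial (Suc n) (\<lambda>xs. f (lmul A x xs) - codiff A (\<lambda>ys. f (x # ys)) xs)"
      by (intro tensorial_diff_fun tensorial_lmul Suc.IH tensorial_cons Suc.prems 1)
    then show ?case by (rule tensorial_cong[rotated]) (auto simp: tpower_gens_def)
  next
    case (2 x y xs)
    have "codiff A (\<lambda>ys. f ((x \<oplus> y) # ys) - f (x # ys) - f (y # ys)) xs \<in> K"
      by (rule codiff_mem[of n]) (use tensorial_add[OF Suc.prems 2(1,2)] 2(3) in auto)
    obtain z zs where z: "xs = z # zs" "z \<in> carrier A" "zs \<in> tpower_gens A n"
      using 2(3) by (rule tpower_gens_SucE)
    have "f (lmul A (x \<oplus> y) xs) - f (lmul A x xs) - f (lmul A y xs) \<in> K"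
      using tensorial_add[OF Suc.prems, of "x \<otimes> z" "y \<otimes> z" zs] z 2 by (simp add: l_distr)
    with \<open>codiff A _ xs \<in> K\<close> have "f (lmul A (x \<oplus> y) xs) - f (lmul A x xs) - f (lmul A y xs)
        - codiff A (\<lambda>ys. f ((x \<oplus> y) # ys) - f (x # ys) - f (y # ys)) xs \<in> K"
      using diff_mem by blast
    moreover have "xs \<noteq> []" using z(1) by simp
    ultimately show ?case unfolding codiff_diff_fun by (simp add: algebra_simps del: lmul.simps)
  next
    case (3 x s y xs)
    have s: "s \<in> carrier A" using 3 subset by blast
    have "codiff A (\<lambda>zs. f ((x \<otimes> s) # zs) - f (x # lmul A s zs)) (y # xs) \<in> K"
      by (rule codiff_mem[of n]) (use tensorial_balanced[OF Suc.prems 3(1,2)] 3(4) in auto)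
    then have "- (codiff A (\<lambda>zs. f ((x \<otimes> s) # zs)) (y # xs) - codiff A (\<lambda>zs. f (x # zs)) (lmul A s (y # xs))) \<in> K"
      using codiff_lmul[OF s 3(4), of "\<lambda>zs. f (x # zs)"] uminus_mem by (simp only: codiff_diff_fun)
    moreover have "f (((x \<otimes> s) \<otimes> y) # xs) = f ((x \<otimes> (s \<otimes> y)) # xs)"
      using 3 s by (simp add: m_assoc)
    ultimately show ?case by (simp add: algebra_simps split: if_splits)
  qed
qed

end

section \<open>The contracting homotopy of a twisted product\<close>

lemma comm_group_subgroup: "comm_group G \<Longrightarrow> subgroup H G \<Longrightarrow> comm_group (G\<lparr>carrier := H\<rparr>)"
  by (rule group.group_comm_groupI)
    (auto intro: subgroup.subgroup_is_group comm_group.axioms(2) comm_monoid.m_comm comm_group.axioms(1)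
      dest: subgroup.mem_carrier)

text \<open>
  Composition with the contracting homotopy: \<open>fac a\<close> is a formal sum of pairs \<open>(l, u)\<close> with
  \<open>a = \<Sum> l u\<close>, and the summand is the value of \<open>f\<close> at \<open>l \<otimes> u \<otimes> as - l \<otimes> h (u as)\<close>.  The recursive
  call vanishes for empty \<open>as\<close>, so the case \<open>h (l u) = l \<otimes> u\<close> needs no equation of its own.
\<close>

function htpy :: "('a, 'm) ring_scheme \<Rightarrow> ('a \<Rightarrow> ('a \<times> 'a) \<Rightarrow>\<^sub>0 int) \<Rightarrow>
    ('a list \<Rightarrow> 'b \<Rightarrow>\<^sub>0 int) \<Rightarrow> 'a list \<Rightarrow> 'b \<Rightarrow>\<^sub>0 int" where
  "htpy A fac f [] = 0"
| "htpy A fac f (a # as) =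
    frag_extend (\<lambda>(l, u). f (l # u # as) - htpy A fac (\<lambda>bs. f (l # bs)) (lmul A u as)) (fac a)"
  by pat_completeness auto
termination by (relation "measure (\<lambda>(A, fac, f, as). length as)") auto

lemma htpy_diff_fun: "htpy A fac (\<lambda>xs. f xs - g xs) xs = htpy A fac f xs - htpy A fac g xs"
proof (induction xs arbitrary: f g rule: length_induct)
  case (1 xs)
  show ?case
  proof (cases xs)
    case (Cons a as)
    have "htpy A fac (\<lambda>bs. f (l # bs) - g (l # bs)) (lmul A u as)
        = htpy A fac (\<lambda>bs. f (l # bs)) (lmul A u as) - htpy A fac (\<lambda>bs. g (l # bs)) (lmul A u as)" for l u
      using 1[rule_format, of "lmul A u as"] Cons by simp
    then have "htpy A fac (\<lambda>xs. f xs - g xs) xs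
      = frag_extend (\<lambda>z. (case z of (l, u) \<Rightarrow> f (l # u # as) - htpy A fac (\<lambda>bs. f (l # bs)) (lmul A u as))
          - (case z of (l, u) \<Rightarrow> g (l # u # as) - htpy A fac (\<lambda>bs. g (l # bs)) (lmul A u as))) (fac a)"
      unfolding Cons htpy.simps by (intro frag_extend_eq) (auto simp: algebra_simps)
    then show ?thesis
      unfolding frag_extend_minus_fun Cons htpy.simps .
  qed simp
qed

text \<open>
  \<open>A = L \<otimes>\<^sub>S U\<close>, with \<open>fac\<close> choosing representatives of the inverse of the multiplication map: the two
  congruences say that \<open>fac\<close> is a homomorphism modulo the tensor relations and inverts
  multiplication.  The induction rule expresses that the products \<open>l u\<close> generate \<open>A\<close>.
\<close>

locale twisted_factorization = relative_pair A S + L: subring L A + U: subring U A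
  for A (structure) and S L U +
  fixes fac :: "'a \<Rightarrow> ('a \<times> 'a) \<Rightarrow>\<^sub>0 int"
  assumes S_le_L: "S \<subseteq> L" and S_le_U: "S \<subseteq> U"
    and keys_fac: "\<And>a. a \<in> carrier A \<Longrightarrow> Poly_Mapping.keys (fac a) \<subseteq> L \<times> U"
    and fac_add: "\<And>a b. a \<in> carrier A \<Longrightarrow> b \<in> carrier A \<Longrightarrow> fac (a \<oplus> b) - fac a - fac b
      \<in> rel_subgroup (L \<times> U) (tensor_rels S (add_monoid A\<lparr>carrier := L\<rparr>) (mult A) (add_monoid A\<lparr>carrier := U\<rparr>) (mult A))"
    and fac_mult: "\<And>l u. l \<in> L \<Longrightarrow> u \<in> U \<Longrightarrow> fac (l \<otimes> u) - frag_of (l, u)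
      \<in> rel_subgroup (L \<times> U) (tensor_rels S (add_monoid A\<lparr>carrier := L\<rparr>) (mult A) (add_monoid A\<lparr>carrier := U\<rparr>) (mult A))"
    and factor_induct: "\<And>P a. a \<in> carrier A \<Longrightarrow> P \<zero> \<Longrightarrow> (\<And>l u. l \<in> L \<Longrightarrow> u \<in> U \<Longrightarrow> P (l \<otimes> u)) \<Longrightarrow>
      (\<And>a b. a \<in> carrier A \<Longrightarrow> b \<in> carrier A \<Longrightarrow> P a \<Longrightarrow> P b \<Longrightarrow> P (a \<ominus> b)) \<Longrightarrow> P a"
begin

lemma L_carrier: "l \<in> L \<Longrightarrow> l \<in> carrier A"
  using L.subset by blast

lemma U_carrier: "u \<in> U \<Longrightarrow> u \<in> carrier A"
  using U.subset by blast

lemma S_carrier: "s \<in> S \<Longrightarrow> s \<in> carrier A"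
  using subset by blast

end

locale twisted_homotopy = twisted_factorization A S L U fac + frag_subgroup K
  for A (structure) and S L U fac and K :: "('b \<Rightarrow>\<^sub>0 int) set"
begin

sublocale tensorial_functions A S K ..

lemma htpy_mem:
  assumes "\<And>ys. ys \<in> tpower_gens A (Suc n) \<Longrightarrow> f ys \<in> K" "xs \<in> tpower_gens A n"
  shows "htpy A fac f xs \<in> K"
  using assms
proof (induction n arbitrary: f xs)
  case 0
  then show ?case by (simp add: tpower_gens_0)
next
  case (Suc n)
  obtain a as where xs: "xs = a # as" "a \<in> carrier A" "as \<in> tpower_gens A n"
    using Suc.prems(2) by (rule tpower_gens_SucE)
  show ?case
    unfolding xs(1) htpy.simps
  proof (rule frag_extend_mem[OF keys_fac[OF xs(2)]], clarify)
    fix l u assume lu: "l \<in> L" "u \<in> U"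
    have "htpy A fac (\<lambda>bs. f (l # bs)) (lmul A u as) \<in> K"
      by (rule Suc.IH) (use lu xs Suc.prems(1) L_carrier U_carrier lmul_in_gens in auto)
    moreover have "f (l # u # as) \<in> K"
      using Suc.prems(1)[of "l # u # as"] lu xs L_carrier U_carrier by simp
    ultimately show "f (l # u # as) - htpy A fac (\<lambda>bs. f (l # bs)) (lmul A u as) \<in> K"
      using diff_mem by blast
  qed
qed

text \<open>
  Two additive functions on \<open>A\<close> agree as soon as they agree on the products \<open>l u\<close>; here \<open>\<psi>\<close> stands
  for their difference.  All identities for the homotopy are checked on products in this way.
\<close>

lemma additive_mem_if_products_mem:
  assumes add: "\<And>a b. a \<in> carrier A \<Longrightarrow> b \<in> carrier A \<Longrightarrow> \<psi> (a \<oplus> b) - \<psi> a - \<psi> b \<in> K"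
    and prod: "\<And>l u. l \<in> L \<Longrightarrow> u \<in> U \<Longrightarrow> \<psi> (l \<otimes> u) \<in> K"
    and a: "a \<in> carrier A"
  shows "\<psi> a \<in> K"
  using a
proof (rule factor_induct)
  have "- (\<psi> (\<zero> \<oplus> \<zero>) - \<psi> \<zero> - \<psi> \<zero>) \<in> K" by (intro uminus_mem add) auto
  then show "\<psi> \<zero> \<in> K" by simp
next
  fix a b assume ab: "a \<in> carrier A" "b \<in> carrier A" "\<psi> a \<in> K" "\<psi> b \<in> K"
  have "\<psi> (a \<ominus> b \<oplus> b) - \<psi> (a \<ominus> b) - \<psi> b \<in> K" by (intro add) (use ab in auto)
  moreover have "a \<ominus> b \<oplus> b = a" using ab by algebra
  ultimately have "\<psi> a - \<psi> (a \<ominus> b) - \<psi> b \<in> K" by simp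
  then have "(\<psi> a - \<psi> b) - (\<psi> a - \<psi> (a \<ominus> b) - \<psi> b) \<in> K" using ab diff_mem by blast
  then show "\<psi> (a \<ominus> b) \<in> K" by (simp add: algebra_simps)
qed (rule prod)

lemma tensor_data_LU:
  "tensor_data S (add_monoid A\<lparr>carrier := L\<rparr>) (mult A) (add_monoid A\<lparr>carrier := U\<rparr>) (mult A)"
proof -
  have L: "comm_group (add_monoid A\<lparr>carrier := L\<rparr>)" and U: "comm_group (add_monoid A\<lparr>carrier := U\<rparr>)"
    by (rule comm_group_subgroup[OF a_comm_group L.subgroup_axioms] comm_group_subgroup[OF a_comm_group U.subgroup_axioms])+
  show ?thesis
    unfolding tensor_data_def tensor_data_axioms_def using L U S_le_L S_le_U by auto
qed

text \<open>
  The summand in the definition of \<open>htpy\<close> must be additive and \<open>S\<close>-balanced in \<open>(l, u)\<close>; then its sum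
  over \<open>fac a\<close> does not depend on the choice of \<open>fac\<close>, is additive in \<open>a\<close>, and at \<open>a = l u\<close> is the
  summand itself.  The summand contains \<open>htpy\<close> on a shorter list: additivity in \<open>u\<close> is the first claim
  for that list.  Balancedness moves \<open>s \<in> S \<subseteq> L\<close> from \<open>u\<close> to \<open>l\<close> and needs that the homotopy is
  left \<open>L\<close>-linear on the shorter list, which is the third claim.  So the three claims are proved by one
  induction.
\<close>

lemma htpy_add_mult_lmul:
  assumes "tensorial (Suc (Suc m)) f" "as \<in> tpower_gens A m"
  shows "\<And>a b. a \<in> carrier A \<Longrightarrow> b \<in> carrier A \<Longrightarrow>
      htpy A fac f ((a \<oplus> b) # as) - htpy A fac f (a # as) - htpy A fac f (b # as) \<in> K"
    and "\<And>l u. l \<in> L \<Longrightarrow> u \<in> U \<Longrightarrow>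
      htpy A fac f ((l \<otimes> u) # as) - (f (l # u # as) - htpy A fac (\<lambda>bs. f (l # bs)) (lmul A u as)) \<in> K"
    and "\<And>l a. l \<in> L \<Longrightarrow> a \<in> carrier A \<Longrightarrow>
      htpy A fac f ((l \<otimes> a) # as) - htpy A fac (\<lambda>bs. f (lmul A l bs)) (a # as) \<in> K"
proof -
  have "(\<forall>a\<in>carrier A. \<forall>b\<in>carrier A. htpy A fac f ((a \<oplus> b) # as) - htpy A fac f (a # as) - htpy A fac f (b # as) \<in> K)
    \<and> (\<forall>l\<in>L. \<forall>u\<in>U. htpy A fac f ((l \<otimes> u) # as) - (f (l # u # as) - htpy A fac (\<lambda>bs. f (l # bs)) (lmul A u as)) \<in> K)
    \<and> (\<forall>l\<in>L. \<forall>a\<in>carrier A. htpy A fac f ((l \<otimes> a) # as) - htpy A fac (\<lambda>bs. f (lmul A l bs)) (a # as) \<in> K)"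
    using assms
  proof (induction m arbitrary: f as rule: less_induct)
    case (less m)
    let ?M = "add_monoid A\<lparr>carrier := L\<rparr>" and ?N = "add_monoid A\<lparr>carrier := U\<rparr>"
    let ?q = "\<lambda>f (l, u). f (l # u # as) - htpy A fac (\<lambda>bs. f (l # bs)) (lmul A u as)"
    interpret T: tensor_data S ?M "mult A" ?N "mult A" by (rule tensor_data_LU)
    have bilinear: "frag_extend (?q g) r \<in> K"
      if g: "tensorial (Suc (Suc m)) g" and r: "r \<in> tensor_rels S ?M (mult A) ?N (mult A)" for g r
      using r
    proof (cases rule: T.tensor_relE)
      case (add_left l l' u)
      then have lu: "l \<in> carrier A" "l' \<in> carrier A" "u \<in> carrier A" using L_carrier U_carrier by auto
      have "htpy A fac (\<lambda>bs. g ((l \<oplus> l') # bs) - g (l # bs) - g (l' # bs)) (lmul A u as) \<in> K"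
        by (rule htpy_mem[of m])
          (use lu less.prems(2) lmul_in_gens tensorial_add[OF g lu(1,2)] in auto)
      moreover have "g ((l \<oplus> l') # u # as) - g (l # u # as) - g (l' # u # as) \<in> K"
        using tensorial_add[OF g lu(1,2)] lu less.prems(2) by simp
      ultimately have "(g ((l \<oplus> l') # u # as) - g (l # u # as) - g (l' # u # as))
        - htpy A fac (\<lambda>bs. g ((l \<oplus> l') # bs) - g (l # bs) - g (l' # bs)) (lmul A u as) \<in> K"
        using diff_mem by blast
      then show ?thesis
        unfolding add_left(1) htpy_diff_fun by (simp add: frag_extend_diff frag_extend_add algebra_simps)
    next
      case (add_right l u u')
      then have lu: "l \<in> carrier A" "u \<in> carrier A" "u' \<in> carrier A" using L_carrier U_carrier by auto
      have gl: "tensorial (Suc m) (\<lambda>bs. g (l # bs))" by (rule tensorial_cons[OF g lu(1)])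
      have 1: "g (l # (u \<oplus> u') # as) - g (l # u # as) - g (l # u' # as) \<in> K"
        using tensorial_add[OF gl lu(2,3) less.prems(2)] .
      have 2: "htpy A fac (\<lambda>bs. g (l # bs)) (lmul A (u \<oplus> u') as) - htpy A fac (\<lambda>bs. g (l # bs)) (lmul A u as)
        - htpy A fac (\<lambda>bs. g (l # bs)) (lmul A u' as) \<in> K"
      proof (cases as)
        case (Cons b bs)
        then obtain k where k: "m = Suc k" "b \<in> carrier A" "bs \<in> tpower_gens A k"
          using less.prems(2) by auto
        then show ?thesis
          using less.IH[of k "\<lambda>bs. g (l # bs)" bs] gl lu Cons by (simp add: l_distr)
      qed simp
      from diff_mem[OF 1 2] show ?thesis
        unfolding add_right(1) by (simp add: frag_extend_diff frag_extend_add algebra_simps)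
    next
      case (balanced l s u)
      then have lu: "l \<in> L" "l \<in> carrier A" "s \<in> S" "s \<in> L" "s \<in> carrier A" "u \<in> carrier A"
        using L_carrier U_carrier S_le_L by auto
      have gl: "tensorial (Suc m) (\<lambda>bs. g (l # bs))" by (rule tensorial_cons[OF g lu(2)])
      have 1: "g ((l \<otimes> s) # u # as) - g (l # (s \<otimes> u) # as) \<in> K"
        using tensorial_balanced[OF g lu(2,3), of "u # as"] lu less.prems(2) by simp
      have 2: "htpy A fac (\<lambda>bs. g ((l \<otimes> s) # bs)) (lmul A u as) - htpy A fac (\<lambda>bs. g (l # bs)) (lmul A (s \<otimes> u) as) \<in> K"
      proof (cases as)
        case (Cons b bs)
        then obtain k where k: "m = Suc k" "b \<in> carrier A" "bs \<in> tpower_gens A k"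
          using less.prems(2) by auto
        have "htpy A fac (\<lambda>bs. g ((l \<otimes> s) # bs) - g (l # lmul A s bs)) (lmul A u as) \<in> K"
        proof (rule htpy_mem[of m])
          fix ys assume ys: "ys \<in> tpower_gens A (Suc m)"
          then have "ys \<noteq> []" by auto
          with tensorial_balanced[OF g lu(2,3) ys]
          show "g ((l \<otimes> s) # ys) - g (l # lmul A s ys) \<in> K" .
        qed (use lu less.prems(2) lmul_in_gens in auto)
        moreover have "htpy A fac (\<lambda>bs. g (l # bs)) (lmul A (s \<otimes> u) as)
            - htpy A fac (\<lambda>bs. g (l # lmul A s bs)) (lmul A u as) \<in> K"
          using less.IH[of k "\<lambda>bs. g (l # bs)" bs] gl lu Cons k by (simp add: m_assoc)
        ultimately show ?thesis
          unfolding htpy_diff_fun using diff_mem by fastforce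
      qed simp
      from diff_mem[OF 1 2] show ?thesis
        unfolding balanced(1) by (simp add: frag_extend_diff frag_extend_add algebra_simps)
    qed
    have ext: "frag_extend (?q g) z \<in> K" if "tensorial (Suc (Suc m)) g"
      "z \<in> rel_subgroup (L \<times> U) (tensor_rels S ?M (mult A) ?N (mult A))" for g z
      using T.frag_extend_rel_subgroup[OF frag_subgroup_axioms bilinear[OF that(1)], of z] that(2) by simp
    have h: "htpy A fac g (a # as) = frag_extend (?q g) (fac a)" for g a by simp
    have add: "htpy A fac g ((a \<oplus> b) # as) - htpy A fac g (a # as) - htpy A fac g (b # as) \<in> K"
      if "tensorial (Suc (Suc m)) g" "a \<in> carrier A" "b \<in> carrier A" for g a b
      using ext[OF that(1) fac_add[OF that(2,3)]] unfolding h frag_extend_diff .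
    have eq: "htpy A fac g ((l \<otimes> u) # as) - (g (l # u # as) - htpy A fac (\<lambda>bs. g (l # bs)) (lmul A u as)) \<in> K"
      if "tensorial (Suc (Suc m)) g" "l \<in> L" "u \<in> U" for g l u
      using ext[OF that(1) fac_mult[OF that(2,3)]] unfolding h frag_extend_diff by simp
    have lin: "htpy A fac f ((l \<otimes> a) # as) - htpy A fac (\<lambda>bs. f (lmul A l bs)) (a # as) \<in> K"
      if l: "l \<in> L" and a: "a \<in> carrier A" for l a
    proof (rule additive_mem_if_products_mem[OF _ _ a])
      have lc: "l \<in> carrier A" using l L_carrier by blast
      have fl: "tensorial (Suc (Suc m)) (\<lambda>bs. f (lmul A l bs))"
        by (rule tensorial_lmul[OF lc less.prems(1)])
      {
        fix a b assume ab: "a \<in> carrier A" "b \<in> carrier A"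
        have "htpy A fac f ((l \<otimes> a \<oplus> l \<otimes> b) # as) - htpy A fac f ((l \<otimes> a) # as) - htpy A fac f ((l \<otimes> b) # as) \<in> K"
          by (rule add[OF less.prems(1)]) (use lc ab in auto)
        from diff_mem[OF this add[OF fl ab]]
        show "htpy A fac f ((l \<otimes> (a \<oplus> b)) # as) - htpy A fac (\<lambda>bs. f (lmul A l bs)) ((a \<oplus> b) # as)
          - (htpy A fac f ((l \<otimes> a) # as) - htpy A fac (\<lambda>bs. f (lmul A l bs)) (a # as))
          - (htpy A fac f ((l \<otimes> b) # as) - htpy A fac (\<lambda>bs. f (lmul A l bs)) (b # as)) \<in> K"
          using lc ab by (simp add: r_distr algebra_simps del: htpy.simps)
      next
        fix l' u assume lu: "l' \<in> L" "u \<in> U"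
        then have "htpy A fac f (((l \<otimes> l') \<otimes> u) # as)
            - (f ((l \<otimes> l') # u # as) - htpy A fac (\<lambda>bs. f ((l \<otimes> l') # bs)) (lmul A u as)) \<in> K"
          by (intro eq[OF less.prems(1)]) (auto simp: l)
        from diff_mem[OF this eq[OF fl lu]]
        show "htpy A fac f ((l \<otimes> (l' \<otimes> u)) # as) - htpy A fac (\<lambda>bs. f (lmul A l bs)) ((l' \<otimes> u) # as) \<in> K"
          using lc lu L_carrier U_carrier by (simp add: m_assoc del: htpy.simps)
      }
    qed
    show ?case using add[OF less.prems(1)] eq[OF less.prems(1)] lin by blast
  qed
  then show "\<And>a b. a \<in> carrier A \<Longrightarrow> b \<in> carrier A \<Longrightarrow>
      htpy A fac f ((a \<oplus> b) # as) - htpy A fac f (a # as) - htpy A fac f (b # as) \<in> K"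
    and "\<And>l u. l \<in> L \<Longrightarrow> u \<in> U \<Longrightarrow>
      htpy A fac f ((l \<otimes> u) # as) - (f (l # u # as) - htpy A fac (\<lambda>bs. f (l # bs)) (lmul A u as)) \<in> K"
    and "\<And>l a. l \<in> L \<Longrightarrow> a \<in> carrier A \<Longrightarrow>
      htpy A fac f ((l \<otimes> a) # as) - htpy A fac (\<lambda>bs. f (lmul A l bs)) (a # as) \<in> K"
    by blast+
qed

lemmas htpy_add = htpy_add_mult_lmul(1) and htpy_mult = htpy_add_mult_lmul(2) and htpy_lmul = htpy_add_mult_lmul(3)

text \<open>
  The homotopy is well defined on tensor powers.  Balancedness between the first two entries is checked
  on products: moving \<open>s\<close> past \<open>l u\<close> means moving it past \<open>u \<in> U\<close>, and \<open>u s\<close> is again in \<open>U\<close>.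
\<close>

lemma tensorial_htpy: "tensorial (Suc n) f \<Longrightarrow> tensorial n (htpy A fac f)"
proof (induction n arbitrary: f)
  case (Suc n)
  show ?case
  proof (rule tensorial_SucI, goal_cases)
    case (1 a)
    have "tensorial n (\<lambda>as. f (l # u # as) - htpy A fac (\<lambda>bs. f (l # bs)) (lmul A u as))"
      if "l \<in> L" "u \<in> U" for l u
    proof -
      have lu: "l \<in> carrier A" "u \<in> carrier A" using that L_carrier U_carrier by auto
      show ?thesis
        by (intro tensorial_diff_fun tensorial_lmul[OF lu(2)] Suc.IH tensorial_cons[OF Suc.prems lu(1)]
            tensorial_cons[OF tensorial_cons[OF Suc.prems lu(1)] lu(2)])
    qed
    then have "tensorial n (\<lambda>as. frag_extend
        (\<lambda>z. case z of (l, u) \<Rightarrow> f (l # u # as) - htpy A fac (\<lambda>bs. f (l # bs)) (lmul A u as)) (fac a))"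
      by (intro tensorial_frag_extend[OF keys_fac[OF 1]]) auto
    then show ?case by simp
  next
    case (2 x y xs)
    then show ?case by (intro htpy_add[OF Suc.prems])
  next
    case (3 x s y xs)
    have s: "s \<in> carrier A" and y: "y \<in> carrier A" using 3 S_carrier by auto
    have sy: "s \<otimes> y # xs \<in> tpower_gens A n" using 3 s by auto
    note add1 = htpy_add[OF Suc.prems 3(4)] and add2 = htpy_add[OF Suc.prems sy]
    show ?case
    proof (rule additive_mem_if_products_mem[OF _ _ 3(1)])
      fix a b assume ab: "a \<in> carrier A" "b \<in> carrier A"
      have "htpy A fac f ((a \<otimes> s \<oplus> b \<otimes> s) # y # xs) - htpy A fac f ((a \<otimes> s) # y # xs)
          - htpy A fac f ((b \<otimes> s) # y # xs) \<in> K"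
        by (rule add1) (use ab s in auto)
      from diff_mem[OF this add2[OF ab]]
      show "htpy A fac f ((a \<oplus> b) \<otimes> s # y # xs) - htpy A fac f ((a \<oplus> b) # s \<otimes> y # xs)
        - (htpy A fac f (a \<otimes> s # y # xs) - htpy A fac f (a # s \<otimes> y # xs))
        - (htpy A fac f (b \<otimes> s # y # xs) - htpy A fac f (b # s \<otimes> y # xs)) \<in> K"
        using ab s by (simp add: l_distr algebra_simps del: htpy.simps)
    next
      fix l u assume lu: "l \<in> L" "u \<in> U"
      then have lu': "l \<in> carrier A" "u \<in> carrier A" "u \<otimes> s \<in> U"
        using L_carrier U_carrier 3(2) S_le_U by auto
      have 1: "htpy A fac f ((l \<otimes> (u \<otimes> s)) # y # xs)
          - (f (l # u \<otimes> s # y # xs) - htpy A fac (\<lambda>bs. f (l # bs)) (u \<otimes> s \<otimes> y # xs)) \<in> K"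
        using htpy_mult[OF Suc.prems 3(4) lu(1) lu'(3)] by simp
      have 2: "htpy A fac f (l \<otimes> u # s \<otimes> y # xs)
          - (f (l # u # s \<otimes> y # xs) - htpy A fac (\<lambda>bs. f (l # bs)) (u \<otimes> (s \<otimes> y) # xs)) \<in> K"
        using htpy_mult[OF Suc.prems sy lu] by simp
      have 3: "f (l # u \<otimes> s # y # xs) - f (l # u # s \<otimes> y # xs) \<in> K"
        using tensorial_balanced[OF tensorial_cons[OF Suc.prems lu'(1)] lu'(2) 3(2) 3(4)] by simp
      from add_mem[OF diff_mem[OF 1 2] 3]
      show "htpy A fac f (l \<otimes> u \<otimes> s # y # xs) - htpy A fac f (l \<otimes> u # s \<otimes> y # xs) \<in> K"
        using lu' s y by (simp add: m_assoc algebra_simps del: htpy.simps)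
    qed
  qed
qed simp

text \<open>
  The identity \<open>h d + d h = 1\<close>.  Both sides are additive in the first entry, so let it be \<open>l u\<close>, and
  write \<open>F\<close> for \<open>f\<close> with first argument \<open>l\<close>.  Expanding both composites, the terms with \<open>l \<otimes> u \<otimes> \<dots>\<close>
  cancel, left \<open>L\<close>-linearity cancels the two terms in which \<open>h\<close> is applied to \<open>l u b \<otimes> \<dots>\<close>, and
  what remains is \<open>f (l u \<otimes> \<dots>)\<close> plus \<open>h d + d h - 1\<close> for \<open>F\<close> on the shorter list \<open>u b \<otimes> \<dots>\<close>.
\<close>

lemma htpy_codiff:
  assumes "tensorial (Suc m) f" "xs \<in> tpower_gens A (Suc m)"
  shows "htpy A fac (codiff A f) xs + codiff A (htpy A fac f) xs - f xs \<in> K"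
  using assms
proof (induction m arbitrary: f xs)
  case 0
  obtain a where xs: "xs = [a]" "a \<in> carrier A"
    using 0(2) by (auto simp: tpower_gens_0 elim!: tpower_gens_SucE)
  have df: "tensorial (Suc (Suc 0)) (codiff A f)" by (rule tensorial_codiff[OF 0(1)])
  have "htpy A fac (codiff A f) [a] - f [a] \<in> K"
  proof (rule additive_mem_if_products_mem[OF _ _ xs(2)])
    fix a b assume ab: "a \<in> carrier A" "b \<in> carrier A"
    have "htpy A fac (codiff A f) [a \<oplus> b] - htpy A fac (codiff A f) [a] - htpy A fac (codiff A f) [b] \<in> K"
      using htpy_add[OF df _ ab, of "[]"] by simp
    moreover have "f [a \<oplus> b] - f [a] - f [b] \<in> K"
      using tensorial_add[OF 0(1) ab, of "[]"] by simp
    ultimately have "(htpy A fac (codiff A f) [a \<oplus> b] - htpy A fac (codiff A f) [a] - htpy A fac (codiff A f) [b])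
      - (f [a \<oplus> b] - f [a] - f [b]) \<in> K"
      by (rule diff_mem)
    then show "htpy A fac (codiff A f) [a \<oplus> b] - f [a \<oplus> b] - (htpy A fac (codiff A f) [a] - f [a])
      - (htpy A fac (codiff A f) [b] - f [b]) \<in> K"
      by (simp add: algebra_simps del: htpy.simps)
  next
    fix l u assume "l \<in> L" "u \<in> U"
    from htpy_mult[OF df _ this, of "[]"]
    show "htpy A fac (codiff A f) [l \<otimes> u] - f [l \<otimes> u] \<in> K" by simp
  qed
  then show ?case using xs by simp
next
  case (Suc m)
  obtain a b y where xs: "xs = a # b # y" "a \<in> carrier A" "b \<in> carrier A" "y \<in> tpower_gens A m"
    using Suc.prems(2) by (auto elim!: tpower_gens_SucE)
  have df: "tensorial (Suc (Suc (Suc m))) (codiff A f)"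
    by (rule tensorial_codiff[OF Suc.prems(1)])
  have dh: "tensorial (Suc (Suc m)) (codiff A (htpy A fac f))"
    by (intro tensorial_codiff tensorial_htpy Suc.prems(1))
  have bs: "b # y \<in> tpower_gens A (Suc m)" using xs by simp
  have "htpy A fac (codiff A f) (a # b # y) + codiff A (htpy A fac f) (a # b # y) - f (a # b # y) \<in> K"
  proof (rule additive_mem_if_products_mem[OF _ _ xs(2)])
    fix a a' assume aa: "a \<in> carrier A" "a' \<in> carrier A"
    from diff_mem[OF add_mem[OF htpy_add[OF df bs aa] tensorial_add[OF dh aa bs]]
        tensorial_add[OF Suc.prems(1) aa bs]]
    show "htpy A fac (codiff A f) ((a \<oplus> a') # b # y) + codiff A (htpy A fac f) ((a \<oplus> a') # b # y) - f ((a \<oplus> a') # b # y)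
      - (htpy A fac (codiff A f) (a # b # y) + codiff A (htpy A fac f) (a # b # y) - f (a # b # y))
      - (htpy A fac (codiff A f) (a' # b # y) + codiff A (htpy A fac f) (a' # b # y) - f (a' # b # y)) \<in> K"
      by (simp only: algebra_simps)
  next
    fix l u assume lu: "l \<in> L" "u \<in> U"
    then have lc: "l \<in> carrier A" and uc: "u \<in> carrier A" using L_carrier U_carrier by auto
    define F where "F = (\<lambda>bs. f (l # bs))"
    define z where "z = u \<otimes> b # y"
    have F: "tensorial (Suc m) F" unfolding F_def by (rule tensorial_cons[OF Suc.prems(1) lc])
    have z: "z \<in> tpower_gens A (Suc m)" "z = lmul A u (b # y)" unfolding z_def using uc xs by auto
    have 1: "htpy A fac (codiff A f) (l \<otimes> u # b # y)
        - (codiff A f (l # u # b # y) - htpy A fac (\<lambda>bs. codiff A f (l # bs)) z) \<in> K"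
      using htpy_mult[OF df bs lu] by (simp add: z_def)
    \<comment> \<open>Split off the face that multiplies \<open>l\<close> into the next entry; the homotopy only sees nonempty lists here.\<close>
    have "htpy A fac (\<lambda>bs. codiff A f (l # bs) - (f (lmul A l bs) - codiff A F bs)) z \<in> K"
      by (rule htpy_mem[OF _ z(1)]) (auto simp: F_def tpower_gens_def)
    then have 2: "htpy A fac (\<lambda>bs. codiff A f (l # bs)) z
        - (htpy A fac (\<lambda>bs. f (lmul A l bs)) z - htpy A fac (codiff A F) z) \<in> K"
      by (simp only: htpy_diff_fun)
    have 3: "htpy A fac f (l \<otimes> (u \<otimes> b) # y) - htpy A fac (\<lambda>bs. f (lmul A l bs)) z \<in> K"
      using htpy_lmul[OF Suc.prems(1) xs(4) lu(1), of "u \<otimes> b"] uc xs by (simp add: z_def del: htpy.simps)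
    have "codiff A (\<lambda>bs. htpy A fac f (l \<otimes> u # bs) - (F (u # bs) - htpy A fac F (lmul A u bs))) (b # y) \<in> K"
      by (rule codiff_mem[of m]) (use htpy_mult[OF Suc.prems(1) _ lu] xs in \<open>auto simp: F_def\<close>)
    then have 4: "codiff A (\<lambda>bs. htpy A fac f (l \<otimes> u # bs)) (b # y)
        - (codiff A (\<lambda>bs. F (u # bs)) (b # y) - codiff A (htpy A fac F) z) \<in> K"
      unfolding codiff_diff_fun z(2) codiff_lmul[OF uc bs] .
    have 5: "htpy A fac (codiff A F) z + codiff A (htpy A fac F) z - F z \<in> K"
      by (rule Suc.IH[OF F z(1)])
    have e1: "codiff A f (l # u # b # y) = f (l \<otimes> u # b # y) - (F z - codiff A (\<lambda>bs. F (u # bs)) (b # y))"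
      by (simp add: F_def z_def)
    have e2: "codiff A (htpy A fac f) (l \<otimes> u # b # y)
        = htpy A fac f (l \<otimes> (u \<otimes> b) # y) - codiff A (\<lambda>bs. htpy A fac f (l \<otimes> u # bs)) (b # y)"
      using lc uc xs by (simp add: m_assoc del: htpy.simps)
    from add_mem[OF diff_mem[OF add_mem[OF diff_mem[OF 1 2] 3] 4] 5]
    show "htpy A fac (codiff A f) (l \<otimes> u # b # y) + codiff A (htpy A fac f) (l \<otimes> u # b # y)
        - f (l \<otimes> u # b # y) \<in> K"
      unfolding e1 e2 by (simp add: algebra_simps del: htpy.simps codiff.simps)
  qed
  then show ?case unfolding xs(1) .
qed

end

section \<open>Factorizations from a twisted product\<close>

text \<open>
  The multiplication map has the tensor relations as its kernel and is onto, so any choice of formal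
  preimages satisfies the congruences.
\<close>

lemma (in relative_pair) twisted_product_factorization:
  assumes "subring L A" "subring U A" and SL: "S \<subseteq> L" and SU: "S \<subseteq> U" and tp: "twisted_product A S L U"
  obtains fac where "twisted_factorization A S L U fac"
proof -
  interpret L: subring L A by fact
  interpret U: subring U A by fact
  define M where "M = add_monoid A\<lparr>carrier := L\<rparr>"
  define N where "N = add_monoid A\<lparr>carrier := U\<rparr>"
  have MN: "carrier M = L" "carrier N = U" by (simp_all add: M_def N_def)
  interpret T: tensor_data S M "mult A" N "mult A"
    unfolding tensor_data_def tensor_data_axioms_def MN unfolding M_def N_def
    using comm_group_subgroup[OF a_comm_group L.subgroup_axioms]
      comm_group_subgroup[OF a_comm_group U.subgroup_axioms] SL SU by auto
  obtain \<alpha> where iso: "\<alpha> \<in> iso T.T (add_monoid A)"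
    and \<alpha>: "\<And>l u. l \<in> L \<Longrightarrow> u \<in> U \<Longrightarrow> \<alpha> (T.pure l u) = l \<otimes> u"
    using tp unfolding twisted_product_def Let_def M_def N_def by blast
  define rels where "rels = rel_subgroup (L \<times> U) (tensor_rels S M (mult A) N (mult A))"
  define ev where "ev z = \<alpha> (rel_class (L \<times> U) (tensor_rels S M (mult A) N (mult A)) z)" for z
  interpret \<alpha>: group_hom T.T "add_monoid A" \<alpha>
    using iso by (simp add: group_hom_def group_hom_axioms_def iso_def T.T.is_group a_group)
  have TT: "presented_group (L \<times> U) (tensor_rels S M (mult A) N (mult A)) = T.T"
    by (simp add: T.tensor_presented MN)
  have bij: "bij_betw \<alpha> (carrier T.T) (carrier A)" using iso by (simp add: iso_def)
  have clsT: "rel_class (L \<times> U) (tensor_rels S M (mult A) N (mult A)) z \<in> carrier T.T"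
    if "Poly_Mapping.keys z \<subseteq> L \<times> U" for z
    using T.rel_class_closed[of z] that by (simp add: MN TT)
  have ev_closed: "ev z \<in> carrier A" if "Poly_Mapping.keys z \<subseteq> L \<times> U" for z
    using \<alpha>.hom_closed[OF clsT[OF that]] by (simp add: ev_def)
  have ev_diff: "ev (x - y) = ev x \<ominus> ev y"
    if "Poly_Mapping.keys x \<subseteq> L \<times> U" "Poly_Mapping.keys y \<subseteq> L \<times> U" for x y
    using T.rel_class_diff[of x y] that \<alpha>.hom_mult[OF clsT[OF that(1)]] \<alpha>.hom_inv[OF clsT[OF that(2)]]
      T.T.inv_closed[OF clsT[OF that(2)]]
    unfolding MN ev_def TT a_minus_def a_inv_def by simp
  have ev_0: "ev 0 = \<zero>"
    using T.rel_class_0 \<alpha>.hom_one unfolding MN ev_def TT by simp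
  have ev_of: "ev (frag_of (l, u)) = l \<otimes> u" if "l \<in> L" "u \<in> U" for l u
    using \<alpha>[OF that] unfolding ev_def T.pure_eq MN .
  have ker: "z \<in> rels" if "Poly_Mapping.keys z \<subseteq> L \<times> U" "ev z = \<zero>" for z
  proof -
    have "inj_on \<alpha> (carrier T.T)" by (rule bij_betw_imp_inj_on[OF bij])
    then have "rel_class (L \<times> U) (tensor_rels S M (mult A) N (mult A)) z = \<one>\<^bsub>T.T\<^esub>"
      by (rule inj_onD[OF _ _ clsT[OF that(1)] T.T.one_closed]) (use that \<alpha>.hom_one in \<open>simp add: ev_def\<close>)
    then show ?thesis
      using T.rel_class_eq_one_iff[of z] that unfolding MN TT rels_def by simp
  qed
  have surj: "\<exists>z. Poly_Mapping.keys z \<subseteq> L \<times> U \<and> ev z = a" if a: "a \<in> carrier A" for a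
  proof -
    have "a \<in> \<alpha> ` carrier T.T" using a bij_betw_imp_surj_on[OF bij] by simp
    then obtain t where t: "a = \<alpha> t" "t \<in> carrier T.T" by (rule imageE)
    obtain z where "Poly_Mapping.keys z \<subseteq> L \<times> U" "t = rel_class (L \<times> U) (tensor_rels S M (mult A) N (mult A)) z"
      using t(2) by (rule T.rel_class_cases[of t, unfolded MN TT])
    with t(1) show ?thesis by (auto simp: ev_def)
  qed
  define fac where "fac a = (SOME z. Poly_Mapping.keys z \<subseteq> L \<times> U \<and> ev z = a)" for a
  have fac: "Poly_Mapping.keys (fac a) \<subseteq> L \<times> U" "ev (fac a) = a" if "a \<in> carrier A" for a
    using someI_ex[OF surj[OF that]] unfolding fac_def by auto
  have LU: "l \<otimes> u \<in> carrier A" if "l \<in> L" "u \<in> U" for l u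
    using that L.subset U.subset by blast
  have "twisted_factorization A S L U fac"
  proof (unfold_locales, goal_cases)
    case (3 a)
    then show ?case by (rule fac(1))
  next
    case (4 a b)
    have k: "Poly_Mapping.keys (fac (a \<oplus> b) - fac a) \<subseteq> L \<times> U"
      by (rule keys_diff_subset) (use 4 fac in auto)
    have "Poly_Mapping.keys (fac (a \<oplus> b) - fac a - fac b) \<subseteq> L \<times> U"
      by (rule keys_diff_subset[OF k]) (use 4 fac in auto)
    moreover have "ev (fac (a \<oplus> b) - fac a - fac b) = a \<oplus> b \<ominus> a \<ominus> b"
      using 4 fac by (simp add: ev_diff k)
    moreover have "a \<oplus> b \<ominus> a \<ominus> b = \<zero>" using 4 by algebra
    ultimately show ?case using ker unfolding rels_def M_def N_def by simp
  next
    case (5 l u)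
    have "Poly_Mapping.keys (fac (l \<otimes> u) - frag_of (l, u)) \<subseteq> L \<times> U"
      by (rule keys_diff_subset) (use 5 fac LU in auto)
    moreover have "ev (fac (l \<otimes> u) - frag_of (l, u)) = \<zero>"
      using 5 fac LU by (simp add: ev_diff ev_of r_neg a_minus_def)
    ultimately show ?case using ker unfolding rels_def M_def N_def by simp
  next
    case (6 P a)
    obtain z where z: "Poly_Mapping.keys z \<subseteq> L \<times> U" "ev z = a" using surj[OF 6(1)] by blast
    from z(1) have "P (ev z)"
    proof (rule free_Abelian_group_induct[where P = "\<lambda>z. P (ev z)"])
      show "P (ev (x - y))" if "Poly_Mapping.keys x \<subseteq> L \<times> U" "Poly_Mapping.keys y \<subseteq> L \<times> U"
        "P (ev x)" "P (ev y)" for x y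
        using 6(4)[OF ev_closed ev_closed] ev_diff that by simp
    qed (use 6(2,3) ev_0 ev_of in auto)
    with z(2) show ?case by simp
  qed (use SL SU in auto)
  then show thesis by (rule that)
qed

section \<open>The ideal generated by the idempotent\<close>

text \<open>
  Multiplication by a fixed element on either side is additive and maps the generators \<open>a e b\<close> to
  generators; the local fact \<open>closed\<close> treats both sides at once.
\<close>

lemma (in ring) ideal_AeA:
  assumes e: "e \<in> carrier R"
  shows "ideal (AeA R e) R"
proof (rule idealI[OF ring_axioms])
  let ?G = "{a \<otimes> e \<otimes> b | a b. a \<in> carrier R \<and> b \<in> carrier R}"
  have G: "?G \<subseteq> carrier (add_monoid R)" using e by auto
  show sub: "subgroup (AeA R e) (add_monoid R)"
    unfolding AeA_def by (rule group.generate_is_subgroup[OF a_group G])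
  have c: "x \<in> carrier R" if "x \<in> AeA R e" for x
    using subgroup.mem_carrier[OF sub that] by simp
  have closed: "f x \<in> AeA R e"
    if f: "\<And>x y. x \<in> carrier R \<Longrightarrow> y \<in> carrier R \<Longrightarrow> f (x \<oplus> y) = f x \<oplus> f y" "f \<zero> = \<zero>"
      "\<And>x. x \<in> carrier R \<Longrightarrow> f (\<ominus> x) = \<ominus> f x" "\<And>x. x \<in> ?G \<Longrightarrow> f x \<in> AeA R e"
      and x: "x \<in> AeA R e" for f x
  proof -
    have "x \<in> AeA R e \<and> f x \<in> AeA R e" if "x \<in> generate (add_monoid R) ?G" for x
      using that
    proof (induction x rule: generate.induct)
      case one
      show ?case using subgroup.one_closed[OF sub] f(2) by simp
    next
      case (incl h)
      then show ?case using f(4) unfolding AeA_def by (auto intro: generate.incl)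
    next
      case (inv h)
      have "h \<in> AeA R e" using inv unfolding AeA_def by (auto intro: generate.incl)
      moreover have "f (\<ominus> h) = \<ominus> f h" by (rule f(3)) (use inv G in auto)
      ultimately show ?case
        using subgroup.m_inv_closed[OF sub, of h] subgroup.m_inv_closed[OF sub f(4)[OF inv]]
        by (simp add: a_inv_def)
    next
      case (eng x y)
      then show ?case
        using subgroup.m_closed[OF sub, of x y] subgroup.m_closed[OF sub, of "f x" "f y"] f(1) c by auto
    qed
    with x show ?thesis unfolding AeA_def by blast
  qed
  have gen: "a \<otimes> e \<otimes> b \<in> AeA R e" if "a \<in> carrier R" "b \<in> carrier R" for a b
    using that unfolding AeA_def by (auto intro: generate.incl)
  show "x \<otimes> a \<in> AeA R e" if "a \<in> AeA R e" and x: "x \<in> carrier R" for a x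
  proof (rule closed[OF _ _ _ _ that(1)])
    fix g assume "g \<in> ?G"
    then obtain c d where "g = c \<otimes> e \<otimes> d" "c \<in> carrier R" "d \<in> carrier R" by blast
    then show "x \<otimes> g \<in> AeA R e" using gen[of "x \<otimes> c" d] x e by (simp add: m_assoc)
  qed (use x in \<open>auto simp: r_distr r_minus\<close>)
  show "a \<otimes> x \<in> AeA R e" if "a \<in> AeA R e" and x: "x \<in> carrier R" for a x
  proof (rule closed[OF _ _ _ _ that(1)])
    fix g assume "g \<in> ?G"
    then obtain c d where "g = c \<otimes> e \<otimes> d" "c \<in> carrier R" "d \<in> carrier R" by blast
    then show "g \<otimes> x \<in> AeA R e" using gen[of c "d \<otimes> x"] x e by (simp add: m_assoc)
  qed (use x in \<open>auto simp: l_distr l_minus\<close>)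
qed

lemma (in ring) self_in_AeA:
  assumes "e \<in> carrier R"
  shows "e \<in> AeA R e"
proof -
  have "\<one> \<otimes> e \<otimes> \<one> \<in> AeA R e" unfolding AeA_def by (rule generate.incl) blast
  then show ?thesis using assms by simp
qed

locale LU_homotopy = twisted_homotopy A S L U fac K
  for A (structure) and S L U fac and K :: "('b \<Rightarrow>\<^sub>0 int) set" +
  fixes e
  assumes e_in_S: "e \<in> S" and e_idem: "e \<otimes> e = e"
    and lower: "lower_triangular A e L" and upper: "upper_triangular A e U"
begin

lemma e_carrier: "e \<in> carrier A"
  using e_in_S S_carrier by blast

lemma lower_L: "l \<in> L \<Longrightarrow> e \<otimes> l = e \<otimes> l \<otimes> e"
proof -
  assume l: "l \<in> L"
  then have "e \<otimes> l \<otimes> (\<one> \<ominus> e) = \<zero>" using lower by (simp add: lower_triangular_def)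
  moreover have "e \<otimes> l \<otimes> (\<one> \<ominus> e) = e \<otimes> l \<ominus> e \<otimes> l \<otimes> e"
    using L_carrier[OF l] e_carrier by (simp add: a_minus_def r_distr r_minus)
  ultimately show ?thesis using L_carrier[OF l] e_carrier by (simp add: r_right_minus_eq)
qed

lemma upper_U: "u \<in> U \<Longrightarrow> u \<otimes> e = e \<otimes> u \<otimes> e"
proof -
  assume u: "u \<in> U"
  then have "(\<one> \<ominus> e) \<otimes> u \<otimes> e = \<zero>" using upper by (simp add: upper_triangular_def)
  moreover have "(\<one> \<ominus> e) \<otimes> u \<otimes> e = u \<otimes> e \<ominus> e \<otimes> u \<otimes> e"
    using U_carrier[OF u] e_carrier by (simp add: a_minus_def l_distr l_minus)
  ultimately show ?thesis using U_carrier[OF u] e_carrier by (simp add: r_right_minus_eq)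
qed

text \<open>
  This is the equality of \<open>AeA\<close> with the span of the products \<open>l e u\<close>, phrased for additive functions.
  Reducing both factors of a generator to products gives \<open>l u e l' u'\<close>.  Here \<open>u e = e u e\<close>, so
  the element is \<open>l e x u'\<close> with \<open>x = u e l'\<close>; for \<open>x = m v\<close> it equals \<open>(l e m) e (v u')\<close>
  because \<open>e m = e m e\<close>.
\<close>

lemma additive_mem_on_ideal:
  assumes add: "\<And>a b. a \<in> carrier A \<Longrightarrow> b \<in> carrier A \<Longrightarrow> \<psi> (a \<oplus> b) - \<psi> a - \<psi> b \<in> K"
    and prod: "\<And>l u. l \<in> L \<Longrightarrow> u \<in> U \<Longrightarrow> \<psi> (l \<otimes> e \<otimes> u) \<in> K"
    and x: "x \<in> AeA A e"
  shows "\<psi> x \<in> K"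
proof -
  note e = e_carrier
  have step: "\<psi> (l \<otimes> u \<otimes> e \<otimes> (l' \<otimes> u')) \<in> K" if lu: "l \<in> L" "u \<in> U" "l' \<in> L" "u' \<in> U" for l u l' u'
  proof -
    have c: "l \<in> carrier A" "u \<in> carrier A" "l' \<in> carrier A" "u' \<in> carrier A"
      using lu L_carrier U_carrier by auto
    have "\<psi> (l \<otimes> e \<otimes> x \<otimes> u') \<in> K" if x: "x \<in> carrier A" for x
    proof (rule additive_mem_if_products_mem[OF _ _ x])
      fix a b assume "a \<in> carrier A" "b \<in> carrier A"
      then show "\<psi> (l \<otimes> e \<otimes> (a \<oplus> b) \<otimes> u') - \<psi> (l \<otimes> e \<otimes> a \<otimes> u') - \<psi> (l \<otimes> e \<otimes> b \<otimes> u') \<in> K"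
        using add[of "l \<otimes> e \<otimes> a \<otimes> u'" "l \<otimes> e \<otimes> b \<otimes> u'"] c e by (simp add: r_distr l_distr)
    next
      fix m v assume mv: "m \<in> L" "v \<in> U"
      then have mv': "m \<in> carrier A" "v \<in> carrier A" using L_carrier U_carrier by auto
      have "l \<otimes> e \<otimes> (m \<otimes> v) \<otimes> u' = l \<otimes> (e \<otimes> m) \<otimes> (v \<otimes> u')"
        using c e mv' by (simp add: m_assoc)
      also have "\<dots> = (l \<otimes> e \<otimes> m) \<otimes> e \<otimes> (v \<otimes> u')"
        using c e mv' by (subst lower_L[OF mv(1)]) (simp add: m_assoc)
      finally show "\<psi> (l \<otimes> e \<otimes> (m \<otimes> v) \<otimes> u') \<in> K"
        using prod[of "l \<otimes> e \<otimes> m" "v \<otimes> u'"] lu mv e_in_S S_le_L by auto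
    qed
    from this[of "u \<otimes> e \<otimes> l'"] have "\<psi> (l \<otimes> (e \<otimes> u \<otimes> e) \<otimes> l' \<otimes> u') \<in> K"
      using c e by (simp add: m_assoc)
    then show ?thesis
      unfolding upper_U[OF lu(2), symmetric] using c e by (simp add: m_assoc)
  qed
  have gen: "\<psi> (a \<otimes> e \<otimes> b) \<in> K" if a: "a \<in> carrier A" and b: "b \<in> carrier A" for a b
  proof (rule additive_mem_if_products_mem[OF _ _ a])
    fix a a' assume "a \<in> carrier A" "a' \<in> carrier A"
    then show "\<psi> ((a \<oplus> a') \<otimes> e \<otimes> b) - \<psi> (a \<otimes> e \<otimes> b) - \<psi> (a' \<otimes> e \<otimes> b) \<in> K"
      using add[of "a \<otimes> e \<otimes> b" "a' \<otimes> e \<otimes> b"] b e by (simp add: l_distr)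
  next
    fix l u assume lu: "l \<in> L" "u \<in> U"
    then have c: "l \<otimes> u \<otimes> e \<in> carrier A" using L_carrier U_carrier e by auto
    show "\<psi> (l \<otimes> u \<otimes> e \<otimes> b) \<in> K"
    proof (rule additive_mem_if_products_mem[OF _ _ b])
      fix b b' assume "b \<in> carrier A" "b' \<in> carrier A"
      then show "\<psi> (l \<otimes> u \<otimes> e \<otimes> (b \<oplus> b')) - \<psi> (l \<otimes> u \<otimes> e \<otimes> b) - \<psi> (l \<otimes> u \<otimes> e \<otimes> b') \<in> K"
        using add[of "l \<otimes> u \<otimes> e \<otimes> b" "l \<otimes> u \<otimes> e \<otimes> b'"] c by (simp add: r_distr)
    qed (use step lu in blast)
  qed
  let ?G = "{a \<otimes> e \<otimes> b | a b. a \<in> carrier A \<and> b \<in> carrier A}"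
  have "- (\<psi> (\<zero> \<oplus> \<zero>) - \<psi> \<zero> - \<psi> \<zero>) \<in> K" by (intro uminus_mem add) auto
  then have z: "\<psi> \<zero> \<in> K" by simp
  have "x \<in> carrier A \<and> \<psi> x \<in> K" if "x \<in> generate (add_monoid A) ?G" for x
    using that
  proof (induction x rule: generate.induct)
    case one
    show ?case using z by simp
  next
    case (incl h)
    then show ?case using gen e by auto
  next
    case (inv h)
    then have h: "h \<in> carrier A" "\<psi> h \<in> K" using gen e by auto
    have "\<psi> (h \<oplus> \<ominus> h) - \<psi> h - \<psi> (\<ominus> h) \<in> K" by (rule add) (use h in auto)
    then have "\<psi> \<zero> - \<psi> h - \<psi> (\<ominus> h) \<in> K" using h by (simp add: r_neg)
    from diff_mem[OF diff_mem[OF z h(2)] this] have "\<psi> (\<ominus> h) \<in> K" by simp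
    then show ?case using h by (simp add: a_inv_def[symmetric])
  next
    case (eng x y)
    then have "\<psi> (x \<oplus> y) - \<psi> x - \<psi> y \<in> K" using add by blast
    from add_mem[OF add_mem[OF this, of "\<psi> x"], of "\<psi> y"] eng show ?case by simp
  qed
  with x show ?thesis unfolding AeA_def by blast
qed

text \<open>
  If the first entry is \<open>(l e) u\<close>, then every term of the homotopy starts with \<open>l e\<close>, which lies in the
  ideal.
\<close>

lemma htpy_first_in_ideal:
  assumes f: "tensorial (Suc (Suc m)) f"
    and van: "\<And>x ys. x \<in> AeA A e \<Longrightarrow> ys \<in> tpower_gens A (Suc m) \<Longrightarrow> f (x # ys) \<in> K"
    and x: "x \<in> AeA A e" and as: "as \<in> tpower_gens A m"
  shows "htpy A fac f (x # as) \<in> K"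
proof (rule additive_mem_on_ideal[OF _ _ x])
  fix l u assume lu: "l \<in> L" "u \<in> U"
  then have c: "l \<in> carrier A" "u \<in> carrier A" using L_carrier U_carrier by auto
  have le: "l \<otimes> e \<in> L" "l \<otimes> e \<in> AeA A e"
    using lu e_in_S S_le_L ideal.I_l_closed[OF ideal_AeA self_in_AeA c(1)] e_carrier by auto
  have "htpy A fac (\<lambda>bs. f ((l \<otimes> e) # bs)) (lmul A u as) \<in> K"
    by (rule htpy_mem[OF van[OF le(2)] lmul_in_gens[OF c(2) as]])
  moreover have "f ((l \<otimes> e) # u # as) \<in> K" by (rule van[OF le(2)]) (use c as in auto)
  ultimately have "f ((l \<otimes> e) # u # as) - htpy A fac (\<lambda>bs. f ((l \<otimes> e) # bs)) (lmul A u as) \<in> K"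
    using diff_mem by blast
  from add_mem[OF htpy_mult[OF f as le(1) lu(2)] this]
  show "htpy A fac f ((l \<otimes> e \<otimes> u) # as) \<in> K" by (simp only: diff_add_cancel)
qed (rule htpy_add[OF f as])

text \<open>
  The homotopy multiplies the last entry only by elements from the left, which keeps it in the ideal,
  except in the innermost call \<open>h (x) = \<Sum> l \<otimes> u\<close>.  There the last entry \<open>x\<close> may be taken to be
  \<open>l (e u)\<close>, and \<open>e u\<close> lies in the ideal.
\<close>

lemma htpy_last_in_ideal:
  assumes "tensorial (Suc (Suc m)) f"
    and "\<And>ys. ys \<in> tpower_gens A (Suc (Suc m)) \<Longrightarrow> last ys \<in> AeA A e \<Longrightarrow> f ys \<in> K"
    and "xs \<in> tpower_gens A (Suc m)" "last xs \<in> AeA A e"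
  shows "htpy A fac f xs \<in> K"
  using assms
proof (induction m arbitrary: f xs)
  case 0
  obtain x where xs: "xs = [x]" "x \<in> AeA A e"
    using 0(3,4) by (auto simp: tpower_gens_0 elim!: tpower_gens_SucE)
  have "htpy A fac f [x] \<in> K"
  proof (rule additive_mem_on_ideal[OF _ _ xs(2)])
    show "htpy A fac f [a \<oplus> b] - htpy A fac f [a] - htpy A fac f [b] \<in> K"
      if "a \<in> carrier A" "b \<in> carrier A" for a b
      by (rule htpy_add[OF 0(1)]) (use that in auto)
    fix l u assume lu: "l \<in> L" "u \<in> U"
    then have c: "l \<in> carrier A" "u \<in> carrier A" using L_carrier U_carrier by auto
    have eu: "e \<otimes> u \<in> U" "e \<otimes> u \<in> AeA A e"
      using lu e_in_S S_le_U ideal.I_r_closed[OF ideal_AeA self_in_AeA c(2)] e_carrier by auto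
    have "htpy A fac f [l \<otimes> (e \<otimes> u)] - f [l, e \<otimes> u] \<in> K"
      using htpy_mult[OF 0(1) _ lu(1) eu(1), of "[]"] by simp
    moreover have "f [l, e \<otimes> u] \<in> K" by (rule 0(2)) (use c e_carrier eu in auto)
    ultimately have "htpy A fac f [l \<otimes> (e \<otimes> u)] - f [l, e \<otimes> u] + f [l, e \<otimes> u] \<in> K" by (rule add_mem)
    then show "htpy A fac f [l \<otimes> e \<otimes> u] \<in> K"
      using c e_carrier by (simp add: m_assoc del: htpy.simps)
  qed
  then show ?case unfolding xs(1) .
next
  case (Suc m)
  interpret I: ideal "AeA A e" A by (rule ideal_AeA[OF e_carrier])
  obtain a b as where xs: "xs = a # b # as" "a \<in> carrier A" "b \<in> carrier A" "as \<in> tpower_gens A m"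
    using Suc.prems(3) by (auto elim!: tpower_gens_SucE)
  have bas: "b # as \<in> tpower_gens A (Suc m)" using xs by simp
  show ?case
    unfolding xs(1) htpy.simps
  proof (rule frag_extend_mem[OF keys_fac[OF xs(2)]], clarify)
    fix l u assume lu: "l \<in> L" "u \<in> U"
    then have c: "l \<in> carrier A" "u \<in> carrier A" using L_carrier U_carrier by auto
    have "last (lmul A u (b # as)) \<in> AeA A e"
      using Suc.prems(4) xs(1) I.I_l_closed[OF _ c(2), of b] by auto
    then have "htpy A fac (\<lambda>bs. f (l # bs)) (lmul A u (b # as)) \<in> K"
      using Suc.prems(2) c by (intro Suc.IH tensorial_cons[OF Suc.prems(1) c(1)] lmul_in_gens[OF c(2) bas])
        (auto elim!: tpower_gens_SucE)
    moreover have "f (l # u # b # as) \<in> K"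
      by (rule Suc.prems(2)) (use xs c Suc.prems(4) in auto)
    ultimately show "f (l # u # b # as) - htpy A fac (\<lambda>bs. f (l # bs)) (lmul A u (b # as)) \<in> K"
      using diff_mem by blast
  qed
qed

text \<open>
  If \<open>f \<circ> d = 0\<close>, the homotopy identity reads \<open>f = (f \<circ> h) \<circ> d\<close>.
\<close>

theorem cocycle_is_coboundary:
  assumes f: "tensorial (Suc (Suc m)) f"
    and van: "\<And>ys. ys \<in> tpower_gens A (Suc (Suc m)) \<Longrightarrow> hd ys \<in> AeA A e \<or> last ys \<in> AeA A e \<Longrightarrow> f ys \<in> K"
    and cocycle: "\<And>ys. ys \<in> tpower_gens A (Suc (Suc (Suc m))) \<Longrightarrow> codiff A f ys \<in> K"
  obtains g where "tensorial (Suc m) g"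
    "\<And>ys. ys \<in> tpower_gens A (Suc m) \<Longrightarrow> hd ys \<in> AeA A e \<or> last ys \<in> AeA A e \<Longrightarrow> g ys \<in> K"
    "\<And>ys. ys \<in> tpower_gens A (Suc (Suc m)) \<Longrightarrow> codiff A g ys - f ys \<in> K"
proof
  interpret I: ideal "AeA A e" A by (rule ideal_AeA[OF e_carrier])
  show "tensorial (Suc m) (htpy A fac f)" by (rule tensorial_htpy[OF f])
  show "htpy A fac f ys \<in> K" if ys_gens: "ys \<in> tpower_gens A (Suc m)" and ends: "hd ys \<in> AeA A e \<or> last ys \<in> AeA A e" for ys
    using ends
  proof
    assume hd: "hd ys \<in> AeA A e"
    obtain y zs where ys: "ys = y # zs" "y \<in> carrier A" "zs \<in> tpower_gens A m"
      using ys_gens by (rule tpower_gens_SucE)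
    show ?thesis
      unfolding ys(1)
    proof (rule htpy_first_in_ideal[OF f _ _ ys(3)])
      show "f (x # zs) \<in> K" if "x \<in> AeA A e" "zs \<in> tpower_gens A (Suc m)" for x zs
        by (rule van) (use that I.Icarr in auto)
    qed (use hd ys(1) in simp)
  next
    assume "last ys \<in> AeA A e"
    then show ?thesis using htpy_last_in_ideal[OF f _ ys_gens] van by blast
  qed
  show "codiff A (htpy A fac f) ys - f ys \<in> K" if "ys \<in> tpower_gens A (Suc (Suc m))" for ys
  proof -
    have "htpy A fac (codiff A f) ys \<in> K"
      by (rule htpy_mem[OF _ that]) (rule cocycle)
    from diff_mem[OF htpy_codiff[OF f that] this] show ?thesis by (simp add: algebra_simps)
  qed
qed

end

section \<open>Tensoring with a cyclic module\<close>

locale left_module = ring A + X: comm_group X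
  for A :: "('a, 'm) ring_scheme" (structure) and X :: "('x, 'y) monoid_scheme" and lX :: "'a \<Rightarrow> 'x \<Rightarrow> 'x" +
  assumes lact_hom: "a \<in> carrier A \<Longrightarrow> lX a \<in> hom X X"
    and lact_add: "a \<in> carrier A \<Longrightarrow> b \<in> carrier A \<Longrightarrow> x \<in> carrier X \<Longrightarrow> lX (a \<oplus> b) x = lX a x \<otimes>\<^bsub>X\<^esub> lX b x"
    and lact_mult: "a \<in> carrier A \<Longrightarrow> b \<in> carrier A \<Longrightarrow> x \<in> carrier X \<Longrightarrow> lX (a \<otimes> b) x = lX a (lX b x)"
    and lact_one: "x \<in> carrier X \<Longrightarrow> lX \<one> x = x"

locale right_module = ring A + X: comm_group X
  for A :: "('a, 'm) ring_scheme" (structure) and X :: "('x, 'y) monoid_scheme" and rX :: "'x \<Rightarrow> 'a \<Rightarrow> 'x" +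
  assumes ract_hom: "a \<in> carrier A \<Longrightarrow> (\<lambda>x. rX x a) \<in> hom X X"
    and ract_add: "a \<in> carrier A \<Longrightarrow> b \<in> carrier A \<Longrightarrow> x \<in> carrier X \<Longrightarrow> rX x (a \<oplus> b) = rX x a \<otimes>\<^bsub>X\<^esub> rX x b"
    and ract_mult: "a \<in> carrier A \<Longrightarrow> b \<in> carrier A \<Longrightarrow> x \<in> carrier X \<Longrightarrow> rX x (a \<otimes> b) = rX (rX x a) b"
    and ract_one: "x \<in> carrier X \<Longrightarrow> rX x \<one> = x"

lemma (in left_module) lact_closed: "a \<in> carrier A \<Longrightarrow> x \<in> carrier X \<Longrightarrow> lX a x \<in> carrier X"
  using lact_hom by (rule hom_in_carrier)

lemma (in right_module) ract_closed: "a \<in> carrier A \<Longrightarrow> x \<in> carrier X \<Longrightarrow> rX x a \<in> carrier X"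
  using ract_hom[of a] by (rule hom_in_carrier)

text \<open>
  \<open>N\<close> is \<open>A/I\<close> as a right and as a left module, with projection \<open>q\<close>.  Keeping \<open>N\<close> abstract
  separates the tensor product arguments from the arithmetic of cosets.
\<close>

locale cyclic_quotient = ideal I A + N: comm_group N
  for I and A :: "('a, 'm) ring_scheme" (structure) and N :: "('n, 'y) monoid_scheme" and q :: "'a \<Rightarrow> 'n"
    and rN :: "'n \<Rightarrow> 'a \<Rightarrow> 'n" and lN :: "'a \<Rightarrow> 'n \<Rightarrow> 'n" +
  assumes q_surj: "carrier N = q ` carrier A"
    and q_add: "a \<in> carrier A \<Longrightarrow> b \<in> carrier A \<Longrightarrow> q (a \<oplus> b) = q a \<otimes>\<^bsub>N\<^esub> q b"
    and q_eq_iff: "a \<in> carrier A \<Longrightarrow> b \<in> carrier A \<Longrightarrow> q a = q b \<longleftrightarrow> a \<ominus> b \<in> I"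
    and rN_q: "a \<in> carrier A \<Longrightarrow> b \<in> carrier A \<Longrightarrow> rN (q a) b = q (a \<otimes> b)"
    and lN_q: "a \<in> carrier A \<Longrightarrow> b \<in> carrier A \<Longrightarrow> lN a (q b) = q (a \<otimes> b)"
begin

lemma q_closed: "a \<in> carrier A \<Longrightarrow> q a \<in> carrier N"
  by (simp add: q_surj)

lemma q_zero: "q \<zero> = \<one>\<^bsub>N\<^esub>"
proof -
  have "q \<zero> \<otimes>\<^bsub>N\<^esub> q \<zero> = q \<zero>" using q_add[of \<zero> \<zero>] by simp
  then show ?thesis using q_closed[of \<zero>] by simp
qed

lemma q_ideal: "i \<in> I \<Longrightarrow> q i = \<one>\<^bsub>N\<^esub>"
  using q_eq_iff[of i \<zero>] Icarr by (simp add: q_zero a_minus_def)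

definition rep :: "'n \<Rightarrow> 'a" where "rep n = (SOME a. a \<in> carrier A \<and> q a = n)"

lemma rep: "n \<in> carrier N \<Longrightarrow> rep n \<in> carrier A \<and> q (rep n) = n"
  unfolding rep_def by (rule someI_ex) (auto simp: q_surj)

lemma tensor_data_left:
  assumes "left_module A X lX"
  shows "tensor_data (carrier A) N rN X lX"
proof -
  interpret X: left_module A X lX by fact
  show ?thesis
    by unfold_locales (auto simp: q_surj rN_q X.lact_closed)
qed

lemma tensor_data_right:
  assumes "right_module A X rX"
  shows "tensor_data (carrier A) X rX N lN"
proof -
  interpret X: right_module A X rX by fact
  show ?thesis
    by unfold_locales (auto simp: q_surj lN_q X.ract_closed)
qed

lemma pure_left_q:
  assumes "left_module A X lX" "a \<in> carrier A" "x \<in> carrier X"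
  shows "pure_tensor (carrier A) N rN X lX (q a) x = pure_tensor (carrier A) N rN X lX (q \<one>) (lX a x)"
proof -
  interpret T: tensor_data "carrier A" N rN X lX by (rule tensor_data_left) fact
  show ?thesis using T.pure_balanced[of "q \<one>" a x] assms by (simp add: q_closed rN_q)
qed

lemma pure_right_q:
  assumes "right_module A X rX" "a \<in> carrier A" "x \<in> carrier X"
  shows "pure_tensor (carrier A) X rX N lN x (q a) = pure_tensor (carrier A) X rX N lN (rX x a) (q \<one>)"
proof -
  interpret T: tensor_data "carrier A" X rX N lN by (rule tensor_data_right) fact
  show ?thesis using T.pure_balanced[of x a "q \<one>"] assms by (simp add: q_closed lN_q)
qed

text \<open>
  As \<open>N\<close> is generated by \<open>q 1\<close>, every pure tensor is of this form, and the tensors of this form are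
  the image of a homomorphism.
\<close>

lemma tensor_left_cases:
  assumes "left_module A X lX" "t \<in> carrier (tensor (carrier A) N rN X lX)"
  obtains x where "x \<in> carrier X" "t = pure_tensor (carrier A) N rN X lX (q \<one>) x"
proof -
  interpret X: left_module A X lX by fact
  interpret T: tensor_data "carrier A" N rN X lX by (rule tensor_data_left) fact
  interpret p: group_hom X T.T "\<lambda>x. T.pure (q \<one>) x"
    using T.pure_hom_right[OF q_closed[OF one_closed]]
    by (simp add: group_hom_def group_hom_axioms_def X.X.is_group T.T.is_group)
  have "\<exists>x\<in>carrier X. t = T.pure (q \<one>) x"
    using assms(2)
  proof (induction t rule: T.tensor_induct)
    case one
    show ?case using p.hom_one X.X.one_closed by metis
  next
    case (pure n x)
    then obtain a where "a \<in> carrier A" "n = q a" using q_surj by auto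
    then show ?case using pure_left_q[OF assms(1), of a x] X.lact_closed[of a x] pure by auto
  next
    case (mult_inv s t)
    then obtain x y where "x \<in> carrier X" "s = T.pure (q \<one>) x" "y \<in> carrier X" "t = T.pure (q \<one>) y"
      by blast
    then show ?case by (intro bexI[of _ "x \<otimes>\<^bsub>X\<^esub> inv\<^bsub>X\<^esub> y"]) simp_all
  qed
  then show thesis using that by blast
qed

lemma tensor_right_cases:
  assumes "right_module A X rX" "t \<in> carrier (tensor (carrier A) X rX N lN)"
  obtains x where "x \<in> carrier X" "t = pure_tensor (carrier A) X rX N lN x (q \<one>)"
proof -
  interpret X: right_module A X rX by fact
  interpret T: tensor_data "carrier A" X rX N lN by (rule tensor_data_right) fact
  interpret p: group_hom X T.T "\<lambda>x. T.pure x (q \<one>)"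
    using T.pure_hom_left[OF q_closed[OF one_closed]]
    by (simp add: group_hom_def group_hom_axioms_def X.X.is_group T.T.is_group)
  have "\<exists>x\<in>carrier X. t = T.pure x (q \<one>)"
    using assms(2)
  proof (induction t rule: T.tensor_induct)
    case one
    show ?case using p.hom_one X.X.one_closed by metis
  next
    case (pure x n)
    then obtain a where "a \<in> carrier A" "n = q a" using q_surj by auto
    then show ?case using pure_right_q[OF assms(1), of a x] X.ract_closed[of a x] pure by auto
  next
    case (mult_inv s t)
    then obtain x y where "x \<in> carrier X" "s = T.pure x (q \<one>)" "y \<in> carrier X" "t = T.pure y (q \<one>)"
      by blast
    then show ?case by (intro bexI[of _ "x \<otimes>\<^bsub>X\<^esub> inv\<^bsub>X\<^esub> y"]) simp_all
  qed
  then show thesis using that by blast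
qed

text \<open>
  \<open>(A/I) \<otimes>\<^sub>A X\<close> is \<open>X/IX\<close>: a homomorphism on \<open>X\<close> that kills \<open>I X\<close> factors through
  \<open>x \<mapsto> q 1 \<otimes> x\<close>.  The factorization sends \<open>n \<otimes> x\<close> to \<open>\<gamma> (a x)\<close> for any representative \<open>a\<close> of \<open>n\<close>.
\<close>

lemma tensor_left_hom:
  assumes X: "left_module A X lX" and G: "comm_group G" and \<gamma>: "\<gamma> \<in> hom X G"
    and van: "\<And>i x. i \<in> I \<Longrightarrow> x \<in> carrier X \<Longrightarrow> \<gamma> (lX i x) = \<one>\<^bsub>G\<^esub>"
  obtains h where "h \<in> hom (tensor (carrier A) N rN X lX) G"
    "\<And>x. x \<in> carrier X \<Longrightarrow> h (pure_tensor (carrier A) N rN X lX (q \<one>) x) = \<gamma> x"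
proof -
  interpret X: left_module A X lX by fact
  interpret G: comm_group G by fact
  interpret T: tensor_data "carrier A" N rN X lX by (rule tensor_data_left) fact
  have \<gamma>c: "x \<in> carrier X \<Longrightarrow> \<gamma> x \<in> carrier G" for x using \<gamma> by (rule hom_in_carrier)
  have indep: "\<gamma> (lX a x) = \<gamma> (lX b x)"
    if "a \<in> carrier A" "b \<in> carrier A" "q a = q b" "x \<in> carrier X" for a b x
  proof -
    have i: "a \<ominus> b \<in> I" using q_eq_iff that by blast
    have "a = (a \<ominus> b) \<oplus> b" using that by algebra
    then have "lX a x = lX (a \<ominus> b) x \<otimes>\<^bsub>X\<^esub> lX b x"
      using X.lact_add[of "a \<ominus> b" b x] that by simp
    then show ?thesis
      using hom_mult[OF \<gamma>] van[OF i] that X.lact_closed \<gamma>c by simp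
  qed
  obtain h where h: "h \<in> hom T.T G"
    "\<And>n x. n \<in> carrier N \<Longrightarrow> x \<in> carrier X \<Longrightarrow> h (T.pure n x) = \<gamma> (lX (rep n) x)"
  proof (rule T.tensor_universal[OF G, of "\<lambda>n x. \<gamma> (lX (rep n) x)"], goal_cases)
    case (1 n x)
    then show ?case using rep X.lact_closed \<gamma>c by blast
  next
    case (2 n n' x)
    have "\<gamma> (lX (rep (n \<otimes>\<^bsub>N\<^esub> n')) x) = \<gamma> (lX (rep n \<oplus> rep n') x)"
      by (rule indep) (use 2 rep q_add in simp_all)
    then show ?case using 2 rep X.lact_add hom_mult[OF \<gamma>] X.lact_closed by simp
  next
    case (3 n x y)
    then show ?case using rep hom_mult[OF X.lact_hom] hom_mult[OF \<gamma>] X.lact_closed by simp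
  next
    case (4 n a x)
    have "rN n a = q (rep n \<otimes> a)" using rN_q[of "rep n" a] rep[OF 4(2)] 4(3) by simp
    moreover have "rN n a \<in> carrier N" using T.ract_closed 4 by blast
    ultimately have "\<gamma> (lX (rep (rN n a)) x) = \<gamma> (lX (rep n \<otimes> a) x)"
      by (intro indep) (use 4 rep in simp_all)
    then show ?case using 4 rep X.lact_mult by simp
  qed blast
  have "h (T.pure (q \<one>) x) = \<gamma> x" if "x \<in> carrier X" for x
    using h(2)[of "q \<one>" x] indep[of "rep (q \<one>)" \<one> x] rep[of "q \<one>"] that q_closed[of \<one>] X.lact_one by simp
  then show thesis using that h(1) by blast
qed

lemma tensor_right_hom:
  assumes X: "right_module A X rX" and G: "comm_group G" and \<gamma>: "\<gamma> \<in> hom X G"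
    and van: "\<And>i x. i \<in> I \<Longrightarrow> x \<in> carrier X \<Longrightarrow> \<gamma> (rX x i) = \<one>\<^bsub>G\<^esub>"
  obtains h where "h \<in> hom (tensor (carrier A) X rX N lN) G"
    "\<And>x. x \<in> carrier X \<Longrightarrow> h (pure_tensor (carrier A) X rX N lN x (q \<one>)) = \<gamma> x"
proof -
  interpret X: right_module A X rX by fact
  interpret G: comm_group G by fact
  interpret T: tensor_data "carrier A" X rX N lN by (rule tensor_data_right) fact
  have \<gamma>c: "x \<in> carrier X \<Longrightarrow> \<gamma> x \<in> carrier G" for x using \<gamma> by (rule hom_in_carrier)
  have indep: "\<gamma> (rX x a) = \<gamma> (rX x b)"
    if "a \<in> carrier A" "b \<in> carrier A" "q a = q b" "x \<in> carrier X" for a b x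
  proof -
    have i: "a \<ominus> b \<in> I" using q_eq_iff that by blast
    have "a = (a \<ominus> b) \<oplus> b" using that by algebra
    then have "rX x a = rX x (a \<ominus> b) \<otimes>\<^bsub>X\<^esub> rX x b"
      using X.ract_add[of "a \<ominus> b" b x] that by simp
    then show ?thesis
      using hom_mult[OF \<gamma>] van[OF i] that X.ract_closed \<gamma>c by simp
  qed
  obtain h where h: "h \<in> hom T.T G"
    "\<And>x n. x \<in> carrier X \<Longrightarrow> n \<in> carrier N \<Longrightarrow> h (T.pure x n) = \<gamma> (rX x (rep n))"
  proof (rule T.tensor_universal[OF G, of "\<lambda>x n. \<gamma> (rX x (rep n))"], goal_cases)
    case (1 x n)
    then show ?case using rep X.ract_closed \<gamma>c by blast
  next
    case (2 x y n)
    then show ?case using rep hom_mult[OF X.ract_hom] hom_mult[OF \<gamma>] X.ract_closed by simp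
  next
    case (3 x n n')
    have "\<gamma> (rX x (rep (n \<otimes>\<^bsub>N\<^esub> n'))) = \<gamma> (rX x (rep n \<oplus> rep n'))"
      by (rule indep) (use 3 rep q_add in simp_all)
    then show ?case using 3 rep X.ract_add hom_mult[OF \<gamma>] X.ract_closed by simp
  next
    case (4 x a n)
    have "lN a n = q (a \<otimes> rep n)" using lN_q[of a "rep n"] rep[OF 4(4)] 4(3) by simp
    moreover have "lN a n \<in> carrier N" using T.lact_closed 4 by blast
    ultimately have "\<gamma> (rX x (rep (lN a n))) = \<gamma> (rX x (a \<otimes> rep n))"
      by (intro indep) (use 4 rep in simp_all)
    then show ?case using 4 rep X.ract_mult by simp
  qed blast
  have "h (T.pure x (q \<one>)) = \<gamma> x" if "x \<in> carrier X" for x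
    using h(2)[of x "q \<one>"] indep[of "rep (q \<one>)" \<one> x] rep[of "q \<one>"] that q_closed[of \<one>] X.ract_one by simp
  then show thesis using that h(1) by blast
qed

lemma pure_left_ideal:
  assumes "left_module A X lX" "i \<in> I" "x \<in> carrier X"
  shows "pure_tensor (carrier A) N rN X lX (q \<one>) (lX i x) = \<one>\<^bsub>tensor (carrier A) N rN X lX\<^esub>"
proof -
  interpret T: tensor_data "carrier A" N rN X lX by (rule tensor_data_left) fact
  show ?thesis
    using pure_left_q[OF assms(1) Icarr[OF assms(2)] assms(3)] q_ideal[OF assms(2)]
      hom_one[OF T.pure_hom_left[OF assms(3)] N.is_group T.T.is_group] by simp
qed

lemma pure_right_ideal:
  assumes "right_module A X rX" "i \<in> I" "x \<in> carrier X"
  shows "pure_tensor (carrier A) X rX N lN (rX x i) (q \<one>) = \<one>\<^bsub>tensor (carrier A) X rX N lN\<^esub>"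
proof -
  interpret T: tensor_data "carrier A" X rX N lN by (rule tensor_data_right) fact
  show ?thesis
    using pure_right_q[OF assms(1) Icarr[OF assms(2)] assms(3)] q_ideal[OF assms(2)]
      hom_one[OF T.pure_hom_right[OF assms(3)] N.is_group T.T.is_group] by simp
qed

end

lemma (in ideal) cyclic_quotient_Quot:
  "cyclic_quotient I R (add_monoid (R Quot I)) ((+>) I) (quot_ract R I) (quot_lact R I)"
proof -
  interpret Q: ring "R Quot I" by (rule quotient_is_ring)
  interpret N: comm_group "add_monoid (R Quot I)" by (rule Q.a_comm_group)
  show ?thesis
  proof (unfold_locales, goal_cases)
    case 1
    show ?case by (auto simp: FactRing_def A_RCOSETS_def' a_r_coset_def r_coset_def)
  next
    case (2 a b)
    then show ?case by (simp add: FactRing_def a_rcos_sum)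
  next
    case (3 a b)
    show ?case
      using quotient_eq_iff_same_a_r_cos[OF ideal_axioms 3] by simp
  next
    case (4 a b)
    then show ?case by (simp add: quot_ract_def FactRing_def rcoset_mult_add)
  next
    case (5 a b)
    then show ?case by (simp add: quot_lact_def FactRing_def rcoset_mult_add)
  qed
qed

section \<open>The bar complex\<close>

lemma rmul_eq: "xs \<noteq> [] \<Longrightarrow> rmul A xs a = butlast xs @ [last xs \<otimes>\<^bsub>A\<^esub> a]"
  by (induction A xs a rule: rmul.induct) auto

lemma lmul_eq: "xs \<noteq> [] \<Longrightarrow> lmul A a xs = (a \<otimes>\<^bsub>A\<^esub> hd xs) # tl xs"
  by (cases xs) auto

lemma sum_faces_eq_codiff:
  "length xs = Suc (Suc k) \<Longrightarrow> (\<Sum>j\<le>k. frag_cmul ((-1) ^ j) (f (face A j xs))) = codiff A f xs"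
proof (induction k arbitrary: xs f)
  case 0
  then obtain x y where "xs = [x, y]" by (auto simp: length_Suc_conv)
  then show ?case by (simp add: face_def)
next
  case (Suc k)
  then obtain x y ys where xs: "xs = x # y # ys" "length ys = Suc k" by (auto simp: length_Suc_conv)
  have "(\<Sum>j\<le>Suc k. frag_cmul ((-1) ^ j) (f (face A j xs)))
      = f (face A 0 xs) + (\<Sum>j\<le>k. frag_cmul ((-1) ^ Suc j) (f (face A (Suc j) xs)))"
    by (subst sum.atMost_Suc_shift) simp
  also have "(\<Sum>j\<le>k. frag_cmul ((-1) ^ Suc j) (f (face A (Suc j) xs)))
      = - (\<Sum>j\<le>k. frag_cmul ((-1) ^ j) (f (x # face A j (y # ys))))"
    by (simp add: face_def xs(1) sum_negf[symmetric])
  also have "(\<Sum>j\<le>k. frag_cmul ((-1) ^ j) (f (x # face A j (y # ys)))) = codiff A (\<lambda>zs. f (x # zs)) (y # ys)"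
    by (rule Suc.IH) (simp add: xs(2))
  finally show ?case by (simp add: xs(1) face_def)
qed

context relative_pair
begin

abbreviation "gens n \<equiv> tpower_gens A n"
abbreviation "rels n \<equiv> tpower_rels A S n"
abbreviation "tcls n \<equiv> rel_class (gens n) (rels n)"

lemma presentation_tpower: "presentation (gens n) (rels n)"
proof
  have S: "s \<in> S \<Longrightarrow> s \<in> carrier A" for s using subset by blast
  show "rels n \<subseteq> carrier (free_Abelian_group (gens n))"
  proof
    fix r assume "r \<in> rels n"
    then show "r \<in> carrier (free_Abelian_group (gens n))"
      unfolding tpower_rels_def
      by (elim UnE CollectE exE conjE) (simp_all add: keys_diff_subset tpower_gens_def S)
  qed
qed

sublocale tp: presentation "gens n" "rels n" for n
  by (rule presentation_tpower)

sublocale tf: tensorial_functions A S "rel_subgroup (gens n) (rels n)" for n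
  ..

lemma tensorial_frag_of: "tf.tensorial n n frag_of"
  unfolding tf.tensorial_def frag_expansion[symmetric] using tp.rels_mem by blast

lemma tpower_map:
  assumes "\<And>xs. xs \<in> gens n \<Longrightarrow> Poly_Mapping.keys (f xs) \<subseteq> gens m" "tf.tensorial m n f"
  shows "induced_map (gens m) (rels m) f \<in> hom (presented_group (gens n) (rels n)) (presented_group (gens m) (rels m))"
    and "\<And>z. Poly_Mapping.keys z \<subseteq> gens n \<Longrightarrow> induced_map (gens m) (rels m) f (tcls n z) = tcls m (frag_extend f z)"
proof -
  have r: "frag_extend f r \<in> rel_subgroup (gens m) (rels m)" if "r \<in> rels n" for r
    using assms(2) that unfolding tf.tensorial_def by blast
  show "induced_map (gens m) (rels m) f \<in> hom (presented_group (gens n) (rels n)) (presented_group (gens m) (rels m))"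
    by (rule induced_map_hom[OF presentation_tpower presentation_tpower assms(1) r])
  show "\<And>z. Poly_Mapping.keys z \<subseteq> gens n \<Longrightarrow> induced_map (gens m) (rels m) f (tcls n z) = tcls m (frag_extend f z)"
    by (rule induced_map_rel_class[OF presentation_tpower presentation_tpower assms(1) r])
qed

lemma keys_codiff: "xs \<in> gens (Suc n) \<Longrightarrow> Poly_Mapping.keys (codiff A frag_of xs) \<subseteq> gens n"
proof -
  have "Poly_Mapping.keys (codiff A f xs) \<subseteq> X"
    if "xs \<in> gens (Suc n)" "\<And>ys. ys \<in> gens n \<Longrightarrow> Poly_Mapping.keys (f ys) \<subseteq> X"
    for X n xs and f :: "'a list \<Rightarrow> 'a list \<Rightarrow>\<^sub>0 int"
    using that
  proof (induction n arbitrary: xs f)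
    case 0
    then show ?case by (auto simp: tpower_gens_0 elim!: tpower_gens_SucE)
  next
    case (Suc n)
    obtain x ys where xs: "xs = x # ys" "x \<in> carrier A" "ys \<in> gens (Suc n)"
      using Suc.prems(1) by (rule tpower_gens_SucE)
    have "Poly_Mapping.keys (codiff A (\<lambda>ys. f (x # ys)) ys) \<subseteq> X"
      by (rule Suc.IH[OF xs(3)]) (use Suc.prems(2) xs in simp)
    moreover have "Poly_Mapping.keys (f (lmul A x ys)) \<subseteq> X"
      by (rule Suc.prems(2)[OF lmul_in_gens[OF xs(2,3)]])
    ultimately show ?case
      using xs(1) keys_diff[of "f (lmul A x ys)" "codiff A (\<lambda>ys. f (x # ys)) ys"] by auto
  qed
  from this[of xs n frag_of "gens n"] show "xs \<in> gens (Suc n) \<Longrightarrow> ?thesis" by simp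
qed

lemma gens_nonempty: "xs \<in> gens (k + 2) \<Longrightarrow> xs \<noteq> []"
  by auto

lemma bar_lact:
  assumes a: "a \<in> carrier A"
  shows "bar_lact A S k a \<in> hom (bar A S k) (bar A S k)"
    and "\<And>z. Poly_Mapping.keys z \<subseteq> gens (k + 2) \<Longrightarrow>
      bar_lact A S k a (tcls (k + 2) z) = tcls (k + 2) (frag_extend (\<lambda>xs. frag_of (lmul A a xs)) z)"
proof -
  let ?f = "\<lambda>xs. frag_of ((a \<otimes> hd xs) # tl xs)"
  have eq: "frag_of (lmul A a xs) = ?f xs" if "xs \<in> gens (k + 2)" for xs
    by (simp only: lmul_eq[OF gens_nonempty[OF that]])
  have k: "Poly_Mapping.keys (?f xs) \<subseteq> gens (k + 2)" if "xs \<in> gens (k + 2)" for xs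
    using lmul_in_gens[OF a that] eq[OF that] by (metis frag_of_in_free_Abelian_group carrier_free_Abelian_group_iff)
  have t: "tf.tensorial (k + 2) (k + 2) ?f"
    by (rule tf.tensorial_cong[OF eq tf.tensorial_lmul[OF a tensorial_frag_of]])
  show "bar_lact A S k a \<in> hom (bar A S k) (bar A S k)"
    unfolding bar_lact_def bar_def by (rule tpower_map(1)[OF k t])
  show "bar_lact A S k a (tcls (k + 2) z) = tcls (k + 2) (frag_extend (\<lambda>xs. frag_of (lmul A a xs)) z)"
    if "Poly_Mapping.keys z \<subseteq> gens (k + 2)" for z
  proof -
    have "induced_map (gens (k + 2)) (rels (k + 2)) ?f (tcls (k + 2) z) = tcls (k + 2) (frag_extend ?f z)"
      by (rule tpower_map(2)[OF k t that])
    moreover have "frag_extend (\<lambda>xs. frag_of (lmul A a xs)) z = frag_extend ?f z"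
      by (rule frag_extend_eq) (use eq that in blast)
    ultimately show ?thesis unfolding bar_lact_def by (simp only:)
  qed
qed

lemma bar_ract:
  assumes a: "a \<in> carrier A"
  shows "(\<lambda>x. bar_ract A S k x a) \<in> hom (bar A S k) (bar A S k)"
    and "\<And>z. Poly_Mapping.keys z \<subseteq> gens (k + 2) \<Longrightarrow>
      bar_ract A S k (tcls (k + 2) z) a = tcls (k + 2) (frag_extend (\<lambda>xs. frag_of (rmul A xs a)) z)"
proof -
  let ?f = "\<lambda>xs. frag_of (butlast xs @ [last xs \<otimes> a])"
  have eq: "frag_of (rmul A xs a) = ?f xs" if "xs \<in> gens (k + 2)" for xs
    by (simp only: rmul_eq[OF gens_nonempty[OF that]])
  have k: "Poly_Mapping.keys (?f xs) \<subseteq> gens (k + 2)" if "xs \<in> gens (k + 2)" for xs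
    using rmul_in_gens[OF a that] eq[OF that] by (metis frag_of_in_free_Abelian_group carrier_free_Abelian_group_iff)
  have t: "tf.tensorial (k + 2) (k + 2) ?f"
    by (rule tf.tensorial_cong[OF eq tf.tensorial_rmul[OF a tensorial_frag_of]])
  show "(\<lambda>x. bar_ract A S k x a) \<in> hom (bar A S k) (bar A S k)"
    unfolding bar_ract_def bar_def by (rule tpower_map(1)[OF k t])
  show "bar_ract A S k (tcls (k + 2) z) a = tcls (k + 2) (frag_extend (\<lambda>xs. frag_of (rmul A xs a)) z)"
    if "Poly_Mapping.keys z \<subseteq> gens (k + 2)" for z
  proof -
    have "induced_map (gens (k + 2)) (rels (k + 2)) ?f (tcls (k + 2) z) = tcls (k + 2) (frag_extend ?f z)"
      by (rule tpower_map(2)[OF k t that])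
    moreover have "frag_extend (\<lambda>xs. frag_of (rmul A xs a)) z = frag_extend ?f z"
      by (rule frag_extend_eq) (use eq that in blast)
    ultimately show ?thesis unfolding bar_ract_def by (simp only:)
  qed
qed

lemma bar_diff:
  shows "bar_diff A S (Suc k) \<in> hom (bar A S (Suc k)) (bar A S k)"
    and "\<And>z. Poly_Mapping.keys z \<subseteq> gens (Suc k + 2) \<Longrightarrow>
      bar_diff A S (Suc k) (tcls (Suc k + 2) z) = tcls (k + 2) (frag_extend (codiff A frag_of) z)"
proof -
  let ?f = "\<lambda>xs. \<Sum>j\<le>Suc k. frag_cmul ((-1) ^ j) (frag_of (face A j xs))"
  have eq: "codiff A frag_of xs = ?f xs" if "xs \<in> gens (Suc k + 2)" for xs
    by (rule sum_faces_eq_codiff[symmetric]) (use that in \<open>simp add: tpower_gens_def\<close>)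
  have k: "Poly_Mapping.keys (?f xs) \<subseteq> gens (k + 2)" if "xs \<in> gens (Suc k + 2)" for xs
    using keys_codiff[of xs "k + 2"] eq[OF that] that by simp
  have t: "tf.tensorial (k + 2) (Suc k + 2) ?f"
    by (rule tf.tensorial_cong[OF eq]) (use tf.tensorial_codiff[OF tensorial_frag_of[of "k + 2"]] in simp_all)
  have idx: "Suc k + 1 = k + 2" by simp
  show "bar_diff A S (Suc k) \<in> hom (bar A S (Suc k)) (bar A S k)"
    unfolding bar_diff_def bar_def idx by (rule tpower_map(1)[OF k t])
  show "bar_diff A S (Suc k) (tcls (Suc k + 2) z) = tcls (k + 2) (frag_extend (codiff A frag_of) z)"
    if "Poly_Mapping.keys z \<subseteq> gens (Suc k + 2)" for z
  proof -
    have "induced_map (gens (k + 2)) (rels (k + 2)) ?f (tcls (Suc k + 2) z) = tcls (k + 2) (frag_extend ?f z)"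
      by (rule tpower_map(2)[OF k t that])
    moreover have "frag_extend (codiff A frag_of) z = frag_extend ?f z"
      by (rule frag_extend_eq) (use eq that in blast)
    ultimately show ?thesis unfolding bar_diff_def idx by (simp only:)
  qed
qed

lemma bar_cases:
  assumes "x \<in> carrier (bar A S k)"
  obtains z where "Poly_Mapping.keys z \<subseteq> gens (k + 2)" "x = tcls (k + 2) z"
  using assms unfolding bar_def by (rule tp.rel_class_cases)

lemma tcls_closed: "Poly_Mapping.keys z \<subseteq> gens (k + 2) \<Longrightarrow> tcls (k + 2) z \<in> carrier (bar A S k)"
  unfolding bar_def by (rule tp.rel_class_closed)

lemma comm_group_bar: "comm_group (bar A S k)"
  unfolding bar_def by (rule tp.comm_group_presented)

lemma keys_lmul:
  "a \<in> carrier A \<Longrightarrow> Poly_Mapping.keys z \<subseteq> gens n \<Longrightarrow>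
    Poly_Mapping.keys (frag_extend (\<lambda>xs. frag_of (lmul A a xs)) z) \<subseteq> gens n"
  by (erule keys_frag_extend_subset) (simp add: lmul_in_gens)

lemma keys_rmul:
  "a \<in> carrier A \<Longrightarrow> Poly_Mapping.keys z \<subseteq> gens n \<Longrightarrow>
    Poly_Mapping.keys (frag_extend (\<lambda>xs. frag_of (rmul A xs a)) z) \<subseteq> gens n"
  by (erule keys_frag_extend_subset) (simp add: rmul_in_gens)

lemma keys_codiff_extend:
  "Poly_Mapping.keys z \<subseteq> gens (Suc n) \<Longrightarrow> Poly_Mapping.keys (frag_extend (codiff A frag_of) z) \<subseteq> gens n"
  by (erule keys_frag_extend_subset) (simp add: keys_codiff)

text \<open>
  Both actions on the bar groups are additive in the scalar for the same reason: on each generator the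
  defect is an additivity relation.
\<close>

lemma bar_add_eqI:
  assumes z: "Poly_Mapping.keys z \<subseteq> gens (k + 2)"
    and k: "\<And>xs. xs \<in> gens (k + 2) \<Longrightarrow> F xs \<in> gens (k + 2) \<and> G xs \<in> gens (k + 2) \<and> H xs \<in> gens (k + 2)"
    and rel: "\<And>xs. xs \<in> gens (k + 2) \<Longrightarrow>
      frag_of (F xs) - frag_of (G xs) - frag_of (H xs) \<in> rel_subgroup (gens (k + 2)) (rels (k + 2))"
  shows "tcls (k + 2) (frag_extend (\<lambda>xs. frag_of (F xs)) z)
    = tcls (k + 2) (frag_extend (\<lambda>xs. frag_of (G xs)) z) \<otimes>\<^bsub>bar A S k\<^esub> tcls (k + 2) (frag_extend (\<lambda>xs. frag_of (H xs)) z)"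
proof -
  have keys: "Poly_Mapping.keys (frag_extend (\<lambda>xs. frag_of (E xs)) z) \<subseteq> gens (k + 2)"
    if "\<And>xs. xs \<in> gens (k + 2) \<Longrightarrow> E xs \<in> gens (k + 2)" for E
    using z by (rule keys_frag_extend_subset) (use that in auto)
  have "frag_extend (\<lambda>xs. frag_of (F xs) - frag_of (G xs) - frag_of (H xs)) z \<in> rel_subgroup (gens (k + 2)) (rels (k + 2))"
    by (rule tp.rel.frag_extend_mem[OF z rel])
  then have d: "frag_extend (\<lambda>xs. frag_of (F xs)) z - (frag_extend (\<lambda>xs. frag_of (G xs)) z + frag_extend (\<lambda>xs. frag_of (H xs)) z)
      \<in> rel_subgroup (gens (k + 2)) (rels (k + 2))"
    by (simp only: frag_extend_minus_fun frag_extend_plus diff_diff_eq)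
  have kF: "Poly_Mapping.keys (frag_extend (\<lambda>xs. frag_of (F xs)) z) \<subseteq> gens (k + 2)"
    and kG: "Poly_Mapping.keys (frag_extend (\<lambda>xs. frag_of (G xs)) z) \<subseteq> gens (k + 2)"
    and kH: "Poly_Mapping.keys (frag_extend (\<lambda>xs. frag_of (H xs)) z) \<subseteq> gens (k + 2)"
    using keys k by blast+
  have kGH: "Poly_Mapping.keys (frag_extend (\<lambda>xs. frag_of (G xs)) z + frag_extend (\<lambda>xs. frag_of (H xs)) z) \<subseteq> gens (k + 2)"
    using kG kH keys_add[of "frag_extend (\<lambda>xs. frag_of (G xs)) z" "frag_extend (\<lambda>xs. frag_of (H xs)) z"] by blast
  show ?thesis
    unfolding bar_def tp.rel_class_add[OF kG kH, symmetric]
    using tp.rel_class_eq_iff[OF kF kGH] d by blast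
qed

lemma tensorial_first_add:
  assumes "a \<in> carrier A" "b \<in> carrier A" "xs \<in> gens (k + 2)"
  shows "frag_of (lmul A (a \<oplus> b) xs) - frag_of (lmul A a xs) - frag_of (lmul A b xs)
    \<in> rel_subgroup (gens (k + 2)) (rels (k + 2))"
proof -
  obtain x ys where "xs = x # ys" "x \<in> carrier A" "ys \<in> gens (Suc k)"
    using assms(3) by (auto elim: tpower_gens_SucE)
  then show ?thesis
    using tf.tensorial_add[of "k + 2" "Suc k" frag_of "a \<otimes> x" "b \<otimes> x" ys] tensorial_frag_of[of "k + 2"] assms
    by (simp add: l_distr)
qed

lemma tensorial_last_add:
  assumes "a \<in> carrier A" "b \<in> carrier A" "xs \<in> gens (k + 2)"
  shows "frag_of (rmul A xs (a \<oplus> b)) - frag_of (rmul A xs a) - frag_of (rmul A xs b)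
    \<in> rel_subgroup (gens (k + 2)) (rels (k + 2))"
proof -
  have ne: "xs \<noteq> []" by (rule gens_nonempty[OF assms(3)])
  then have s: "set (butlast xs) \<subseteq> carrier A" "last xs \<in> carrier A"
    using assms(3) in_set_butlastD[of _ xs] by (auto simp: tpower_gens_def)
  have "frag_of (butlast xs @ [last xs \<otimes> a \<oplus> last xs \<otimes> b] @ []) - frag_of (butlast xs @ [last xs \<otimes> a] @ [])
      - frag_of (butlast xs @ [last xs \<otimes> b] @ []) \<in> rel_subgroup (gens (k + 2)) (rels (k + 2))"
    by (rule tf.tensorialD(1)[OF tensorial_frag_of]) (use s assms in \<open>auto simp: tpower_gens_def\<close>)
  then show ?thesis using s assms by (simp add: rmul_eq[OF ne] r_distr)
qed

lemma frag_extend_id_on: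
  "Poly_Mapping.keys z \<subseteq> X \<Longrightarrow> (\<And>x. x \<in> X \<Longrightarrow> f x = x) \<Longrightarrow> frag_extend (\<lambda>x. frag_of (f x)) z = z"
  by (induction z rule: frag_induction) (auto simp: frag_extend_diff)

lemma frag_extend_cong_on:
  "Poly_Mapping.keys z \<subseteq> X \<Longrightarrow> (\<And>x. x \<in> X \<Longrightarrow> f x = g x) \<Longrightarrow> frag_extend f z = frag_extend g z"
  by (rule frag_extend_eq) blast

lemma left_module_bar: "left_module A (bar A S k) (bar_lact A S k)"
proof -
  interpret B: comm_group "bar A S k" by (rule comm_group_bar)
  show ?thesis
  proof (unfold_locales, goal_cases)
    case (1 a)
    then show ?case by (rule bar_lact(1))
  next
    case (2 a b x)
    obtain z where z: "Poly_Mapping.keys z \<subseteq> gens (k + 2)" "x = tcls (k + 2) z"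
      using 2(3) by (rule bar_cases)
    show ?case
      unfolding z(2) bar_lact(2)[OF add.m_closed[OF 2(1,2)] z(1)] bar_lact(2)[OF 2(1) z(1)] bar_lact(2)[OF 2(2) z(1)]
      by (rule bar_add_eqI[OF z(1)]) (use 2 lmul_in_gens tensorial_first_add in auto)
  next
    case (3 a b x)
    have ab: "a \<otimes> b \<in> carrier A" using 3 by simp
    obtain z where z: "Poly_Mapping.keys z \<subseteq> gens (k + 2)" "x = tcls (k + 2) z"
      using 3(3) by (rule bar_cases)
    show ?case
      unfolding z(2) bar_lact(2)[OF ab z(1)] bar_lact(2)[OF 3(2) z(1)]
        bar_lact(2)[OF 3(1) keys_lmul[OF 3(2) z(1)]] frag_extend_frag_extend frag_extend_of
      by (rule arg_cong[of _ _ "tcls (k + 2)"], rule frag_extend_cong_on[OF z(1)])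
        (simp add: lmul_lmul[OF 3(1,2)])
  next
    case (4 x)
    have one: "\<one> \<in> carrier A" by simp
    obtain z where z: "Poly_Mapping.keys z \<subseteq> gens (k + 2)" "x = tcls (k + 2) z"
      using 4 by (rule bar_cases)
    have "lmul A \<one> xs = xs" if "xs \<in> gens (k + 2)" for xs
      using that by (cases xs) auto
    then show ?case
      unfolding z(2) bar_lact(2)[OF one z(1)] using frag_extend_id_on[OF z(1)] by metis
  qed
qed

lemma right_module_bar: "right_module A (bar A S k) (bar_ract A S k)"
proof -
  interpret B: comm_group "bar A S k" by (rule comm_group_bar)
  show ?thesis
  proof (unfold_locales, goal_cases)
    case (1 a)
    then show ?case by (rule bar_ract(1))
  next
    case (2 a b x)
    obtain z where z: "Poly_Mapping.keys z \<subseteq> gens (k + 2)" "x = tcls (k + 2) z"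
      using 2(3) by (rule bar_cases)
    show ?case
      unfolding z(2) bar_ract(2)[OF add.m_closed[OF 2(1,2)] z(1)] bar_ract(2)[OF 2(1) z(1)] bar_ract(2)[OF 2(2) z(1)]
      by (rule bar_add_eqI[OF z(1)]) (use 2 rmul_in_gens tensorial_last_add in auto)
  next
    case (3 a b x)
    have ab: "a \<otimes> b \<in> carrier A" using 3 by simp
    obtain z where z: "Poly_Mapping.keys z \<subseteq> gens (k + 2)" "x = tcls (k + 2) z"
      using 3(3) by (rule bar_cases)
    show ?case
      unfolding z(2) bar_ract(2)[OF ab z(1)] bar_ract(2)[OF 3(1) z(1)]
        bar_ract(2)[OF 3(2) keys_rmul[OF 3(1) z(1)]] frag_extend_frag_extend frag_extend_of
      by (rule arg_cong[of _ _ "tcls (k + 2)"], rule frag_extend_cong_on[OF z(1)])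
        (simp add: rmul_rmul[OF 3(1,2)])
  next
    case (4 x)
    have one: "\<one> \<in> carrier A" by simp
    obtain z where z: "Poly_Mapping.keys z \<subseteq> gens (k + 2)" "x = tcls (k + 2) z"
      using 4 by (rule bar_cases)
    have "rmul A xs \<one> = xs" if "xs \<in> gens (k + 2)" for xs
    proof -
      have "xs \<noteq> []" by (rule gens_nonempty[OF that])
      then have "last xs \<in> carrier A" using that by (auto simp: tpower_gens_def)
      with \<open>xs \<noteq> []\<close> show ?thesis by (simp add: rmul_eq)
    qed
    then show ?case
      unfolding z(2) bar_ract(2)[OF one z(1)] using frag_extend_id_on[OF z(1)] by metis
  qed
qed

lemma bar_lact_ract:
  assumes "a \<in> carrier A" "b \<in> carrier A" "x \<in> carrier (bar A S k)"
  shows "bar_lact A S k a (bar_ract A S k x b) = bar_ract A S k (bar_lact A S k a x) b"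
proof -
  obtain z where z: "Poly_Mapping.keys z \<subseteq> gens (k + 2)" "x = tcls (k + 2) z"
    using assms(3) by (rule bar_cases)
  show ?thesis
    unfolding z(2) bar_ract(2)[OF assms(2) z(1)] bar_lact(2)[OF assms(1) z(1)]
      bar_lact(2)[OF assms(1) keys_rmul[OF assms(2) z(1)]] bar_ract(2)[OF assms(2) keys_lmul[OF assms(1) z(1)]]
      frag_extend_frag_extend frag_extend_of
    by (rule arg_cong[of _ _ "tcls (k + 2)"], rule frag_extend_cong_on[OF z(1)])
      (simp add: lmul_rmul[OF assms(1,2)])
qed

lemma bar_diff_lact:
  assumes "a \<in> carrier A" "x \<in> carrier (bar A S (Suc k))"
  shows "bar_diff A S (Suc k) (bar_lact A S (Suc k) a x) = bar_lact A S k a (bar_diff A S (Suc k) x)"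
proof -
  obtain z where z: "Poly_Mapping.keys z \<subseteq> gens (Suc k + 2)" "x = tcls (Suc k + 2) z"
    using assms(2) by (rule bar_cases)
  have z': "Poly_Mapping.keys z \<subseteq> gens (Suc (k + 2))" using z(1) by simp
  show ?thesis
    unfolding z(2) bar_diff(2)[OF z(1)] bar_lact(2)[OF assms(1) z(1)]
      bar_diff(2)[OF keys_lmul[OF assms(1) z(1)]] bar_lact(2)[OF assms(1) keys_codiff_extend[OF z']]
      frag_extend_frag_extend frag_extend_of frag_extend_codiff
    by (rule arg_cong[of _ _ "tcls (k + 2)"], rule frag_extend_cong_on[OF z(1)])
      (rule codiff_lmul[OF assms(1), symmetric])
qed

lemma bar_diff_ract:
  assumes "a \<in> carrier A" "x \<in> carrier (bar A S (Suc k))"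
  shows "bar_diff A S (Suc k) (bar_ract A S (Suc k) x a) = bar_ract A S k (bar_diff A S (Suc k) x) a"
proof -
  obtain z where z: "Poly_Mapping.keys z \<subseteq> gens (Suc k + 2)" "x = tcls (Suc k + 2) z"
    using assms(2) by (rule bar_cases)
  have z': "Poly_Mapping.keys z \<subseteq> gens (Suc (k + 2))" using z(1) by simp
  have "2 \<le> Suc k + 2" by simp
  then show ?thesis
    unfolding z(2) bar_diff(2)[OF z(1)] bar_ract(2)[OF assms(1) z(1)]
      bar_diff(2)[OF keys_rmul[OF assms(1) z(1)]] bar_ract(2)[OF assms(1) keys_codiff_extend[OF z']]
      frag_extend_frag_extend frag_extend_of frag_extend_codiff
    by (intro arg_cong[of _ _ "tcls (k + 2)"] frag_extend_cong_on[OF z(1)])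
      (rule codiff_rmul[OF assms(1), symmetric])
qed

lemma bar_diff_bar_diff:
  assumes "x \<in> carrier (bar A S (Suc (Suc k)))"
  shows "bar_diff A S (Suc k) (bar_diff A S (Suc (Suc k)) x) = \<one>\<^bsub>bar A S k\<^esub>"
proof -
  obtain z where z: "Poly_Mapping.keys z \<subseteq> gens (Suc (Suc k) + 2)" "x = tcls (Suc (Suc k) + 2) z"
    using assms by (rule bar_cases)
  have z': "Poly_Mapping.keys z \<subseteq> gens (Suc (Suc k + 2))" using z(1) by simp
  have "frag_extend (codiff A (codiff A frag_of)) z = 0"
    by (rule frag_extend_eq_0) (use codiff_codiff z(1) in blast)
  then show ?thesis
    unfolding z(2) bar_diff(2)[OF z(1)] bar_diff(2)[OF keys_codiff_extend[OF z']]
      frag_extend_frag_extend frag_extend_codiff frag_extend_of bar_def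
    using tp.rel_class_0[of "k + 2"] by simp
qed

end

section \<open>The complex computing relative Tor of a quotient by an ideal\<close>

text \<open>
  The complex for \<open>A/I\<close> on both sides.  It is the quotient of the bar complex by the tensors with first
  or last entry in \<open>I\<close>: the chain map \<open>\<zeta>\<close> below is onto, and \<open>hom_factors_through_\<zeta>\<close> says that its
  kernel is no larger.
\<close>

locale cyclic_tor = relative_pair A S + cyclic_quotient I A N q rN lN
  for A :: "('a, 'm) ring_scheme" (structure) and S I
    and N :: "('n, 'y) monoid_scheme" and q rN lN
begin

abbreviation "NB k \<equiv> N_bar A S N rN k"
abbreviation "rNB k \<equiv> N_bar_ract A S N rN k"
abbreviation "C k \<equiv> rel_Tor_complex A S N rN N lN k"
abbreviation "D k \<equiv> rel_Tor_diff A S N rN N lN k"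
abbreviation "unit \<equiv> q \<one>"

definition \<iota> :: "nat \<Rightarrow> ('a list \<Rightarrow>\<^sub>0 int) set \<Rightarrow> ('n, 'a) tensor_bar" where
  "\<iota> k x = pure_tensor (carrier A) N rN (bar A S k) (bar_lact A S k) unit x"

text \<open>
  The chain map \<open>x \<mapsto> 1 \<otimes> x \<otimes> 1\<close>.
\<close>

definition \<zeta> :: "nat \<Rightarrow> ('a list \<Rightarrow>\<^sub>0 int) set \<Rightarrow> ((('n, 'a) tensor_bar \<times> 'n) \<Rightarrow>\<^sub>0 int) set" where
  "\<zeta> k x = pure_tensor (carrier A) (NB k) (rNB k) N lN (\<iota> k x) unit"

lemma tensor_data_NB: "tensor_data (carrier A) N rN (bar A S k) (bar_lact A S k)"
  by (rule tensor_data_left[OF left_module_bar])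

lemma unit_closed: "unit \<in> carrier N"
  by (rule q_closed) simp

lemma NB_cases:
  assumes "t \<in> carrier (NB k)"
  obtains x where "x \<in> carrier (bar A S k)" "t = \<iota> k x"
  using assms unfolding N_bar_def \<iota>_def by (rule tensor_left_cases[OF left_module_bar])

lemma comm_group_NB: "comm_group (NB k)"
proof -
  interpret T: tensor_data "carrier A" N rN "bar A S k" "bar_lact A S k" by (rule tensor_data_NB)
  show ?thesis unfolding N_bar_def by (rule T.T.comm_group_axioms)
qed

lemma \<iota>_hom: "\<iota> k \<in> hom (bar A S k) (NB k)"
proof -
  interpret T: tensor_data "carrier A" N rN "bar A S k" "bar_lact A S k" by (rule tensor_data_NB)
  show ?thesis unfolding N_bar_def \<iota>_def[abs_def] by (rule T.pure_hom_right[OF unit_closed])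
qed

lemma \<iota>_closed: "x \<in> carrier (bar A S k) \<Longrightarrow> \<iota> k x \<in> carrier (NB k)"
  using \<iota>_hom by (rule hom_in_carrier)

lemma NB_ract:
  assumes a: "a \<in> carrier A"
  shows "(\<lambda>t. rNB k t a) \<in> hom (NB k) (NB k)"
    and "x \<in> carrier (bar A S k) \<Longrightarrow> rNB k (\<iota> k x) a = \<iota> k (bar_ract A S k x a)"
proof -
  show "(\<lambda>t. rNB k t a) \<in> hom (NB k) (NB k)"
    unfolding N_bar_ract_def N_bar_def
    by (rule tensor_map_hom[OF tensor_data_NB tensor_data_NB _ _ bar_ract(1)[OF a]])
      (simp_all add: hom_def bar_lact_ract a)
  show "rNB k (\<iota> k x) a = \<iota> k (bar_ract A S k x a)" if "x \<in> carrier (bar A S k)"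
    unfolding N_bar_ract_def \<iota>_def
    by (subst tensor_map_pure[OF tensor_data_NB tensor_data_NB _ _ bar_ract(1)[OF a]])
      (use that unit_closed in \<open>simp_all add: hom_def bar_lact_ract a\<close>)
qed

lemma right_module_NB: "right_module A (NB k) (rNB k)"
proof -
  interpret NB: comm_group "NB k" by (rule comm_group_NB)
  interpret B: right_module A "bar A S k" "bar_ract A S k" by (rule right_module_bar)
  show ?thesis
  proof (unfold_locales, goal_cases)
    case (1 a)
    then show ?case by (rule NB_ract(1))
  next
    case (2 a b t)
    obtain x where x: "x \<in> carrier (bar A S k)" "t = \<iota> k x" using 2(3) by (rule NB_cases)
    show ?case
      unfolding x(2) NB_ract(2)[OF 2(1) x(1)] NB_ract(2)[OF 2(2) x(1)] NB_ract(2)[OF add.m_closed[OF 2(1,2)] x(1)]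
      using B.ract_add[OF 2(1,2) x(1)] hom_mult[OF \<iota>_hom] B.ract_closed 2 x(1) by simp
  next
    case (3 a b t)
    obtain x where x: "x \<in> carrier (bar A S k)" "t = \<iota> k x" using 3(3) by (rule NB_cases)
    have ab: "a \<otimes> b \<in> carrier A" using 3 by simp
    show ?case
      unfolding x(2) NB_ract(2)[OF 3(1) x(1)] NB_ract(2)[OF 3(2) B.ract_closed[OF 3(1) x(1)]] NB_ract(2)[OF ab x(1)]
        B.ract_mult[OF 3(1,2) x(1)] ..
  next
    case (4 t)
    obtain x where x: "x \<in> carrier (bar A S k)" "t = \<iota> k x" using 4 by (rule NB_cases)
    have one: "\<one> \<in> carrier A" by simp
    show ?case unfolding x(2) NB_ract(2)[OF one x(1)] B.ract_one[OF x(1)] ..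
  qed
qed

lemma tensor_data_C: "tensor_data (carrier A) (NB k) (rNB k) N lN"
  by (rule tensor_data_right[OF right_module_NB])

lemma comm_group_C: "comm_group (C k)"
proof -
  interpret T: tensor_data "carrier A" "NB k" "rNB k" N lN by (rule tensor_data_C)
  show ?thesis unfolding rel_Tor_complex_def by (rule T.T.comm_group_axioms)
qed

lemma \<zeta>_hom: "\<zeta> k \<in> hom (bar A S k) (C k)"
proof -
  interpret T: tensor_data "carrier A" "NB k" "rNB k" N lN by (rule tensor_data_C)
  have "(\<lambda>t. T.pure t unit) \<in> hom (NB k) T.T" by (rule T.pure_hom_left[OF unit_closed])
  from hom_compose[OF \<iota>_hom this] show ?thesis
    unfolding rel_Tor_complex_def \<zeta>_def[abs_def] by (simp add: comp_def)
qed

lemma C_cases: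
  assumes "c \<in> carrier (C k)"
  obtains x where "x \<in> carrier (bar A S k)" "c = \<zeta> k x"
proof -
  obtain t where "t \<in> carrier (NB k)" "c = pure_tensor (carrier A) (NB k) (rNB k) N lN t unit"
    using assms unfolding rel_Tor_complex_def by (rule tensor_right_cases[OF right_module_NB])
  moreover obtain x where "x \<in> carrier (bar A S k)" "t = \<iota> k x"
    using calculation(1) by (rule NB_cases)
  ultimately show thesis using that by (simp add: \<zeta>_def)
qed

lemma \<zeta>_lact_ideal: "i \<in> I \<Longrightarrow> x \<in> carrier (bar A S k) \<Longrightarrow> \<zeta> k (bar_lact A S k i x) = \<one>\<^bsub>C k\<^esub>"
proof -
  assume ix: "i \<in> I" "x \<in> carrier (bar A S k)"
  interpret T: tensor_data "carrier A" "NB k" "rNB k" N lN by (rule tensor_data_C)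
  have "\<iota> k (bar_lact A S k i x) = \<one>\<^bsub>NB k\<^esub>"
    unfolding \<iota>_def N_bar_def by (rule pure_left_ideal[OF left_module_bar ix])
  then show ?thesis
    using hom_one[OF T.pure_hom_left[OF unit_closed] T.M.is_group T.T.is_group]
    unfolding \<zeta>_def rel_Tor_complex_def by simp
qed

lemma \<zeta>_ract_ideal:
  assumes "i \<in> I" "x \<in> carrier (bar A S k)"
  shows "\<zeta> k (bar_ract A S k x i) = \<one>\<^bsub>C k\<^esub>"
  using pure_right_ideal[OF right_module_NB assms(1) \<iota>_closed[OF assms(2)]]
    NB_ract(2)[OF Icarr[OF assms(1)] assms(2)]
  unfolding \<zeta>_def rel_Tor_complex_def by simp

text \<open>
  First divide out \<open>I\<close> on the left and then on the right; the second step applies because the right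
  action on \<open>N \<otimes>\<^sub>A \<beta>\<^sub>k\<close> is inherited from the bar group.
\<close>

lemma hom_factors_through_\<zeta>:
  assumes G: "comm_group G" and \<gamma>: "\<gamma> \<in> hom (bar A S k) G"
    and l: "\<And>i x. i \<in> I \<Longrightarrow> x \<in> carrier (bar A S k) \<Longrightarrow> \<gamma> (bar_lact A S k i x) = \<one>\<^bsub>G\<^esub>"
    and r: "\<And>i x. i \<in> I \<Longrightarrow> x \<in> carrier (bar A S k) \<Longrightarrow> \<gamma> (bar_ract A S k x i) = \<one>\<^bsub>G\<^esub>"
  obtains h where "h \<in> hom (C k) G" "\<And>x. x \<in> carrier (bar A S k) \<Longrightarrow> h (\<zeta> k x) = \<gamma> x"
proof -
  obtain h where h: "h \<in> hom (NB k) G" and h\<iota>: "\<And>x. x \<in> carrier (bar A S k) \<Longrightarrow> h (\<iota> k x) = \<gamma> x"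
    using tensor_left_hom[OF left_module_bar G \<gamma> l] unfolding N_bar_def \<iota>_def by blast
  interpret B: right_module A "bar A S k" "bar_ract A S k" by (rule right_module_bar)
  have "h (rNB k t i) = \<one>\<^bsub>G\<^esub>" if i: "i \<in> I" and t: "t \<in> carrier (NB k)" for i t
  proof -
    obtain x where x: "x \<in> carrier (bar A S k)" "t = \<iota> k x" using t by (rule NB_cases)
    show ?thesis
      unfolding x(2) NB_ract(2)[OF Icarr[OF i] x(1)]
      using h\<iota>[OF B.ract_closed[OF Icarr[OF i] x(1)]] r[OF i x(1)] by simp
  qed
  then obtain h' where h': "h' \<in> hom (C k) G"
    "\<And>t. t \<in> carrier (NB k) \<Longrightarrow> h' (pure_tensor (carrier A) (NB k) (rNB k) N lN t unit) = h t"
    using tensor_right_hom[OF right_module_NB G h] unfolding rel_Tor_complex_def by blast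
  show thesis
    by (rule that[OF h'(1)]) (simp add: \<zeta>_def h'(2) \<iota>_closed h\<iota>)
qed

lemma NB_diff:
  shows "N_bar_diff A S N rN (Suc k) \<in> hom (NB (Suc k)) (NB k)"
    and "\<And>x. x \<in> carrier (bar A S (Suc k)) \<Longrightarrow>
      N_bar_diff A S N rN (Suc k) (\<iota> (Suc k) x) = \<iota> k (bar_diff A S (Suc k) x)"
proof -
  show "N_bar_diff A S N rN (Suc k) \<in> hom (NB (Suc k)) (NB k)"
    unfolding N_bar_diff_def N_bar_def diff_Suc_1
    by (rule tensor_map_hom[OF tensor_data_NB tensor_data_NB _ _ bar_diff(1)])
      (simp_all add: hom_def bar_diff_lact)
  show "N_bar_diff A S N rN (Suc k) (\<iota> (Suc k) x) = \<iota> k (bar_diff A S (Suc k) x)"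
    if "x \<in> carrier (bar A S (Suc k))" for x
    unfolding N_bar_diff_def \<iota>_def diff_Suc_1
    by (subst tensor_map_pure[OF tensor_data_NB tensor_data_NB _ _ bar_diff(1)])
      (use that unit_closed in \<open>simp_all add: hom_def bar_diff_lact\<close>)
qed

lemma NB_diff_ract:
  assumes "t \<in> carrier (NB (Suc k))" "a \<in> carrier A"
  shows "N_bar_diff A S N rN (Suc k) (rNB (Suc k) t a) = rNB k (N_bar_diff A S N rN (Suc k) t) a"
proof -
  interpret B: right_module A "bar A S (Suc k)" "bar_ract A S (Suc k)" by (rule right_module_bar)
  obtain x where x: "x \<in> carrier (bar A S (Suc k))" "t = \<iota> (Suc k) x" using assms(1) by (rule NB_cases)
  show ?thesis
    unfolding x(2) NB_ract(2)[OF assms(2) x(1)] NB_diff(2)[OF B.ract_closed[OF assms(2) x(1)]] NB_diff(2)[OF x(1)]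
      NB_ract(2)[OF assms(2) hom_in_carrier[OF bar_diff(1) x(1)]] bar_diff_ract[OF assms(2) x(1)] ..
qed

lemma C_diff:
  shows "D (Suc k) \<in> hom (C (Suc k)) (C k)"
    and "\<And>x. x \<in> carrier (bar A S (Suc k)) \<Longrightarrow> D (Suc k) (\<zeta> (Suc k) x) = \<zeta> k (bar_diff A S (Suc k) x)"
proof -
  show "D (Suc k) \<in> hom (C (Suc k)) (C k)"
    unfolding rel_Tor_diff_def rel_Tor_complex_def diff_Suc_1
    by (rule tensor_map_hom[OF tensor_data_C tensor_data_C NB_diff(1)])
      (simp_all add: hom_def NB_diff_ract)
  show "D (Suc k) (\<zeta> (Suc k) x) = \<zeta> k (bar_diff A S (Suc k) x)" if "x \<in> carrier (bar A S (Suc k))" for x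
    unfolding rel_Tor_diff_def \<zeta>_def diff_Suc_1 NB_diff(2)[OF that, symmetric]
    by (subst tensor_map_pure[OF tensor_data_C tensor_data_C NB_diff(1)])
      (use that unit_closed in \<open>simp_all add: hom_def NB_diff_ract \<iota>_closed\<close>)
qed

lemma C_diff_C_diff:
  assumes "c \<in> carrier (C (Suc (Suc k)))"
  shows "D (Suc k) (D (Suc (Suc k)) c) = \<one>\<^bsub>C k\<^esub>"
proof -
  obtain x where x: "x \<in> carrier (bar A S (Suc (Suc k)))" "c = \<zeta> (Suc (Suc k)) x"
    using assms by (rule C_cases)
  have "\<zeta> k \<one>\<^bsub>bar A S k\<^esub> = \<one>\<^bsub>C k\<^esub>"
    by (rule hom_one[OF \<zeta>_hom comm_group.axioms(2)[OF comm_group_bar] comm_group.axioms(2)[OF comm_group_C]])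
  then show ?thesis
    unfolding x(2) C_diff(2)[OF x(1)] C_diff(2)[OF hom_in_carrier[OF bar_diff(1) x(1)]] bar_diff_bar_diff[OF x(1)] .
qed

lemma trivial_Tor_if_exact:
  assumes "\<And>c. c \<in> carrier (C (Suc k)) \<Longrightarrow> D (Suc k) c = \<one>\<^bsub>C k\<^esub> \<Longrightarrow>
    c \<in> D (Suc (Suc k)) ` carrier (C (Suc (Suc k)))"
  shows "trivial_group (rel_Tor A S N rN N lN (Suc k))"
proof -
  let ?Z = "kernel (C (Suc k)) (C k) (D (Suc k))"
  interpret d: group_hom "C (Suc k)" "C k" "D (Suc k)"
    using C_diff(1) comm_group_C by (simp add: group_hom_def group_hom_axioms_def comm_group.axioms(2))
  have im: "D (Suc (Suc k)) ` carrier (C (Suc (Suc k))) = ?Z"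
    using assms C_diff_C_diff hom_in_carrier[OF C_diff(1)] by (auto simp: kernel_def)
  interpret Z: group "(C (Suc k))\<lparr>carrier := ?Z\<rparr>"
    by (rule subgroup.subgroup_is_group[OF d.subgroup_kernel d.G.is_group])
  have "trivial_group ((C (Suc k))\<lparr>carrier := ?Z\<rparr> Mod carrier ((C (Suc k))\<lparr>carrier := ?Z\<rparr>))"
    unfolding trivial_group_def
    using normal.factorgroup_is_group[OF Z.normal_self] Z.coset_join2[OF _ Z.subgroup_self] Z.one_closed
    by (auto simp: carrier_FactGroup)
  then show ?thesis
    unfolding rel_Tor_def chain_homology_def by (simp add: im)
qed

text \<open>
  Let \<open>K\<close> consist of the formal sums of lists whose image in the complex is a boundary.  Modulo \<open>K\<close>, the
  function \<open>frag_of\<close> is a cocycle that vanishes on lists with first or last entry in \<open>I\<close>.  Hence it is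
  the coboundary of some \<open>g\<close> with the same vanishing property.  This \<open>g\<close> induces a homomorphism \<open>h\<close> on
  the chains one degree lower, and \<open>h \<circ> D\<close> is the projection modulo \<open>K\<close>.  So a cycle is zero modulo
  \<open>K\<close>, that is, a boundary.
\<close>

theorem Tor_vanishes:
  assumes fac: "twisted_factorization A S L U fac" and e: "e \<in> S" "e \<otimes> e = e"
    and LU: "lower_triangular A e L" "upper_triangular A e U" and I_eq: "I = AeA A e"
  shows "trivial_group (rel_Tor A S N rN N lN (Suc k))"
proof -
  interpret twisted_factorization A S L U fac by fact
  show ?thesis
  proof (rule trivial_Tor_if_exact)
    fix c assume c: "c \<in> carrier (C (Suc k))" "D (Suc k) c = \<one>\<^bsub>C k\<^esub>"
    let ?n = "Suc k + 2"
    let ?B = "D (Suc (Suc k)) ` carrier (C (Suc (Suc k)))"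
    define K where "K = {z. Poly_Mapping.keys z \<subseteq> gens ?n \<and> \<zeta> (Suc k) (tcls ?n z) \<in> ?B}"
    interpret d: group_hom "C (Suc (Suc k))" "C (Suc k)" "D (Suc (Suc k))"
      using C_diff(1) comm_group_C by (simp add: group_hom_def group_hom_axioms_def comm_group.axioms(2))
    interpret z: group_hom "bar A S (Suc k)" "C (Suc k)" "\<zeta> (Suc k)"
      using \<zeta>_hom comm_group_C comm_group_bar by (simp add: group_hom_def group_hom_axioms_def comm_group.axioms(2))
    have B: "subgroup ?B (C (Suc k))" by (rule d.img_is_subgroup)
    have one_B: "\<zeta> (Suc k) \<one>\<^bsub>bar A S (Suc k)\<^esub> \<in> ?B"
      using subgroup.one_closed[OF B] by simp
    have rel_K: "r \<in> K" if "r \<in> rel_subgroup (gens ?n) (rels ?n)" for r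
      using that tp.rel_subgroup_keys[OF that] tp.rel_class_eq_one_iff[of r ?n] one_B
      unfolding K_def bar_def by simp
    interpret K: frag_subgroup K
    proof
      show "0 \<in> K" by (rule rel_K) (rule tp.rel.zero_mem)
      fix x y assume xy: "x \<in> K" "y \<in> K"
      then have k: "Poly_Mapping.keys x \<subseteq> gens ?n" "Poly_Mapping.keys y \<subseteq> gens ?n"
        and b: "\<zeta> (Suc k) (tcls ?n x) \<in> ?B" "\<zeta> (Suc k) (tcls ?n y) \<in> ?B"
        by (simp_all add: K_def)
      have "\<zeta> (Suc k) (tcls ?n (x - y)) = \<zeta> (Suc k) (tcls ?n x) \<otimes>\<^bsub>C (Suc k)\<^esub> inv\<^bsub>C (Suc k)\<^esub> \<zeta> (Suc k) (tcls ?n y)"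
        using tp.rel_class_diff[OF k] tcls_closed[OF k(1)] tcls_closed[OF k(2)]
        unfolding bar_def[symmetric] by simp
      also have "\<dots> \<in> ?B"
        using subgroup.m_closed[OF B b(1) subgroup.m_inv_closed[OF B b(2)]] .
      finally show "x - y \<in> K"
        using k keys_diff[of x y] unfolding K_def by blast
    qed
    interpret LU_homotopy A S L U fac K e
      by unfold_locales (use e LU in auto)
    have frag_K: "frag_of xs \<in> K" if "xs \<in> gens ?n" "\<zeta> (Suc k) (tcls ?n (frag_of xs)) \<in> ?B" for xs
      using that by (simp add: K_def)
    obtain g where g: "tensorial (Suc (Suc k)) g"
      and g_ends: "\<And>ys. ys \<in> gens (Suc (Suc k)) \<Longrightarrow> hd ys \<in> I \<or> last ys \<in> I \<Longrightarrow> g ys \<in> K"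
      and g_diff: "\<And>ys. ys \<in> gens (Suc (Suc (Suc k))) \<Longrightarrow> codiff A g ys - frag_of ys \<in> K"
    proof (rule cocycle_is_coboundary[of "Suc k" frag_of, folded I_eq])
      show "tensorial (Suc (Suc (Suc k))) frag_of"
        unfolding tensorial_def frag_expansion[symmetric] using rel_K tp.rels_mem[of _ ?n] by simp
    next
      fix ys assume ys: "ys \<in> gens (Suc (Suc (Suc k)))" and ends: "hd ys \<in> I \<or> last ys \<in> I"
      have ys': "ys \<in> gens ?n" using ys by simp
      have ne: "ys \<noteq> []" using ys by auto
      have "\<zeta> (Suc k) (tcls ?n (frag_of ys)) = \<one>\<^bsub>C (Suc k)\<^esub>"
        using ends
      proof
        assume i: "hd ys \<in> I"
        \<comment> \<open>The list is \<open>hd ys\<close> acting on a list that starts with \<open>1\<close>.\<close>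
        let ?xs = "\<one> # tl ys"
        have xs: "?xs \<in> gens ?n" using ys by (auto elim!: tpower_gens_SucE)
        have "lmul A (hd ys) ?xs = ys" using ne Icarr[OF i] by simp
        then have "tcls ?n (frag_of ys) = bar_lact A S (Suc k) (hd ys) (tcls ?n (frag_of ?xs))"
          using bar_lact(2)[OF Icarr[OF i], of "frag_of ?xs" "Suc k"] xs by simp
        then show ?thesis using \<zeta>_lact_ideal[OF i tcls_closed] xs by simp
      next
        assume i: "last ys \<in> I"
        let ?xs = "butlast ys @ [\<one>]"
        have "length ?xs = length ys" using ne by simp
        then have xs: "?xs \<in> gens ?n" using ys in_set_butlastD[of _ ys] by (auto simp: tpower_gens_def)
        have "rmul A ?xs (last ys) = ys" using ne Icarr[OF i] by (simp add: rmul_eq)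
        then have "tcls ?n (frag_of ys) = bar_ract A S (Suc k) (tcls ?n (frag_of ?xs)) (last ys)"
          using bar_ract(2)[OF Icarr[OF i], of "frag_of ?xs" "Suc k"] xs by simp
        then show ?thesis using \<zeta>_ract_ideal[OF i tcls_closed] xs by simp
      qed
      then show "frag_of ys \<in> K" using frag_K[OF ys'] subgroup.one_closed[OF B] by simp
    next
      fix ys assume ys: "ys \<in> gens (Suc (Suc (Suc (Suc k))))"
      then have ys': "Poly_Mapping.keys (frag_of ys) \<subseteq> gens (Suc (Suc k) + 2)" by simp
      have "tcls ?n (codiff A frag_of ys) = bar_diff A S (Suc (Suc k)) (tcls (Suc (Suc k) + 2) (frag_of ys))"
        unfolding bar_diff(2)[OF ys'] frag_extend_of ..
      then have "\<zeta> (Suc k) (tcls ?n (codiff A frag_of ys))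
          = D (Suc (Suc k)) (\<zeta> (Suc (Suc k)) (tcls (Suc (Suc k) + 2) (frag_of ys)))"
        by (simp only: C_diff(2)[OF tcls_closed[OF ys']])
      then have "\<zeta> (Suc k) (tcls ?n (codiff A frag_of ys)) \<in> ?B"
        using hom_in_carrier[OF \<zeta>_hom tcls_closed[OF ys']] by (simp only: imageI)
      then show "codiff A frag_of ys \<in> K" using keys_codiff[of ys ?n] ys by (simp add: K_def)
    qed blast
    \<comment> \<open>The values of \<open>g\<close> are only known modulo \<open>K\<close> and may involve lists of any length, hence \<open>UNIV\<close>.\<close>
    have pK: "presentation UNIV K" by unfold_locales auto
    interpret P: presentation UNIV K by (rule pK)
    have relK: "z \<in> K" if "z \<in> rel_subgroup UNIV K" for z
      using that by (induction z rule: P.rel_subgroup_induct) (auto intro: K.diff_mem)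
    let ?G = "presented_group UNIV K"
    let ?F = "\<lambda>z. rel_class UNIV K (frag_extend g z)"
    have oneK: "rel_class UNIV K z = \<one>\<^bsub>?G\<^esub> \<longleftrightarrow> z \<in> K" for z
      using P.rel_class_eq_one_iff[of z] relK P.rels_mem by auto
    have F: "?F \<in> hom (free_Abelian_group (gens (k + 2))) ?G"
      by (rule homI) (simp_all add: P.rel_class_closed P.rel_class_add frag_extend_add)
    have "?F r = \<one>\<^bsub>?G\<^esub>" if "r \<in> rels (k + 2)" for r
      unfolding oneK using g that by (simp add: tensorial_def)
    then obtain \<gamma> where \<gamma>: "\<gamma> \<in> hom (bar A S k) ?G"
      and \<gamma>_cls: "\<And>z. Poly_Mapping.keys z \<subseteq> gens (k + 2) \<Longrightarrow> \<gamma> (tcls (k + 2) z) = ?F z"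
      using tp.presented_group_universal[OF P.group_presented F] unfolding bar_def by blast
    obtain h where h: "h \<in> hom (C k) ?G" "\<And>x. x \<in> carrier (bar A S k) \<Longrightarrow> h (\<zeta> k x) = \<gamma> x"
    proof (rule hom_factors_through_\<zeta>[OF P.comm_group_presented \<gamma>])
      fix i x assume i: "i \<in> I" and x: "x \<in> carrier (bar A S k)"
      obtain z where z: "Poly_Mapping.keys z \<subseteq> gens (k + 2)" "x = tcls (k + 2) z"
        using x by (rule bar_cases)
      have "frag_extend (\<lambda>xs. g (lmul A i xs)) z \<in> K"
      proof (rule K.frag_extend_mem[OF z(1)])
        fix xs assume xs: "xs \<in> gens (k + 2)"
        then obtain y ys where "xs = y # ys" "y \<in> carrier A" by (auto elim: tpower_gens_SucE)
        then show "g (lmul A i xs) \<in> K"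
          using g_ends[of "lmul A i xs"] lmul_in_gens[OF Icarr[OF i] xs] I_r_closed[OF i] by simp
      qed
      then show "\<gamma> (bar_lact A S k i x) = \<one>\<^bsub>?G\<^esub>"
        unfolding z(2) bar_lact(2)[OF Icarr[OF i] z(1)] \<gamma>_cls[OF keys_lmul[OF Icarr[OF i] z(1)]]
          frag_extend_frag_extend frag_extend_of oneK .
      have "frag_extend (\<lambda>xs. g (rmul A xs i)) z \<in> K"
      proof (rule K.frag_extend_mem[OF z(1)])
        fix xs assume xs: "xs \<in> gens (k + 2)"
        have ne: "xs \<noteq> []" by (rule gens_nonempty[OF xs])
        then have "last xs \<in> carrier A" using xs by (auto simp: tpower_gens_def)
        then show "g (rmul A xs i) \<in> K"
          using g_ends[of "rmul A xs i"] rmul_in_gens[OF Icarr[OF i] xs] I_l_closed[OF i] ne by (simp add: rmul_eq)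
      qed
      then show "\<gamma> (bar_ract A S k x i) = \<one>\<^bsub>?G\<^esub>"
        unfolding z(2) bar_ract(2)[OF Icarr[OF i] z(1)] \<gamma>_cls[OF keys_rmul[OF Icarr[OF i] z(1)]]
          frag_extend_frag_extend frag_extend_of oneK .
    qed blast
    obtain x where x: "x \<in> carrier (bar A S (Suc k))" "c = \<zeta> (Suc k) x" using c(1) by (rule C_cases)
    obtain z where z: "Poly_Mapping.keys z \<subseteq> gens ?n" "x = tcls ?n z" using x(1) by (rule bar_cases)
    have z': "Poly_Mapping.keys z \<subseteq> gens (Suc (k + 2))" using z(1) by simp
    \<comment> \<open>Evaluate \<open>h (D c) = 1\<close> on a representative \<open>z\<close> of the cycle \<open>c\<close>.\<close>
    have "\<gamma> (bar_diff A S (Suc k) x) = h (D (Suc k) c)"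
      unfolding x(2) C_diff(2)[OF x(1)] by (rule h(2)[symmetric, OF hom_in_carrier[OF bar_diff(1) x(1)]])
    also have "\<dots> = \<one>\<^bsub>?G\<^esub>"
      unfolding c(2) by (rule hom_one[OF h(1) comm_group.axioms(2)[OF comm_group_C] P.group_presented])
    finally have "frag_extend (codiff A g) z \<in> K"
      unfolding z(2) bar_diff(2)[OF z(1)] \<gamma>_cls[OF keys_codiff_extend[OF z']] frag_extend_frag_extend
        frag_extend_codiff frag_extend_of oneK .
    moreover have "frag_extend (\<lambda>ys. codiff A g ys - frag_of ys) z \<in> K"
      by (rule K.frag_extend_mem[OF z(1)]) (use g_diff in simp)
    ultimately have "frag_extend (codiff A g) z - (frag_extend (codiff A g) z - frag_extend frag_of z) \<in> K"
      unfolding frag_extend_minus_fun by (rule K.diff_mem)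
    then have "z \<in> K" by (simp add: frag_expansion[symmetric])
    then show "c \<in> ?B" unfolding x(2) z(2) K_def by simp
  qed
qed

end

section \<open>The stratifying property\<close>

theorem theorem3p7:
  fixes A :: "('a, 'm) ring_scheme" (structure)
    and S L U :: "'a set" and e :: 'a
  assumes "relative_pair A S"
    and "e \<in> S" and "e \<otimes> e = e"
    and "diagonal A e S"
    and "LU_decomposition A S e L U"
  shows "rel_stratifying A S (AeA A e)"
proof -
  interpret relative_pair A S by fact
  have e: "e \<in> carrier A" using assms(2) subset by blast
  have LU: "subring L A" "S \<subseteq> L" "subring U A" "S \<subseteq> U" "twisted_product A S L U"
    "lower_triangular A e L" "upper_triangular A e U"
    using assms(5) unfolding LU_decomposition_def by auto
  obtain fac where fac: "twisted_factorization A S L U fac"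
    by (rule twisted_product_factorization[OF LU(1,3,2,4,5)])
  have "cyclic_tor A S (AeA A e) (add_monoid (A Quot AeA A e)) ((+>) (AeA A e))
      (quot_ract A (AeA A e)) (quot_lact A (AeA A e))"
    by (intro cyclic_tor.intro relative_pair_axioms ideal.cyclic_quotient_Quot ideal_AeA e)
  from cyclic_tor.Tor_vanishes[OF this fac assms(2,3) LU(6,7) refl] show ?thesis
    unfolding rel_stratifying_def by (metis Suc_le_D One_nat_def)
qed

end
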